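(* Let $F \subset B(L_\infty(\Omega))$ and assume that the integral $$\int_0^1 \sqrt{\mathrm{fat}_{t/8}(F)}\;\log\frac{2}{t}\;dt$$ converges. Then $F$ is a uniform Donsker class.
   Context: $\Omega$ is a measurable space and $B(L_\infty(\Omega))$ is the set of measurable functions $f:\Omega\to\mathbb{R}$ with $\sup_{x \in \Omega}|f(x)|\le1$. For $\varepsilon>0$, a finite set $A=\{y_1,\dots,y_m\}\subset\Omega$ is $\varepsilon$-shattered by $F$ if there is a function $\gamma:A\to\mathbb{R}$ such that for every $I\subset\{1,\dots,m\}$ there is $f_I\in F$ with $f_I(y_i)\ge\gamma(y_i)+\varepsilon$ if $i\in I$ and $f_I(y_i)\le\gamma(y_i)-\varepsilon$ if $i\notin I$. The fat-shattering dimension is $\mathrm{fat}_\varepsilon(F)=\sup\{|A| : A\subset\Omega \text{ is } \varepsilon\text{-shattered by } F\}\in\{0,1,2,\dots\}\cup\{\infty\}$. For a probability measure $P$ on $\Omega$, let $G_P$ be the Gaussian process indexed by $F$ with mean $0$ and covariance $\mathbb{E}\,G_P(f)G_P(g)=\int fg\,dP-\int f\,dP\int g\,dP$; for $h=f-g$ with $f,g\in F$ put $G_P(h)=G_P(f)-G_P(g)$. Let $\rho_P^2(f,g)=\mathbb{E}_P(f-g)^2-(\mathbb{E}_P(f-g))^2$ and, for $\delta>0$, $F_\delta=\{f-g : f,g\in F,\ \rho_P(f,g)\le\delta\}$ (depending on $P$). The class $F$ is a uniform Donsker class if (Giné–Zinn characterization) for every probability measure $P$ on $\Omega$, $G_P$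 has a version with bounded, $\rho_P$-uniformly continuous sample paths, and for these versions $$\sup_P\mathbb{E}\sup_{f\in F}|G_P(f)|<\infty,\qquad \lim_{\delta\to0}\sup_P\mathbb{E}\sup_{h\in F_\delta}|G_P(h)|=0,$$ the suprema over $P$ being over all probability measures on $\Omega$. *)

theory Defs
  imports "HOL-Probability.Probability"
begin

text \<open>
  A measurable space \<open>\<Omega>\<close> is given by a measure \<open>M\<close> of which only \<open>space M\<close> and \<open>sets M\<close> matter.
\<close>

definition unit_ball_Linf :: "'a measure \<Rightarrow> ('a \<Rightarrow> real) set" where
  "unit_ball_Linf M = {f \<in> borel_measurable M. \<forall>x\<in>space M. \<bar>f x\<bar> \<le> 1}"

definition prob_measures_on :: "'a measure \<Rightarrow> 'a measure set" where
  "prob_measures_on M = {P. prob_space P \<and> sets P = sets M}"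

definition shattered :: "('a \<Rightarrow> real) set \<Rightarrow> real \<Rightarrow> 'a set \<Rightarrow> bool" where
  "shattered F \<epsilon> A \<longleftrightarrow>
    (\<exists>\<gamma> :: 'a \<Rightarrow> real. \<forall>B\<subseteq>A. \<exists>f\<in>F. \<forall>y\<in>A.
       (y \<in> B \<longrightarrow> f y \<ge> \<gamma> y + \<epsilon>) \<and> (y \<notin> B \<longrightarrow> f y \<le> \<gamma> y - \<epsilon>))"

definition fat_dim :: "'a measure \<Rightarrow> ('a \<Rightarrow> real) set \<Rightarrow> real \<Rightarrow> enat" where
  "fat_dim M F \<epsilon> = (SUP A\<in>{A. finite A \<and> A \<subseteq> space M \<and> shattered F \<epsilon> A}. enat (card A))"

definition sqrt_enat :: "enat \<Rightarrow> ennreal" where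
  "sqrt_enat n = (case n of enat k \<Rightarrow> ennreal (sqrt (real k)) | \<infinity> \<Rightarrow> \<infinity>)"

text \<open>Normal random variables, including the degenerate (constant) ones.\<close>

definition normal_rv :: "'w measure \<Rightarrow> ('w \<Rightarrow> real) \<Rightarrow> bool" where
  "normal_rv N X \<longleftrightarrow> X \<in> borel_measurable N \<and>
     (\<exists>\<mu> \<sigma>. (\<sigma> = 0 \<and> (AE \<omega> in N. X \<omega> = \<mu>)) \<or>
            (\<sigma> > 0 \<and> distributed N lborel X (\<lambda>x. ennreal (normal_density \<mu> \<sigma> x))))"

text \<open>All finite-dimensional marginals are multivariate normal, possibly degenerate.\<close>

definition gaussian_process :: "'w measure \<Rightarrow> 'i set \<Rightarrow> ('i \<Rightarrow> 'w \<Rightarrow> real) \<Rightarrow> bool" where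
  "gaussian_process N I G \<longleftrightarrow> prob_space N \<and>
     (\<forall>T c. finite T \<longrightarrow> T \<subseteq> I \<longrightarrow> normal_rv N (\<lambda>\<omega>. \<Sum>i\<in>T. c i * G i \<omega>))"

definition rho_dist :: "'a measure \<Rightarrow> ('a \<Rightarrow> real) \<Rightarrow> ('a \<Rightarrow> real) \<Rightarrow> real" where
  "rho_dist P f g = sqrt ((\<integral>x. (f x - g x)\<^sup>2 \<partial>P) - (\<integral>x. f x - g x \<partial>P)\<^sup>2)"

definition is_G_P ::
  "('a \<Rightarrow> real) set \<Rightarrow> 'a measure \<Rightarrow> 'w measure \<Rightarrow> (('a \<Rightarrow> real) \<Rightarrow> 'w \<Rightarrow> real) \<Rightarrow> bool" where
  "is_G_P F P N G \<longleftrightarrow> gaussian_process N F G \<and>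
     (\<forall>f\<in>F. (\<integral>\<omega>. G f \<omega> \<partial>N) = 0) \<and>
     (\<forall>f\<in>F. \<forall>g\<in>F. (\<integral>\<omega>. G f \<omega> * G g \<omega> \<partial>N) =
        (\<integral>x. f x * g x \<partial>P) - (\<integral>x. f x \<partial>P) * (\<integral>x. g x \<partial>P))"

definition regular_paths ::
  "('a \<Rightarrow> real) set \<Rightarrow> 'a measure \<Rightarrow> 'w measure \<Rightarrow> (('a \<Rightarrow> real) \<Rightarrow> 'w \<Rightarrow> real) \<Rightarrow> bool" where
  "regular_paths F P N G \<longleftrightarrow> (\<forall>\<omega>\<in>space N.
     bounded ((\<lambda>f. G f \<omega>) ` F) \<and>
     (\<forall>e>0. \<exists>d>0. \<forall>f\<in>F. \<forall>g\<in>F. rho_dist P f g < d \<longrightarrow> \<bar>G f \<omega> - G g \<omega>\<bar> < e))"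

text \<open>
  The set \<open>F\<^sub>\<delta>\<close> is represented by the pairs \<open>(f, g)\<close> rather than by the differences \<open>h = f - g\<close>,
  since \<open>G\<^sub>P(h) = G\<^sub>P(f) - G\<^sub>P(g)\<close> is specified through \<open>f\<close> and \<open>g\<close>.
\<close>

definition close_pairs ::
  "('a \<Rightarrow> real) set \<Rightarrow> 'a measure \<Rightarrow> real \<Rightarrow> (('a \<Rightarrow> real) \<times> ('a \<Rightarrow> real)) set" where
  "close_pairs F P \<delta> = {(f, g). f \<in> F \<and> g \<in> F \<and> rho_dist P f g \<le> \<delta>}"

text \<open>
  The versions of \<open>G\<^sub>P\<close> live on probability spaces \<open>N P\<close> that depend on \<open>P\<close>, whose points have the
  type of paths. This is no restriction: a version with regular paths on any probability space
  induces one on its space of paths, with the same joint law and hence the same expected suprema.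
  The suprema below are measurable: boundedness of the paths makes \<open>F\<close> totally bounded for
  \<open>rho_dist P\<close> (Sudakov minoration), so by continuity they are suprema over countable sets and
  the nonnegative integrals are the expectations.
\<close>

definition uniform_donsker :: "'a measure \<Rightarrow> ('a \<Rightarrow> real) set \<Rightarrow> bool" where
  "uniform_donsker M F \<longleftrightarrow>
    (\<exists>(N :: 'a measure \<Rightarrow> (('a \<Rightarrow> real) \<Rightarrow> real) measure)
      (G :: 'a measure \<Rightarrow> ('a \<Rightarrow> real) \<Rightarrow> (('a \<Rightarrow> real) \<Rightarrow> real) \<Rightarrow> real).
      (\<forall>P\<in>prob_measures_on M. is_G_P F P (N P) (G P) \<and> regular_paths F P (N P) (G P)) \<and>
      (SUP P\<in>prob_measures_on M. \<integral>\<^sup>+\<omega>. (SUP f\<in>F. ennreal \<bar>G P f \<omega>\<bar>) \<partial>N P) < \<infinity> \<and>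
      ((\<lambda>\<delta>. SUP P\<in>prob_measures_on M.
          \<integral>\<^sup>+\<omega>. (SUP (f, g)\<in>close_pairs F P \<delta>. ennreal \<bar>G P f \<omega> - G P g \<omega>\<bar>) \<partial>N P)
        \<longlongrightarrow> 0) (at_right 0))"

end

theory Submission
  imports Defs
begin

text \<open>
  If \<open>S \<subseteq> F\<close> is \<open>\<epsilon>\<close>-separated in \<open>L\<^sub>2(P)\<close>, any two of its members differ by \<open>\<epsilon> / 2\<close> on a set of
  \<open>P\<close>-measure at least \<open>\<epsilon>\<^sup>2 / 8\<close>, so a greedy choice of \<open>O(ln |S| / \<epsilon>\<^sup>2)\<close> points separates all
  pairs in the supremum norm. After rounding to multiples of \<open>\<epsilon> / 4\<close> the argument of Alon,
  Ben-David, Cesa-Bianchi and Haussler bounds \<open>|S|\<close> by the fat-shattering dimension \<open>d\<close> at scale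
  \<open>\<epsilon> / 8\<close>. As the integral condition forces \<open>d = O(1 / \<epsilon>\<^sup>2)\<close>, this amounts to
  \<open>ln |S| \<le> C (d + 1) (ln (2 / \<epsilon>))\<^sup>2\<close> with \<open>C\<close> independent of \<open>P\<close>, hence to a convergent entropy
  integral that is uniform in \<open>P\<close>.

  The process \<open>G\<^sub>P\<close> is first defined on a countable union of finite nets, by Gram-Schmidt
  orthonormalisation with respect to the covariance form and independent standard normal
  coordinates. The dyadic chaining bound is an almost surely finite series with uniformly small
  tails that controls all increments; it gives the extension to \<open>F\<close> and the two uniform bounds.
\<close>

section \<open>Shattering of integer-valued classes\<close>

text \<open>Two obstacles shape the proof. The number of greedy points grows with
  \<open>ln |S|\<close>, so the combinatorial bound contains the quantity that it estimates. It is
  used twice: a crude pass, which relies on the growth bound for \<open>d\<close>, shows that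
  \<open>ln |S|\<close> is polynomial in \<open>1 / \<epsilon>\<close>; inserting this again leaves
  only logarithms of \<open>1 / \<epsilon>\<close>. The square of the logarithm is a product of two:
  one from the exponent \<open>r\<close> at which \<open>2 ^ r\<close> exceeds the number of small
  level maps, one from the factor in cardinality paid for each unit of \<open>r\<close>. Under the
  square root of the entropy integral they become the single logarithm of the hypothesis. The second
  obstacle is that \<open>F\<close> may be uncountable, so statements that hold almost surely for
  each function separately cannot be combined, and a supremum over \<open>F\<close> is not visibly
  measurable. Every pathwise claim is therefore deduced from one measurable variable, the sum over
  all scales of the largest increment between net points. Where it is finite the process is a limit
  along projections to the nets; elsewhere it is set to zero.\<close>

text \<open>A partial map packs the shattered set (its domain) and the level at each point into one
  object that can be counted. Both inequalities are strict, so high and low values differ by at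
  least two steps; this is the margin that survives undoing the rounding.\<close>

definition level_shattered :: "('a \<Rightarrow> nat) set \<Rightarrow> ('a \<rightharpoonup> nat) \<Rightarrow> bool" where
  "level_shattered H m \<longleftrightarrow>
     (\<forall>B\<subseteq>dom m. \<exists>f\<in>H. \<forall>x\<in>dom m. (x \<in> B \<longrightarrow> the (m x) < f x) \<and> (x \<notin> B \<longrightarrow> f x < the (m x)))"

text \<open>The gap is two rather than one so that an integer level fits strictly between the two
  values.\<close>

definition separated_on :: "'a set \<Rightarrow> ('a \<Rightarrow> nat) set \<Rightarrow> bool" where
  "separated_on X H \<longleftrightarrow> (\<forall>f\<in>H. \<forall>g\<in>H. f \<noteq> g \<longrightarrow> (\<exists>x\<in>X. f x + 2 \<le> g x \<or> g x + 2 \<le> f x))"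

definition level_maps :: "'a set \<Rightarrow> nat \<Rightarrow> ('a \<rightharpoonup> nat) set" where
  "level_maps X b = {m. dom m \<subseteq> X \<and> ran m \<subseteq> {..b}}"

lemma level_shattered_mono: "level_shattered H m \<Longrightarrow> H \<subseteq> H' \<Longrightarrow> level_shattered H' m"
  unfolding level_shattered_def by (meson subsetD)

lemma finite_level_maps:
  assumes "finite X"
  shows "finite (level_maps X b)"
proof -
  have "level_maps X b = (\<Union>A\<in>Pow X. {m. dom m = A \<and> ran m \<subseteq> {..b}})"
    by (auto simp: level_maps_def)
  moreover have "finite {m :: 'a \<rightharpoonup> nat. dom m = A \<and> ran m \<subseteq> {..b}}" if "A \<subseteq> X" for A
    using assms that by (intro finite_set_of_finite_maps) (auto intro: finite_subset)
  ultimately show ?thesis using assms by auto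
qed

text \<open>A nonempty map arises from a map with one point fewer by adding a point with a value;
  the option \<open>None\<close> covers the empty map. Each unit of \<open>d\<close> thus costs a
  factor \<open>card X * (b + 1) + 1\<close>.\<close>

lemma card_level_maps_le:
  assumes "finite X"
  shows "card {m \<in> level_maps X b. card (dom m) \<le> d} \<le> (card X * (b + 1) + 1) ^ d"
proof (induction d)
  case 0
  have "m = Map.empty" if "m \<in> level_maps X b" "card (dom m) \<le> 0" for m
    using that finite_subset[OF _ assms, of "dom m"] by (simp add: level_maps_def)
  then have "{m \<in> level_maps X b. card (dom m) \<le> 0} \<subseteq> {Map.empty}" by blast
  from card_mono[OF _ this] show ?case by simp
next
  case (Suc d)
  let ?L = "\<lambda>d. {m \<in> level_maps X b. card (dom m) \<le> d}"
  let ?O = "insert None (Some ` (X \<times> {..b}))"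
  define h :: "('a \<rightharpoonup> nat) \<times> ('a \<times> nat) option \<Rightarrow> 'a \<rightharpoonup> nat"
    where "h = (\<lambda>(m, q). case q of None \<Rightarrow> m | Some (x, v) \<Rightarrow> m(x \<mapsto> v))"
  have fin: "finite (?L d \<times> ?O)"
    using assms finite_level_maps[OF assms] by auto
  have "?L (Suc d) \<subseteq> h ` (?L d \<times> ?O)"
  proof
    fix m assume m: "m \<in> ?L (Suc d)"
    show "m \<in> h ` (?L d \<times> ?O)"
    proof (cases "dom m = {}")
      case True
      then have "(m, None) \<in> ?L d \<times> ?O" using m by auto
      moreover have "m = h (m, None)" by (simp add: h_def)
      ultimately show ?thesis by (rule rev_image_eqI)
    next
      case False
      then obtain x where "x \<in> dom m" by blast
      then obtain v where xv: "m x = Some v" by blast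
      let ?m = "m(x := None)"
      have dom: "dom ?m = dom m - {x}" by auto
      have "finite (dom m)" using m assms by (auto simp: level_maps_def dest: finite_subset)
      then have "card (dom ?m) \<le> d" using m xv unfolding dom by (auto simp: card_Diff_singleton_if)
      moreover have "ran ?m \<subseteq> ran m" by (auto simp: ran_def split: if_splits)
      ultimately have "?m \<in> ?L d" using m by (auto simp: level_maps_def)
      moreover have "(x, v) \<in> X \<times> {..b}" using m xv by (auto simp: level_maps_def ran_def)
      ultimately have "(?m, Some (x, v)) \<in> ?L d \<times> ?O" by blast
      moreover have "m = h (?m, Some (x, v))" using xv by (auto simp: h_def)
      ultimately show ?thesis by (rule rev_image_eqI)
    qed
  qed
  then have "card (?L (Suc d)) \<le> card (?L d \<times> ?O)"
    by (rule surj_card_le[OF fin])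
  also have "\<dots> = card (?L d) * (card X * (b + 1) + 1)"
    using assms by (auto simp: card_cartesian_product card_image card_insert_if)
  also have "\<dots> \<le> (card X * (b + 1) + 1) ^ d * (card X * (b + 1) + 1)"
    using Suc.IH by (intro mult_right_mono) auto
  finally show ?case by (simp add: mult.commute)
qed

lemma pigeonhole_large_fibre:
  assumes "finite A" "finite B" "f ` A \<subseteq> B" "card B * k \<le> card A" "A \<noteq> {}"
  obtains y where "y \<in> B" "k \<le> card {x \<in> A. f x = y}"
proof -
  have "\<exists>y\<in>B. k \<le> card {x \<in> A. f x = y}"
  proof (rule ccontr)
    assume "\<not> ?thesis"
    then have less: "\<forall>y\<in>B. card {x \<in> A. f x = y} < k" by auto
    have "card A = (\<Sum>y\<in>B. card {x \<in> A. f x = y})"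
      using sum_fun_comp[of A B f "\<lambda>_. 1::nat"] assms by simp
    also have "\<dots> < (\<Sum>y\<in>B. k)"
      using less assms by (intro sum_strict_mono) auto
    finally show False using assms by simp
  qed
  then show thesis using that by blast
qed

text \<open>Half of the functions take one value at some point and the partners of these functions a
  value larger by at least 2; a level map shattered by both halves extends to that point.\<close>

lemma card_level_shattered_ge:
  assumes "finite X" "card X \<le> n" "0 < n" "finite H" "separated_on X H"
    and "\<And>f x. f \<in> H \<Longrightarrow> x \<in> X \<Longrightarrow> f x \<le> b"
    and "2 * (2 * n * (b + 1)\<^sup>2) ^ r \<le> card H"
  shows "2 ^ r \<le> card {m \<in> level_maps X b. level_shattered H m}"
  using assms
proof (induction r arbitrary: X H)
  case 0
  then have "H \<noteq> {}" by auto
  then have "Map.empty \<in> {m \<in> level_maps X b. level_shattered H m}"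
    by (auto simp: level_maps_def level_shattered_def)
  moreover have "finite {m \<in> level_maps X b. level_shattered H m}"
    using finite_level_maps[OF 0(1)] by auto
  ultimately have "0 < card {m \<in> level_maps X b. level_shattered H m}"
    using card_gt_0_iff by blast
  then show ?case by simp
next
  case (Suc r)
  define q where "q = 2 * n * (b + 1)\<^sup>2"
  define K where "K = q ^ Suc r"
  have q0: "0 < q" using Suc.prems by (simp add: q_def)
  have "card {..<2 * K} \<le> card H" using Suc.prems(7) by (simp add: K_def q_def)
  then obtain h where h: "h ` {..<2 * K} \<subseteq> H" "inj_on h {..<2 * K}"
    using card_le_inj[of "{..<2 * K}" H] Suc.prems by auto
  \<comment> \<open>The functions are paired as \<open>h (2 * i)\<close>,
    \<open>h (2 * i + 1)\<close>. In each pair \<open>u i\<close> is the member that is lower at a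
    separating point \<open>p i\<close>, and \<open>v i\<close> the higher one.\<close>
  have "\<exists>x u v. x \<in> X \<and> {u, v} = {h (2 * i), h (2 * i + 1)} \<and> u x + 2 \<le> v x" if "i < K" for i
  proof -
    have "h (2 * i) \<noteq> h (2 * i + 1)"
      using that inj_onD[OF h(2), of "2 * i" "2 * i + 1"] by auto
    moreover have "h (2 * i) \<in> H" "h (2 * i + 1) \<in> H" using h that by auto
    ultimately obtain x where x: "x \<in> X"
      "h (2 * i) x + 2 \<le> h (2 * i + 1) x \<or> h (2 * i + 1) x + 2 \<le> h (2 * i) x"
      using Suc.prems(5) unfolding separated_on_def by blast
    then show ?thesis by blast
  qed
  then obtain p u v where puv: "\<And>i. i < K \<Longrightarrow> p i \<in> X"
    "\<And>i. i < K \<Longrightarrow> {u i, v i} = {h (2 * i), h (2 * i + 1)}"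
    "\<And>i. i < K \<Longrightarrow> u i (p i) + 2 \<le> v i (p i)"
    by metis
  have index: "i = j"
    if "h i' = h j'" "i' \<in> {2 * i, 2 * i + 1}" "j' \<in> {2 * j, 2 * j + 1}" "i < K" "j < K"
    for i j i' j'
  proof -
    have "i' = j'" using that by (intro inj_onD[OF h(2)]) auto
    then show ?thesis using that by auto
  qed
  have u_h: "\<exists>i'\<in>{2 * i, 2 * i + 1}. u i = h i'" and v_h: "\<exists>i'\<in>{2 * i, 2 * i + 1}. v i = h i'"
    if "i < K" for i
    using puv(2)[OF that] by (auto simp: doubleton_eq_iff)
  have inj_u: "inj_on u {..<K}" and inj_v: "inj_on v {..<K}"
  proof -
    show "inj_on u {..<K}"
    proof (rule inj_onI)
      fix i j assume ij: "i \<in> {..<K}" "j \<in> {..<K}" "u i = u j"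
      obtain i' where i': "i' \<in> {2 * i, 2 * i + 1}" "u i = h i'" using u_h[of i] ij by blast
      obtain j' where j': "j' \<in> {2 * j, 2 * j + 1}" "u j = h j'" using u_h[of j] ij by blast
      show "i = j" using index[of i' j' i j] i' j' ij by simp
    qed
    show "inj_on v {..<K}"
    proof (rule inj_onI)
      fix i j assume ij: "i \<in> {..<K}" "j \<in> {..<K}" "v i = v j"
      obtain i' where i': "i' \<in> {2 * i, 2 * i + 1}" "v i = h i'" using v_h[of i] ij by blast
      obtain j' where j': "j' \<in> {2 * j, 2 * j + 1}" "v j = h j'" using v_h[of j] ij by blast
      show "i = j" using index[of i' j' i j] i' j' ij by simp
    qed
  qed
  have uH: "u i \<in> H" and vH: "v i \<in> H" if "i < K" for i
  proof -
    have "{u i, v i} \<subseteq> H" using h(1) that unfolding puv(2)[OF that] by auto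
    then show "u i \<in> H" "v i \<in> H" by auto
  qed
  \<comment> \<open>The pigeonholes are a separating point together with both values there, at most
    \<open>n * (b + 1)\<^sup>2\<close> of them. Since \<open>K\<close> is this number times
    \<open>2 * q ^ r\<close>, some hole keeps enough pairs to apply the induction hypothesis to the
    lower and to the upper members.\<close>
  define B where "B = X \<times> {..b} \<times> {..b}"
  define \<phi> where "\<phi> = (\<lambda>i. (p i, u i (p i), v i (p i)))"
  have big: "card B * (2 * q ^ r) \<le> card {..<K}"
  proof -
    have "card B \<le> n * (b + 1)\<^sup>2"
      using mult_right_mono[OF Suc.prems(2), of "(b + 1)\<^sup>2"]
      by (simp add: B_def card_cartesian_product power2_eq_square del: add_mult_distrib)
    then have "card B * (2 * q ^ r) \<le> n * (b + 1)\<^sup>2 * (2 * q ^ r)" by (rule mult_right_mono) simp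
    also have "\<dots> = K" by (simp add: K_def q_def)
    finally show ?thesis by simp
  qed
  have img: "\<phi> ` {..<K} \<subseteq> B"
    using puv uH vH Suc.prems(6) by (auto simp: \<phi>_def B_def)
  have finB: "finite B" using Suc.prems by (simp add: B_def)
  have "0 < K" using q0 unfolding K_def by (rule zero_less_power)
  then have ne: "{..<K} \<noteq> {}" by blast
  obtain y where y: "y \<in> B" "2 * q ^ r \<le> card {i \<in> {..<K}. \<phi> i = y}"
    using pigeonhole_large_fibre[OF finite_lessThan finB img big ne] by blast
  obtain x lo hi where xy: "y = (x, lo, hi)" by (cases y)
  define J where "J = {i \<in> {..<K}. \<phi> i = y}"
  have J: "i < K" "p i = x" "u i x = lo" "v i x = hi" if "i \<in> J" for i
    using that by (auto simp: J_def \<phi>_def xy)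
  have "J \<noteq> {}" using y(2) q0 unfolding J_def[symmetric] by auto
  then obtain i where "i \<in> J" by blast
  then have lohi: "lo + 2 \<le> hi" using J[of i] puv(3)[of i] by simp
  have bnd: "x \<in> X" "hi \<le> b" using y by (auto simp: B_def xy)
  have sep: "separated_on (X - {x}) U" if UH: "U \<subseteq> H"
    and eq: "\<And>f g. f \<in> U \<Longrightarrow> g \<in> U \<Longrightarrow> f x = g x" for U
    unfolding separated_on_def
  proof (intro ballI impI)
    fix f g assume fg: "f \<in> U" "g \<in> U" "f \<noteq> g"
    then obtain z where z: "z \<in> X" "f z + 2 \<le> g z \<or> g z + 2 \<le> f z"
      using Suc.prems(5) UH unfolding separated_on_def by (meson subsetD)
    have "z \<noteq> x"
    proof
      assume "z = x"
      then have "f x + 2 \<le> g x \<or> g x + 2 \<le> f x" using z(2) by simp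
      then show False using eq[OF fg(1,2)] by linarith
    qed
    then have "z \<in> X - {x}" using z(1) by simp
    then show "\<exists>x\<in>X - {x}. f x + 2 \<le> g x \<or> g x + 2 \<le> f x" using z(2) by (rule bexI[rotated])
  qed
  let ?S = "\<lambda>H X. {m \<in> level_maps X b. level_shattered H m}"
  have IH: "2 ^ r \<le> card (?S (w ` J) (X - {x}))"
    if inj: "inj_on w {..<K}" and wH: "w ` J \<subseteq> H" and wx: "\<And>i. i \<in> J \<Longrightarrow> w i x = c" for w c
  proof (rule Suc.IH)
    show "card (X - {x}) \<le> n" using Suc.prems(2) card_Diff1_le[of X x] by linarith
    show "separated_on (X - {x}) (w ` J)" by (rule sep[OF wH]) (auto simp: wx)
    have "inj_on w J" using inj by (rule inj_on_subset) (auto simp: J_def)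
    then show "2 * (2 * n * (b + 1)\<^sup>2) ^ r \<le> card (w ` J)"
      using y(2) by (simp add: card_image J_def q_def)
    show "finite (w ` J)" by (simp add: J_def)
    show "f z \<le> b" if "f \<in> w ` J" "z \<in> X - {x}" for f z
    proof (rule Suc.prems(6))
      show "f \<in> H" using that(1) wH by (rule set_mp[rotated])
      show "z \<in> X" using that(2) by simp
    qed
    show "finite (X - {x})" using Suc.prems(1) by simp
  qed fact
  define S1 where "S1 = ?S (u ` J) (X - {x})"
  define S2 where "S2 = ?S (v ` J) (X - {x})"
  \<comment> \<open>A map shattered by both halves is counted once more with \<open>x\<close> added
    at the level \<open>lo + 1\<close>, strictly between \<open>lo\<close> and \<open>hi\<close>.
    Union and intersection together have as many members as \<open>S1\<close> and \<open>S2\<close>,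
    which yields the doubling.\<close>
  define E where "E = (\<lambda>m. m(x \<mapsto> lo + 1)) ` (S1 \<inter> S2)"
  have uJ: "u ` J \<subseteq> H" and vJ: "v ` J \<subseteq> H" using J(1) uH vH by blast+
  have card12: "2 ^ r \<le> card S1" "2 ^ r \<le> card S2"
    unfolding S1_def S2_def using IH[OF inj_u uJ J(3)] IH[OF inj_v vJ J(4)] by simp_all
  have fin12: "finite S1" "finite S2"
    unfolding S1_def S2_def using finite_level_maps[of "X - {x}" b] Suc.prems(1) by simp_all
  have x12: "m x = None" if "m \<in> S1 \<union> S2" for m
    using that by (auto simp: S1_def S2_def level_maps_def domIff)
  have "inj_on (\<lambda>m. m(x \<mapsto> lo + 1)) (S1 \<inter> S2)"
  proof (rule inj_onI)
    fix m m' :: "'a \<rightharpoonup> nat"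
    assume "m \<in> S1 \<inter> S2" "m' \<in> S1 \<inter> S2" "m(x \<mapsto> lo + 1) = m'(x \<mapsto> lo + 1)"
    moreover from this have "m x = None" "m' x = None" by (auto intro: x12)
    ultimately show "m = m'" by (metis fun_upd_triv fun_upd_upd)
  qed
  then have cardE: "card E = card (S1 \<inter> S2)" by (simp add: E_def card_image)
  have "E \<inter> (S1 \<union> S2) = {}"
  proof -
    have "m x \<noteq> None" if "m \<in> E" for m using that by (auto simp: E_def)
    then show ?thesis using x12 by blast
  qed
  moreover have "finite E" using fin12 by (simp add: E_def)
  ultimately have "card (E \<union> (S1 \<union> S2)) = card (S1 \<inter> S2) + card (S1 \<union> S2)"
    using cardE fin12 by (simp add: card_Un_disjoint)
  also have "\<dots> = card S1 + card S2" using card_Un_Int[OF fin12] by simp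
  finally have card_all: "2 ^ Suc r \<le> card (E \<union> (S1 \<union> S2))" using card12 by simp
  have "E \<union> (S1 \<union> S2) \<subseteq> ?S H X"
  proof (intro Un_least)
    show "S1 \<subseteq> ?S H X" "S2 \<subseteq> ?S H X"
      using level_shattered_mono[OF _ uJ] level_shattered_mono[OF _ vJ]
      by (auto simp: S1_def S2_def level_maps_def)
    show "E \<subseteq> ?S H X"
    proof
      fix m' assume "m' \<in> E"
      then obtain m where m: "m \<in> S1" "m \<in> S2" "m' = m(x \<mapsto> lo + 1)" by (auto simp: E_def)
      have "ran m' \<subseteq> insert (lo + 1) (ran m)" unfolding m(3)
        by (auto simp: ran_def split: if_splits)
      then have 1: "m' \<in> level_maps X b"
        using m(1) bnd lohi unfolding m(3) by (auto simp: S1_def level_maps_def)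
      have dom: "dom m' = insert x (dom m)" "x \<notin> dom m" using m x12[of m] by auto
      have "level_shattered H m'"
        unfolding level_shattered_def
      proof (intro allI impI)
        fix C assume C: "C \<subseteq> dom m'"
        \<comment> \<open>The side demanded at \<open>x\<close> selects the half: the functions
          \<open>v i\<close> have the value \<open>hi\<close> there, the functions
          \<open>u i\<close> the value \<open>lo\<close>.\<close>
        define w where "w = (if x \<in> C then v else u)"
        have "level_shattered (w ` J) m" using m by (auto simp: w_def S1_def S2_def)
        moreover have "C - {x} \<subseteq> dom m" using C dom by auto
        ultimately obtain f where f: "f \<in> w ` J"
          "\<forall>z\<in>dom m. (z \<in> C - {x} \<longrightarrow> the (m z) < f z) \<and> (z \<notin> C - {x} \<longrightarrow> f z < the (m z))"
          unfolding level_shattered_def by blast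
        have "f \<in> H" using f(1) uJ vJ by (auto simp: w_def split: if_splits)
        moreover have "f x = (if x \<in> C then hi else lo)" using f(1) J by (auto simp: w_def)
        ultimately show "\<exists>f\<in>H. \<forall>z\<in>dom m'. (z \<in> C \<longrightarrow> the (m' z) < f z) \<and> (z \<notin> C \<longrightarrow> f z < the (m' z))"
          using f(2) lohi dom m(3) by (intro bexI[of _ f]) auto
      qed
      then show "m' \<in> ?S H X" using 1 by blast
    qed
  qed
  moreover have "finite (?S H X)" using finite_level_maps[OF Suc.prems(1)] by auto
  ultimately show ?case using card_all card_mono le_trans by blast
qed

text \<open>The shattered level maps outnumber all level maps with at most \<open>d\<close> points,
  so one of them is larger.\<close>

lemma exists_large_level_shattered:
  assumes "finite X" "card X \<le> n" "0 < n" "finite H" "separated_on X H"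
    and "\<And>f x. f \<in> H \<Longrightarrow> x \<in> X \<Longrightarrow> f x \<le> b"
    and "2 * (2 * n * (b + 1)\<^sup>2) ^ r \<le> card H" "(n * (b + 1) + 1) ^ d < 2 ^ r"
  obtains m where "m \<in> level_maps X b" "level_shattered H m" "d < card (dom m)"
proof -
  have "\<not> {m \<in> level_maps X b. level_shattered H m} \<subseteq> {m \<in> level_maps X b. card (dom m) \<le> d}"
  proof
    assume sub: "{m \<in> level_maps X b. level_shattered H m} \<subseteq> {m \<in> level_maps X b. card (dom m) \<le> d}"
    have "2 ^ r \<le> card {m \<in> level_maps X b. level_shattered H m}"
      using assms by (intro card_level_shattered_ge) auto
    also have "\<dots> \<le> card {m \<in> level_maps X b. card (dom m) \<le> d}"
      using sub finite_level_maps[OF assms(1)] by (intro card_mono) auto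
    also have "\<dots> \<le> (card X * (b + 1) + 1) ^ d" by (rule card_level_maps_le) fact
    also have "\<dots> \<le> (n * (b + 1) + 1) ^ d"
      using assms(2) by (intro power_mono add_right_mono mult_right_mono) auto
    finally show False using assms(8) by simp
  qed
  then show thesis using that by (auto simp: not_le[symmetric])
qed

text \<open>By averaging, some point lies in at least the fraction \<open>p\<close> of the sets
  still missed. Each greedy choice multiplies their number by at most \<open>1 - p\<close>, and
  after \<open>n\<close> choices fewer than one is left.\<close>

lemma (in prob_space) exists_hitting_points:
  assumes "finite K" "\<And>k. k \<in> K \<Longrightarrow> A k \<in> events" "\<And>k. k \<in> K \<Longrightarrow> p \<le> prob (A k)"
    and "p \<le> 1" "real (card K) * (1 - p) ^ n < 1"
  shows "\<exists>X. finite X \<and> X \<subseteq> space M \<and> card X \<le> n \<and> (\<forall>k\<in>K. X \<inter> A k \<noteq> {})"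
  using assms(1,2,3,5)
proof (induction n arbitrary: K)
  case 0
  then have "K = {}" by simp
  then show ?case by (intro exI[of _ "{}"]) auto
next
  case (Suc n)
  have "\<exists>x\<in>space M. p * card K \<le> (\<Sum>k\<in>K. indicator (A k) x :: real)"
  proof (rule ccontr)
    assume "\<not> ?thesis"
    then have "AE x in M. (\<Sum>k\<in>K. indicator (A k) x :: real) < p * card K"
      by (intro AE_I2) (auto simp: not_le)
    moreover have "integrable M (\<lambda>x. \<Sum>k\<in>K. indicator (A k) x :: real)"
      using Suc.prems by (intro Bochner_Integration.integrable_sum integrable_real_indicator)
        (auto simp: emeasure_eq_measure)
    ultimately have "expectation (\<lambda>x. \<Sum>k\<in>K. indicator (A k) x :: real) < p * card K"
      by (intro expectation_less)
    moreover have "expectation (\<lambda>x. \<Sum>k\<in>K. indicator (A k) x :: real) = (\<Sum>k\<in>K. prob (A k))"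
      using Suc.prems by (subst Bochner_Integration.integral_sum)
        (auto simp: emeasure_eq_measure intro!: integrable_real_indicator)
    moreover have "(\<Sum>k\<in>K. p) \<le> (\<Sum>k\<in>K. prob (A k))" using Suc.prems by (intro sum_mono) auto
    ultimately show False by (simp add: mult.commute)
  qed
  then obtain x where x: "x \<in> space M" "p * card K \<le> (\<Sum>k\<in>K. indicator (A k) x :: real)" by blast
  define K' where "K' = {k \<in> K. x \<notin> A k}"
  have "(\<Sum>k\<in>K. indicator (A k) x :: real) = card {k \<in> K. x \<in> A k}"
    using Suc.prems(1) by (simp add: indicator_def sum.If_cases Int_def)
  moreover have "card K = card {k \<in> K. x \<in> A k} + card K'"
    unfolding K'_def using Suc.prems(1)
      by (subst card_Un_disjoint[symmetric]) (auto intro: arg_cong[where f=card])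
  ultimately have "card K' \<le> (1 - p) * card K" using x(2) by (simp add: algebra_simps)
  then have "card K' * (1 - p) ^ n \<le> (1 - p) * card K * (1 - p) ^ n"
    using assms(4) by (intro mult_right_mono) auto
  also have "\<dots> < 1" using Suc.prems(4) by (simp add: mult_ac)
  finally obtain X where X: "finite X" "X \<subseteq> space M" "card X \<le> n" "\<forall>k\<in>K'. X \<inter> A k \<noteq> {}"
    using Suc.IH[of K'] Suc.prems by (auto simp: K'_def)
  then show ?case using x(1)
    by (intro exI[of _ "insert x X"]) (auto simp: card_insert_if K'_def)
qed

section \<open>Entropy and fat-shattering dimension\<close>

lemma fat_dim_le_card:
  assumes "fat_dim M F \<epsilon> \<le> enat d" "finite A" "A \<subseteq> space M" "shattered F \<epsilon> A"
  shows "card A \<le> d"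
proof -
  have "enat (card A) \<le> fat_dim M F \<epsilon>"
    unfolding fat_dim_def using assms by (intro SUP_upper) auto
  then show ?thesis using assms(1) by (metis enat_ord_simps(1) order_trans)
qed

text \<open>At level \<open>l\<close>, a larger rounded value forces \<open>f x\<close> to be at
  least \<open>(l + 1) * s - 1\<close>, a smaller one forces it below \<open>l * s - 1\<close>. The
  witness is the midpoint of these two bounds, which leaves half a step on either side.\<close>

lemma shattered_if_level_shattered:
  assumes "level_shattered ((\<lambda>f x. nat \<lfloor>(f x + 1) / s\<rfloor>) ` F) m" "0 < s"
    and "\<And>f x. f \<in> F \<Longrightarrow> x \<in> dom m \<Longrightarrow> \<bar>f x\<bar> \<le> 1"
  shows "shattered F (s / 2) (dom m)"
  unfolding shattered_def
proof (intro exI[of _ "\<lambda>x. (real (the (m x)) + 1 / 2) * s - 1"] allI impI)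
  fix B assume B: "B \<subseteq> dom m"
  obtain g where "g \<in> (\<lambda>f x. nat \<lfloor>(f x + 1) / s\<rfloor>) ` F"
    and g: "\<forall>x\<in>dom m. (x \<in> B \<longrightarrow> the (m x) < g x) \<and> (x \<notin> B \<longrightarrow> g x < the (m x))"
    using assms(1)[unfolded level_shattered_def, rule_format, OF B] by (elim bexE)
  then obtain f where f_mem: "f \<in> F" and g_eq: "g = (\<lambda>x. nat \<lfloor>(f x + 1) / s\<rfloor>)"
    by (elim imageE)
  note f = f_mem bspec[OF g[unfolded g_eq]]
  have "(real (the (m x)) + 1 / 2) * s - 1 + s / 2 \<le> f x" if "x \<in> dom m" "x \<in> B" for x
  proof -
    have "int (the (m x)) + 1 \<le> \<lfloor>(f x + 1) / s\<rfloor>" using f(2)[OF that(1)] that(2) by simp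
    then have "real (the (m x)) + 1 \<le> (f x + 1) / s" by (simp add: le_floor_iff)
    then have "(real (the (m x)) + 1) * s \<le> f x + 1" using assms(2) by (simp add: pos_le_divide_eq)
    then show ?thesis by (simp add: algebra_simps)
  qed
  moreover have "f x \<le> (real (the (m x)) + 1 / 2) * s - 1 - s / 2" if "x \<in> dom m" "x \<notin> B" for x
  proof -
    have "\<lfloor>(f x + 1) / s\<rfloor> < int (the (m x))" using f(2)[OF that(1)] that(2) by linarith
    then have "(f x + 1) / s < real (the (m x))" by (simp add: floor_less_iff)
    then have "f x + 1 < real (the (m x)) * s" using assms(2) by (simp add: pos_divide_less_eq)
    then show ?thesis by (simp add: algebra_simps)
  qed
  ultimately show "\<exists>f\<in>F. \<forall>y\<in>dom m.
       (y \<in> B \<longrightarrow> (real (the (m y)) + 1 / 2) * s - 1 + s / 2 \<le> f y) \<and>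
       (y \<notin> B \<longrightarrow> f y \<le> (real (the (m y)) + 1 / 2) * s - 1 - s / 2)"
    using f(1) by blast
qed

text \<open>The square is at most 4 on the set and at most \<open>\<epsilon>\<^sup>2 / 4\<close> off
  it, so the probability is even at least \<open>3 / 16 * \<epsilon>\<^sup>2\<close>.\<close>

lemma (in prob_space) prob_large_ge:
  assumes "f \<in> borel_measurable M" "\<And>x. x \<in> space M \<Longrightarrow> \<bar>f x\<bar> \<le> 2"
    and "0 < \<epsilon>" "\<epsilon>\<^sup>2 \<le> expectation (\<lambda>x. (f x)\<^sup>2)"
  shows "\<epsilon>\<^sup>2 / 8 \<le> prob {x \<in> space M. \<epsilon> / 2 \<le> \<bar>f x\<bar>}"
proof -
  let ?A = "{x \<in> space M. \<epsilon> / 2 \<le> \<bar>f x\<bar>}"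
  have A: "?A \<in> events" using assms(1) by measurable
  have sq: "(f x)\<^sup>2 \<le> 4" if "x \<in> space M" for x
    using power_mono[OF assms(2)[OF that], of 2] by simp
  have "expectation (\<lambda>x. (f x)\<^sup>2) \<le> expectation (\<lambda>x. 4 * indicator ?A x + \<epsilon>\<^sup>2 / 4)"
  proof (intro integral_mono)
    show "integrable M (\<lambda>x. (f x)\<^sup>2)"
      using assms(1) sq by (intro integrable_const_bound[of _ 4]) auto
    show "integrable M (\<lambda>x. 4 * indicator ?A x + \<epsilon>\<^sup>2 / 4 :: real)"
      using A by (intro Bochner_Integration.integrable_add integrable_mult_right integrable_real_indicator)
        (auto simp: emeasure_eq_measure)
    fix x assume x: "x \<in> space M"
    show "(f x)\<^sup>2 \<le> 4 * indicator ?A x + \<epsilon>\<^sup>2 / 4"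
    proof (cases "x \<in> ?A")
      case True
      then show ?thesis using sq[OF x] by (simp add: add_increasing2)
    next
      case False
      then have "\<bar>f x\<bar> \<le> \<epsilon> / 2" using x by simp
      then have "\<bar>f x\<bar>\<^sup>2 \<le> (\<epsilon> / 2)\<^sup>2" by (intro power_mono) auto
      then show ?thesis using False by (simp add: power_divide)
    qed
  qed
  also have "\<dots> = 4 * prob ?A + \<epsilon>\<^sup>2 / 4"
    using A by (subst Bochner_Integration.integral_add)
      (auto simp: emeasure_eq_measure prob_space intro!: integrable_mult_right)
  finally have "\<epsilon>\<^sup>2 \<le> 4 * prob ?A + \<epsilon>\<^sup>2 / 4" using assms(4) by linarith
  moreover have "0 \<le> \<epsilon>\<^sup>2" by simp
  ultimately show ?thesis by linarith
qed

text \<open>The scale 1/8 arises from three halvings: distance \<epsilon> in L2 gives a pointwise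
  gap \<epsilon>/2, this is two rounding steps of width \<open>s = \<epsilon> / 4\<close>, and
  shattering of rounded values has margin \<open>s / 2\<close>. The other parameters are tuned to
  the argument: \<open>b\<close> bounds the rounded values, since
  \<open>2 / s = 8 / \<epsilon>\<close>; \<open>n\<close> points hit the difference sets of all
  ordered pairs; and \<open>r\<close> makes shattered level maps outnumber those with at most
  \<open>d\<close> points.\<close>

lemma (in prob_space) card_L2_separated_less:
  assumes H: "finite H" "H \<subseteq> F" "F \<subseteq> unit_ball_Linf M" and eps: "0 < \<epsilon>" "\<epsilon> \<le> 1"
    and sep: "\<And>f g. f \<in> H \<Longrightarrow> g \<in> H \<Longrightarrow> f \<noteq> g \<Longrightarrow> \<epsilon>\<^sup>2 \<le> expectation (\<lambda>x. (f x - g x)\<^sup>2)"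
    and fat: "fat_dim M F (\<epsilon> / 8) \<le> enat d" and b: "8 / \<epsilon> \<le> real b"
    and n: "0 < n" "(real (card H))\<^sup>2 * (1 - \<epsilon>\<^sup>2 / 8) ^ n < 1"
    and r: "(n * (b + 1) + 1) ^ d < 2 ^ r"
  shows "card H < 2 * (2 * n * (b + 1)\<^sup>2) ^ r"
proof (rule ccontr)
  assume large: "\<not> ?thesis"
  have ball: "f \<in> borel_measurable M" "\<And>x. x \<in> space M \<Longrightarrow> \<bar>f x\<bar> \<le> 1" if "f \<in> F" for f
    using that H(3) by (auto simp: unit_ball_Linf_def)
  define K where "K = {(f, g). f \<in> H \<and> g \<in> H \<and> f \<noteq> g}"
  define A where "A = (\<lambda>(f, g). {x \<in> space M. \<epsilon> / 2 \<le> \<bar>f x - g x :: real\<bar>})"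
  have K_sub: "K \<subseteq> H \<times> H" by (auto simp: K_def)
  then have finK: "finite K" using H(1) finite_subset by blast
  have "card K \<le> (card H)\<^sup>2"
    using card_mono[OF _ K_sub] H(1) by (simp add: card_cartesian_product power2_eq_square)
  then have "real (card K) \<le> (real (card H))\<^sup>2"
    using of_nat_mono[of "card K" "(card H)\<^sup>2", where 'a=real] by simp
  moreover have eps2: "\<epsilon>\<^sup>2 / 8 \<le> 1" using power_le_one[of \<epsilon> 2] eps by simp
  ultimately have "real (card K) * (1 - \<epsilon>\<^sup>2 / 8) ^ n \<le> (real (card H))\<^sup>2 * (1 - \<epsilon>\<^sup>2 / 8) ^ n"
    by (intro mult_right_mono) auto
  with n(2) have small: "real (card K) * (1 - \<epsilon>\<^sup>2 / 8) ^ n < 1" by linarith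
  have meas: "A k \<in> events" if "k \<in> K" for k
  proof -
    obtain f g where k: "k = (f, g)" by (cases k)
    have [measurable]: "f \<in> borel_measurable M" "g \<in> borel_measurable M"
      using that ball H(2) by (auto simp: k K_def)
    show ?thesis unfolding A_def k by simp
  qed
  have prob_A: "\<epsilon>\<^sup>2 / 8 \<le> prob (A k)" if "k \<in> K" for k
  proof -
    obtain f g where k: "k = (f, g)" by (cases k)
    have fg: "f \<in> H" "g \<in> H" "f \<noteq> g" using that by (auto simp: k K_def)
    have "f \<in> F" "g \<in> F" using fg H(2) by auto
    have "\<epsilon>\<^sup>2 / 8 \<le> prob {x \<in> space M. \<epsilon> / 2 \<le> \<bar>f x - g x\<bar>}"
    proof (rule prob_large_ge[OF _ _ eps(1) sep[OF fg]])
      show "(\<lambda>x. f x - g x) \<in> borel_measurable M"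
        using ball(1)[OF \<open>f \<in> F\<close>] ball(1)[OF \<open>g \<in> F\<close>] by simp
      show "\<bar>f x - g x\<bar> \<le> 2" if "x \<in> space M" for x
        using ball(2)[OF \<open>f \<in> F\<close> that] ball(2)[OF \<open>g \<in> F\<close> that] by linarith
    qed
    then show ?thesis by (simp add: A_def k)
  qed
  obtain X where X: "finite X" "X \<subseteq> space M" "card X \<le> n" "\<forall>k\<in>K. X \<inter> A k \<noteq> {}"
  proof -
    have "\<exists>X. finite X \<and> X \<subseteq> space M \<and> card X \<le> n \<and> (\<forall>k\<in>K. X \<inter> A k \<noteq> {})"
      by (rule exists_hitting_points[OF finK _ _ eps2 small]) (fact meas prob_A)+
    then show thesis by (elim exE conjE) (rule that)
  qed
  define s where "s = \<epsilon> / 4"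
  have s: "0 < s" using eps by (simp add: s_def)
  define D where "D = (\<lambda>(f :: 'a \<Rightarrow> real) x. nat \<lfloor>(f x + 1) / s\<rfloor>)"
  have D_sep: "\<exists>x\<in>X. D f x + 2 \<le> D g x \<or> D g x + 2 \<le> D f x" if fg: "f \<in> H" "g \<in> H" "f \<noteq> g" for f g
  proof -
    have "X \<inter> A (f, g) \<noteq> {}" using fg X(4) by (auto simp: K_def)
    then obtain x where x: "x \<in> X" "x \<in> space M" "\<epsilon> / 2 \<le> \<bar>f x - g x\<bar>" by (auto simp: A_def)
    have gap: "D u x + 2 \<le> D v x" if "u \<in> H" "\<epsilon> / 2 \<le> v x - u x" for u v
    proof -
      have "\<bar>u x\<bar> \<le> 1" using ball(2)[of u x] that(1) H(2) x(2) by auto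
      then have "0 \<le> (u x + 1) / s" using s by simp
      moreover have "(u x + 1) / s + 2 \<le> (v x + 1) / s"
      proof -
        have "2 \<le> (v x - u x) / s" using that(2) s by (simp add: pos_le_divide_eq s_def)
        then show ?thesis by (simp add: diff_divide_distrib add_divide_distrib)
      qed
      ultimately show ?thesis unfolding D_def by linarith
    qed
    have "D f x + 2 \<le> D g x \<or> D g x + 2 \<le> D f x"
    proof (cases "f x \<le> g x")
      case True
      then show ?thesis using gap[of f g] x(3) fg(1) by auto
    next
      case False
      then show ?thesis using gap[of g f] x(3) fg(2) by auto
    qed
    then show ?thesis using x(1) by blast
  qed
  have "inj_on D H"
  proof (rule inj_onI, rule ccontr)
    fix f g assume fg: "f \<in> H" "g \<in> H" "D f = D g" "f \<noteq> g"
    show False using D_sep[OF fg(1,2,4)] unfolding fg(3) by simp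
  qed
  then have cardD: "card (D ` H) = card H" by (rule card_image)
  have "separated_on X (D ` H)" unfolding separated_on_def using D_sep by fast
  moreover have "u x \<le> b" if u: "u \<in> D ` H" and x: "x \<in> X" for u x
  proof -
    obtain f where f: "f \<in> H" "u = D f" using u by blast
    have "\<bar>f x\<bar> \<le> 1" using ball(2)[of f x] f(1) H(2) x X(2) by auto
    then have "(f x + 1) / s \<le> 2 / s" using s by (intro divide_right_mono) auto
    also have "\<dots> \<le> real b" using b by (simp add: s_def)
    finally show ?thesis by (simp add: f(2) D_def) linarith
  qed
  moreover have "2 * (2 * n * (b + 1)\<^sup>2) ^ r \<le> card (D ` H)" using large cardD by simp
  moreover have "finite (D ` H)" using H(1) by simp
  ultimately obtain m where m: "m \<in> level_maps X b" "level_shattered (D ` H) m" "d < card (dom m)"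
    using r by - (rule exists_large_level_shattered[OF X(1,3) n(1), of "D ` H" b r d])
  have domX: "dom m \<subseteq> X" using m(1) by (simp add: level_maps_def)
  have "level_shattered (D ` F) m" using m(2) H(2) by (rule level_shattered_mono[OF _ image_mono])
  then have "shattered F (s / 2) (dom m)" unfolding D_def
    using s ball(2) domX X(2) by (intro shattered_if_level_shattered) blast+
  then have "card (dom m) \<le> d"
    using fat domX X by (intro fat_dim_le_card[of M F "s / 2"]) (auto simp: s_def intro: finite_subset)
  then show False using m(3) by simp
qed

text \<open>The bound of \<open>card_L2_separated_less\<close> for \<open>\<epsilon> = (1 / 2) ^ k\<close> and \<open>b = 8 * 2 ^ k\<close>.\<close>

definition card_bound :: "nat \<Rightarrow> nat \<Rightarrow> nat \<Rightarrow> bool" where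
  "card_bound k d N \<longleftrightarrow>
     (\<forall>n r. 0 < n \<longrightarrow> (real N)\<^sup>2 * (1 - ((1 / 2) ^ k)\<^sup>2 / 8) ^ n < 1 \<longrightarrow>
       (n * (8 * 2 ^ k + 1) + 1) ^ d < 2 ^ r \<longrightarrow> N < 2 * (2 * n * (8 * 2 ^ k + 1)\<^sup>2) ^ r)"

text \<open>Admissible \<open>n\<close> are of the order of \<open>4 ^ k * ln N\<close>, so
  \<open>card_bound\<close> yields an inequality with \<open>ln N\<close> on both sides, on the
  right only inside a logarithm \<open>q\<close>. Estimating that logarithm by a small power gives a
  polynomial bound on \<open>ln N\<close>; with it, \<open>q\<close> becomes linear in
  \<open>k + 1\<close>.\<close>

lemma ln_card_bound:
  fixes c :: real
  assumes c: "0 \<le> c"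
  shows "\<exists>C>0. \<forall>k d N. 1 \<le> N \<longrightarrow> real d \<le> c * 4 ^ k \<longrightarrow> card_bound k d N \<longrightarrow>
    ln (real N) \<le> C * (real d + 1) * (real k + 1)\<^sup>2"
proof (intro exI conjI allI impI)
  \<comment> \<open>Here 769 is \<open>1 + 3 * 256\<close>, from the crude pass. In \<open>B\<close>
    the 20 is 12 for the explicit part of \<open>Q\<close> plus 8 from
    \<open>2 * ln 16 \<le> 8\<close>; the rest is \<open>2 * ln a\<close>.\<close>
  define a where "a = 769 * (c + 1)"
  define B where "B = 20 + 2 * ln a"
  have a: "769 \<le> a" using c by (simp add: a_def)
  then have B0: "0 < B" unfolding B_def using ln_ge_zero[of a] by linarith
  show "0 < 3 * B\<^sup>2" using B0 by simp
  fix k d N :: nat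
  assume N: "1 \<le> N" and d: "real d \<le> c * 4 ^ k"
    and bound: "card_bound k d N"
  define \<Lambda> where "\<Lambda> = ln (real N)"
  have \<Lambda>0: "0 \<le> \<Lambda>" using N by (simp add: \<Lambda>_def)
  define p :: real where "p = ((1 / 2) ^ k)\<^sup>2 / 8"
  have "((1 / 2) ^ k)\<^sup>2 = (1 / 4 :: real) ^ k"
    unfolding power2_eq_square power_mult_distrib[symmetric] by simp
  then have p_eq: "p = 1 / (8 * 4 ^ k)" by (simp add: p_def power_divide)
  have "(1 :: real) \<le> 4 ^ k" by simp
  then have "(1 :: real) \<le> 8 * 4 ^ k" by linarith
  then have p1: "p \<le> 1" "0 < p" unfolding p_eq by (simp_all add: divide_le_eq_1)
  \<comment> \<open>With \<open>p = 1 / (8 * 4 ^ k)\<close> this makes \<open>p * n\<close> exceed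
    \<open>2 * \<Lambda>\<close>, hence \<open>(1 - p) ^ n\<close> falls below
    \<open>1 / N\<^sup>2\<close>. Adding 1 gives strictness and \<open>0 < n\<close>, also for
    \<open>N = 1\<close>.\<close>
  define n where "n = nat \<lceil>16 * 4 ^ k * \<Lambda>\<rceil> + 1"
  have n_lower: "16 * 4 ^ k * \<Lambda> < n" unfolding n_def by linarith
  have n_upper: "n \<le> 16 * 4 ^ k * \<Lambda> + 2"
  proof -
    have "0 \<le> 16 * 4 ^ k * \<Lambda>" using \<Lambda>0 by simp
    then show ?thesis unfolding n_def by linarith
  qed
  have "(1 - p) ^ n \<le> exp (- p) ^ n"
    using exp_ge_add_one_self[of "- p"] p1 by (intro power_mono) auto
  also have "\<dots> = exp (- (p * n))" by (simp add: exp_of_nat_mult[symmetric] mult.commute)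
  also have "\<dots> < exp (- (2 * \<Lambda>))"
    using n_lower by (simp add: p_eq field_simps)
  finally have "(real N)\<^sup>2 * (1 - p) ^ n < (real N)\<^sup>2 * exp (- (2 * \<Lambda>))" using N by simp
  also have "\<dots> = 1"
  proof -
    have "exp (2 * \<Lambda>) = (real N)\<^sup>2" using N by (simp add: \<Lambda>_def exp_double)
    then show ?thesis using N by (simp add: exp_minus)
  qed
  finally have small: "(real N)\<^sup>2 * (1 - p) ^ n < 1" .
  \<comment> \<open>\<open>Q\<close> is the base in the conclusion of \<open>card_bound\<close> and
    also dominates the base in its condition on \<open>r\<close>, so a single logarithm serves for
    both.\<close>
  define Q where "Q = 2 * real n * (8 * 2 ^ k + 1)\<^sup>2"
  define q where "q = ln Q"
  have n1: "1 \<le> real n" by (simp add: n_def)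
  have t1: "(1 :: real) \<le> 2 ^ k" by simp
  have nb: "real n * (8 * 2 ^ k + 1) + 1 \<le> Q"
  proof -
    let ?t = "8 * 2 ^ k + 1 :: real"
    have "1 \<le> real n * ?t" using mult_mono[OF n1, of 1 ?t] by simp
    moreover have "real n * ?t * 1 \<le> real n * ?t * ?t" by (intro mult_left_mono) auto
    ultimately show ?thesis by (simp add: Q_def power2_eq_square mult_ac)
  qed
  have Q3: "3 \<le> Q"
  proof -
    have "9 \<le> 1 * (8 * 2 ^ k + 1 :: real)" using t1 by simp
    also have "\<dots> \<le> real n * (8 * 2 ^ k + 1)" using n1 by (intro mult_right_mono) auto
    finally show ?thesis using nb by linarith
  qed
  have q1: "1 \<le> q"
  proof -
    have "exp 1 \<le> Q" using Q3 exp_le by linarith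
    then show ?thesis unfolding q_def using Q3 by (subst ln_ge_iff) auto
  qed
  \<comment> \<open>Rounding up achieves \<open>Q ^ d \<le> 2 ^ r\<close>; the added 1 makes it
    strict, even for \<open>d = 0\<close>.\<close>
  define r where "r = nat \<lceil>d * log 2 Q\<rceil> + 1"
  have log0: "0 \<le> log 2 Q" using Q3 by simp
  have "((real n * (8 * 2 ^ k + 1) + 1) ^ d) \<le> Q ^ d" by (intro power_mono nb) simp
  also have "\<dots> = (2 powr log 2 Q) powr d" using Q3 by (simp add: powr_realpow)
  also have "\<dots> = 2 powr (d * log 2 Q)" by (simp only: powr_powr mult.commute)
  also have "\<dots> < 2 powr (real r)" unfolding r_def by (intro powr_less_mono) linarith+
  also have "\<dots> = 2 ^ r" by (simp add: powr_realpow)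
  finally have "real ((n * (8 * 2 ^ k + 1) + 1) ^ d) < real (2 ^ r)"
    by (simp only: of_nat_power of_nat_add of_nat_mult of_nat_numeral of_nat_1)
  then have "(n * (8 * 2 ^ k + 1) + 1) ^ d < 2 ^ r" using of_nat_less_iff by blast
  then have "N < 2 * (2 * n * (8 * 2 ^ k + 1)\<^sup>2) ^ r"
    using bound small by (auto simp: card_bound_def p_def n_def)
  then have "real N < real (2 * (2 * n * (8 * 2 ^ k + 1)\<^sup>2) ^ r)" using of_nat_less_iff by blast
  also have "\<dots> = 2 * Q ^ r"
    by (simp only: Q_def of_nat_power of_nat_add of_nat_mult of_nat_numeral of_nat_1)
  finally have "\<Lambda> < ln (2 * Q ^ r)" unfolding \<Lambda>_def using N by simp
  also have "\<dots> = ln 2 + r * q" using Q3 by (simp add: ln_mult ln_realpow q_def)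
  also have "\<dots> \<le> 1 + (2 * d * q + 2) * q"
  proof -
    have "log 2 Q \<le> 2 * q"
      using ln2_ge_two_thirds q1 by (simp add: log_def q_def[symmetric] field_simps)
    then have "d * log 2 Q \<le> d * (2 * q)" by (rule mult_left_mono) simp
    moreover have "0 \<le> d * log 2 Q" using log0 by simp
    ultimately have "r \<le> 2 * d * q + 2" unfolding r_def by linarith
    then show ?thesis using q1 ln_le_minus_one[of 2] by (intro add_mono mult_right_mono) auto
  qed
  also have "\<dots> \<le> 3 * (real d + 1) * q\<^sup>2"
  proof -
    have "q \<le> q\<^sup>2" using mult_left_mono[of 1 q q] q1 by (simp add: power2_eq_square)
    moreover have "0 \<le> d * q\<^sup>2" by simp
    moreover have "1 + (2 * d * q + 2) * q = 1 + 2 * (d * q\<^sup>2) + 2 * q"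
      "3 * (real d + 1) * q\<^sup>2 = 3 * (d * q\<^sup>2) + 3 * q\<^sup>2"
      by (simp_all add: power2_eq_square algebra_simps)
    ultimately show ?thesis using q1 by linarith
  qed
  finally have \<Lambda>_le: "\<Lambda> \<le> 3 * (real d + 1) * q\<^sup>2" by simp
  define u where "u = 1 + \<Lambda>"
  define K where "K = real k + 1"
  have u1: "1 \<le> u" and K1: "1 \<le> K" using \<Lambda>0 by (auto simp: u_def K_def)
  have "Q \<le> 2592 * 16 ^ k * u"
  proof -
    have "(8 * 2 ^ k + 1 :: real)\<^sup>2 \<le> (9 * 2 ^ k)\<^sup>2" using t1 by (intro power_mono) auto
    also have "\<dots> = 81 * 4 ^ k"
      by (simp add: power2_eq_square flip: power_mult_distrib)
    finally have sq: "(8 * 2 ^ k + 1 :: real)\<^sup>2 \<le> 81 * 4 ^ k" .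
    have "1 \<le> (4 :: real) ^ k" by simp
    moreover have "16 * 4 ^ k * u = 16 * 4 ^ k * \<Lambda> + 16 * 4 ^ k" by (simp add: u_def distrib_left)
    ultimately have "n \<le> 16 * 4 ^ k * u" using n_upper by linarith
    then have "Q \<le> 2 * (16 * 4 ^ k * u) * (81 * 4 ^ k)"
      unfolding Q_def using sq u1 by (intro mult_mono) auto
    also have "\<dots> = 2592 * (4 ^ k * 4 ^ k) * u" by simp
    also have "4 ^ k * 4 ^ k = (16 :: real) ^ k" unfolding power_mult_distrib[symmetric] by simp
    finally show ?thesis .
  qed
  then have "q \<le> ln (2592 * 16 ^ k * u)" unfolding q_def using Q3 u1 by simp
  also have "\<dots> = ln 2592 + k * ln 16 + ln u" using u1 by (simp add: ln_mult ln_realpow)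
  also have "\<dots> \<le> 12 * K + ln u"
  proof -
    have "ln (2592 :: real) \<le> ln (2 ^ 12)" by simp
    also have "\<dots> \<le> 12" using ln_le_minus_one[of 2] by (subst ln_realpow) auto
    finally have "ln (2592 :: real) \<le> 12" .
    moreover have "ln (16 :: real) \<le> 4"
      using ln_le_minus_one[of 2] ln_realpow[of 2 4] by simp
    then have "k * ln 16 \<le> real k * 4" by (intro mult_left_mono) auto
    ultimately show ?thesis by (simp add: K_def)
  qed
  finally have q_le: "q \<le> 12 * K + ln u" .
  \<comment> \<open>The fourth root makes \<open>q\<^sup>2\<close> of order \<open>w\<^sup>2\<close>
    while \<open>u = w ^ 4\<close>, so that cancelling \<open>w\<^sup>2\<close> leaves a bound on
    the square root of \<open>u\<close>.\<close>
  define w where "w = u powr (1 / 4)"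
  have w1: "1 \<le> w" unfolding w_def using u1 by (simp add: ge_one_powr_ge_zero)
  have w4: "w ^ 4 = u" unfolding w_def using u1 by (simp add: powr_powr flip: powr_realpow)
  have "ln u = 4 * ln w" using w1 by (simp add: w4[symmetric] ln_realpow)
  also have "\<dots> \<le> 4 * w" using ln_le_minus_one[of w] w1 by simp
  also have "\<dots> \<le> 4 * (K * w)" using K1 w1 by simp
  finally have "ln u \<le> 4 * (K * w)" .
  moreover have "K \<le> K * w" using K1 w1 by simp
  ultimately have "q \<le> 16 * (K * w)" using q_le by linarith
  then have q2: "q\<^sup>2 \<le> 256 * (K\<^sup>2 * w\<^sup>2)"
    using power_mono[of q "16 * (K * w)" 2] q1 by (simp add: power_mult_distrib)
  have "u \<le> 1 + 3 * (real d + 1) * (256 * (K\<^sup>2 * w\<^sup>2))"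
    using order_trans[OF \<Lambda>_le mult_left_mono[OF q2, of "3 * (real d + 1)"]] by (simp add: u_def)
  also have "\<dots> \<le> 769 * (real d + 1) * K\<^sup>2 * w\<^sup>2"
  proof -
    have "1 * (1 * 1) \<le> (real d + 1) * (K\<^sup>2 * w\<^sup>2)"
      using K1 w1 by (intro mult_mono) auto
    then show ?thesis by (simp add: algebra_simps)
  qed
  finally have "w\<^sup>2 * w\<^sup>2 \<le> 769 * (real d + 1) * K\<^sup>2 * w\<^sup>2"
    by (simp add: w4[symmetric] power_add[symmetric])
  then have "w\<^sup>2 \<le> 769 * (real d + 1) * K\<^sup>2"
    by (rule mult_right_le_imp_le) (use w1 in simp)
  also have "\<dots> \<le> a * 16 ^ k"
  proof -
    have "real d + 1 \<le> (c + 1) * 4 ^ k"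
    proof -
      have "(1 :: real) \<le> 4 ^ k" by simp
      moreover have "(c + 1) * 4 ^ k = c * 4 ^ k + 4 ^ k" by (simp add: distrib_right)
      ultimately show ?thesis using d by linarith
    qed
    moreover have "real (k + 1) \<le> real (2 ^ k)" using less_exp[of k]
      by (intro of_nat_mono) (metis Suc_eq_plus1 Suc_leI)
    then have "K \<le> 2 ^ k" by (simp add: K_def add.commute)
    then have "K\<^sup>2 \<le> (2 ^ k)\<^sup>2" using K1 by (intro power_mono) auto
    ultimately have "769 * (real d + 1) * K\<^sup>2 \<le> 769 * ((c + 1) * 4 ^ k) * (2 ^ k)\<^sup>2"
      using c by (intro mult_mono) auto
    also have "\<dots> = a * (4 ^ k * (2 ^ k * 2 ^ k))" by (simp add: a_def power2_eq_square mult_ac)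
    also have "4 ^ k * (2 ^ k * 2 ^ k) = (16 :: real) ^ k"
      unfolding power_mult_distrib[symmetric] by simp
    finally show ?thesis .
  qed
  finally have w2_le: "w\<^sup>2 \<le> a * 16 ^ k" .
  \<comment> \<open>Second pass: the polynomial bound on \<open>w\<^sup>2\<close> makes
    \<open>ln u\<close> linear in \<open>k + 1\<close>.\<close>
  have "ln u = 2 * ln (w\<^sup>2)" using w1 by (simp add: w4[symmetric] ln_realpow)
  also have "\<dots> \<le> 2 * ln (a * 16 ^ k)" using w2_le w1 a by (intro mult_left_mono ln_mono) auto
  also have "\<dots> = 2 * ln a + 2 * (k * ln 16)" using a by (simp add: ln_mult ln_realpow)
  also have "\<dots> \<le> (2 * ln a + 8) * K"
  proof -
    have "ln (16 :: real) \<le> 4"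
      using ln_le_minus_one[of 2] ln_realpow[of 2 4] by simp
    then have "k * ln 16 \<le> real k * 4" by (intro mult_left_mono) auto
    moreover have "ln a * 1 \<le> ln a * K" using K1 a by (intro mult_left_mono) auto
    moreover have "real k = K - 1" by (simp add: K_def)
    moreover have "(2 * ln a + 8) * K = 2 * (ln a * K) + 8 * K" by (simp add: distrib_right)
    ultimately show ?thesis by linarith
  qed
  finally have "q \<le> B * K" using q_le by (simp add: B_def algebra_simps)
  then have "q\<^sup>2 \<le> B\<^sup>2 * K\<^sup>2" using power_mono[of q "B * K" 2] q1 by (simp add: power_mult_distrib)
  then have "3 * (real d + 1) * q\<^sup>2 \<le> 3 * (real d + 1) * (B\<^sup>2 * K\<^sup>2)"
    by (rule mult_left_mono) simp
  with \<Lambda>_le have "\<Lambda> \<le> 3 * (real d + 1) * (B\<^sup>2 * K\<^sup>2)" by (rule order_trans)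
  also have "\<dots> = 3 * B\<^sup>2 * (real d + 1) * K\<^sup>2" by simp
  finally show "ln (real N) \<le> 3 * B\<^sup>2 * (real d + 1) * (real k + 1)\<^sup>2"
    unfolding \<Lambda>_def K_def .
qed

section \<open>Semi-inner products and Gram-Schmidt orthonormalisation\<close>

text \<open>Covariance vanishes on constants, so the form is only semidefinite, and bounded
  measurable functions are a set rather than a type; hence a locale over a carrier. The operation
  \<open>f + c * g\<close> covers sums, differences and multiples at once.\<close>

locale semi_inner =
  fixes V :: "('a \<Rightarrow> real) set" and ip :: "('a \<Rightarrow> real) \<Rightarrow> ('a \<Rightarrow> real) \<Rightarrow> real"
  assumes zero_mem: "(\<lambda>x. 0) \<in> V"
    and lin_mem: "f \<in> V \<Longrightarrow> g \<in> V \<Longrightarrow> (\<lambda>x. f x + c * g x) \<in> V"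
    and ip_lin: "f \<in> V \<Longrightarrow> g \<in> V \<Longrightarrow> h \<in> V \<Longrightarrow> ip (\<lambda>x. f x + c * g x) h = ip f h + c * ip g h"
    and ip_sym: "f \<in> V \<Longrightarrow> g \<in> V \<Longrightarrow> ip f g = ip g f"
    and ip_nonneg: "f \<in> V \<Longrightarrow> 0 \<le> ip f f"
begin

lemma scale_mem: "f \<in> V \<Longrightarrow> (\<lambda>x. c * f x) \<in> V"
  using lin_mem[OF zero_mem, of f c] by simp

lemma ip_zero: "h \<in> V \<Longrightarrow> ip (\<lambda>x. 0) h = 0"
  using ip_lin[OF zero_mem zero_mem, of h 1] by simp

lemma ip_scale: "f \<in> V \<Longrightarrow> h \<in> V \<Longrightarrow> ip (\<lambda>x. c * f x) h = c * ip f h"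
  using ip_lin[OF zero_mem, of f h c] by (simp add: ip_zero)

lemma sum_mem: "(\<And>i. i \<in> I \<Longrightarrow> u i \<in> V) \<Longrightarrow> (\<lambda>x. \<Sum>i\<in>I. c i * u i x) \<in> V"
proof (induction I rule: infinite_finite_induct)
  case (insert i I)
  then show ?case using lin_mem[of "\<lambda>x. \<Sum>i\<in>I. c i * u i x" "u i" "c i"] by (simp add: add.commute)
qed (simp_all add: zero_mem)

lemma ip_sum:
  "(\<And>i. i \<in> I \<Longrightarrow> u i \<in> V) \<Longrightarrow> h \<in> V \<Longrightarrow> ip (\<lambda>x. \<Sum>i\<in>I. c i * u i x) h = (\<Sum>i\<in>I. c i * ip (u i) h)"
proof (induction I rule: infinite_finite_induct)
  case (insert i I)
  then show ?case
    using ip_lin[of "\<lambda>x. \<Sum>i\<in>I. c i * u i x" "u i" h "c i"] by (simp add: add.commute sum_mem)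
qed (simp_all add: ip_zero)

definition nrm :: "('a \<Rightarrow> real) \<Rightarrow> real" where
  "nrm f = sqrt (ip f f)"

lemma nrm_nonneg: "f \<in> V \<Longrightarrow> 0 \<le> nrm f"
  by (simp add: nrm_def ip_nonneg)

lemma nrm_sq: "f \<in> V \<Longrightarrow> (nrm f)\<^sup>2 = ip f f"
  by (simp add: nrm_def ip_nonneg)

lemma ip_lin_self:
  assumes "f \<in> V" "g \<in> V"
  shows "ip (\<lambda>x. f x + c * g x) (\<lambda>x. f x + c * g x) = ip f f + 2 * c * ip f g + c\<^sup>2 * ip g g"
proof -
  let ?h = "\<lambda>x. f x + c * g x"
  have h: "?h \<in> V" using assms by (rule lin_mem)
  have "ip ?h ?h = ip f ?h + c * ip g ?h" using assms h by (rule ip_lin)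
  also have "ip f ?h = ip f f + c * ip g f" using ip_sym[OF assms(1) h] ip_lin[OF assms assms(1)]
    by simp
  also have "ip g ?h = ip f g + c * ip g g" using ip_sym[OF assms(2) h] ip_lin[OF assms assms(2)]
    by simp
  also have "ip g f = ip f g" using assms by (simp add: ip_sym)
  finally show ?thesis by (simp add: power2_eq_square algebra_simps)
qed

lemma Cauchy_Schwarz:
  assumes "f \<in> V" "g \<in> V"
  shows "\<bar>ip f g\<bar> \<le> nrm f * nrm g"
proof -
  have quad: "0 \<le> ip f f + 2 * c * ip f g + c\<^sup>2 * ip g g" for c
    using ip_nonneg[OF lin_mem[OF assms, of c]] ip_lin_self[OF assms, of c] by simp
  have "(ip f g)\<^sup>2 \<le> ip f f * ip g g"
  proof (cases "ip g g = 0")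
    case True
    have "ip f g = 0"
    proof (rule ccontr)
      assume ne: "ip f g \<noteq> 0"
      \<comment> \<open>Without the quadratic term the expression is affine in \<open>c\<close>, and
        this \<open>c\<close> makes it equal to \<open>-1\<close>.\<close>
      have "0 \<le> ip f f + 2 * (- (ip f f + 1) / (2 * ip f g)) * ip f g"
        using quad[of "- (ip f f + 1) / (2 * ip f g)"] True by simp
      also have "\<dots> = -1" using ne by (simp add: field_simps)
      finally show False by simp
    qed
    then show ?thesis using True by simp
  next
    case False
    then have pos: "0 < ip g g" using ip_nonneg[OF assms(2)] by simp
    have "0 \<le> ip f f + 2 * (- ip f g / ip g g) * ip f g + (- ip f g / ip g g)\<^sup>2 * ip g g"
      by (rule quad)
    also have "\<dots> = ip f f - (ip f g)\<^sup>2 / ip g g" using pos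
      by (simp add: power2_eq_square field_simps)
    finally show ?thesis using pos by (simp add: field_simps)
  qed
  then have "sqrt ((ip f g)\<^sup>2) \<le> sqrt (ip f f * ip g g)" by (rule real_sqrt_le_mono)
  then show ?thesis by (simp add: nrm_def real_sqrt_mult)
qed

lemma nrm_triangle_lin:
  assumes "f \<in> V" "g \<in> V"
  shows "nrm (\<lambda>x. f x + c * g x) \<le> nrm f + \<bar>c\<bar> * nrm g"
proof (rule power2_le_imp_le)
  have "c * ip f g \<le> \<bar>c\<bar> * (nrm f * nrm g)"
    using mult_left_mono[OF Cauchy_Schwarz[OF assms], of "\<bar>c\<bar>"] abs_le_D1[of "c * ip f g"]
    by (simp add: abs_mult)
  then show "(nrm (\<lambda>x. f x + c * g x))\<^sup>2 \<le> (nrm f + \<bar>c\<bar> * nrm g)\<^sup>2"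
    using assms
    by (simp add: nrm_sq lin_mem ip_lin_self power2_sum power_mult_distrib mult_ac)
  show "0 \<le> nrm f + \<bar>c\<bar> * nrm g" using assms by (simp add: nrm_nonneg)
qed

lemma nrm_diff_triangle:
  assumes "f \<in> V" "g \<in> V" "h \<in> V"
  shows "nrm (\<lambda>x. f x - h x) \<le> nrm (\<lambda>x. f x - g x) + nrm (\<lambda>x. g x - h x)"
proof -
  have "(\<lambda>x. f x - g x) \<in> V" "(\<lambda>x. g x - h x) \<in> V"
    using lin_mem[OF assms(1,2), of "-1"] lin_mem[OF assms(2,3), of "-1"] by simp_all
  from nrm_triangle_lin[OF this, of 1] show ?thesis by simp
qed

lemma nrm_diff_commute:
  assumes "f \<in> V" "g \<in> V"
  shows "nrm (\<lambda>x. f x - g x) = nrm (\<lambda>x. g x - f x)"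
  using ip_lin_self[OF assms, of "-1"] ip_lin_self[OF assms(2,1), of "-1"] ip_sym[OF assms]
  by (simp add: nrm_def)

lemma nrm_sum_le:
  "(\<And>i. i \<in> I \<Longrightarrow> u i \<in> V) \<Longrightarrow> nrm (\<lambda>x. \<Sum>i\<in>I. c i * u i x) \<le> (\<Sum>i\<in>I. \<bar>c i\<bar> * nrm (u i))"
proof (induction I rule: infinite_finite_induct)
  case (insert i I)
  have "nrm (\<lambda>x. (\<Sum>i\<in>I. c i * u i x) + c i * u i x)
    \<le> nrm (\<lambda>x. \<Sum>i\<in>I. c i * u i x) + \<bar>c i\<bar> * nrm (u i)"
    using insert.prems by (intro nrm_triangle_lin sum_mem) auto
  also have "\<dots> \<le> (\<Sum>i\<in>I. \<bar>c i\<bar> * nrm (u i)) + \<bar>c i\<bar> * nrm (u i)" using insert by simp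
  finally show ?case using insert.hyps by (simp add: add.commute)
qed (simp_all add: nrm_def ip_zero[OF zero_mem])

lemma abs_nrm_diff_le:
  assumes "f \<in> V" "g \<in> V"
  shows "\<bar>nrm f - nrm g\<bar> \<le> nrm (\<lambda>x. f x - g x)"
proof -
  have d: "(\<lambda>x. f x - g x) \<in> V" using lin_mem[OF assms, of "-1"] by simp
  have "nrm f \<le> nrm g + nrm (\<lambda>x. f x - g x)" using nrm_triangle_lin[OF assms(2) d, of 1] by simp
  moreover have "nrm g \<le> nrm f + nrm (\<lambda>x. f x - g x)"
    using nrm_triangle_lin[OF assms(1) d, of "-1"] by simp
  ultimately show ?thesis by linarith
qed

text \<open>For a residual of norm zero the division below yields the zero function, so that no case
  distinction is needed.\<close>

context
  fixes f :: "nat \<Rightarrow> 'a \<Rightarrow> real"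
begin

fun gs :: "nat \<Rightarrow> 'a \<Rightarrow> real" where
  "gs n = (\<lambda>x. (f n x - (\<Sum>j<n. ip (f n) (gs j) * gs j x)) /
     nrm (\<lambda>x. f n x - (\<Sum>j<n. ip (f n) (gs j) * gs j x)))"

declare gs.simps [simp del]

definition resid :: "nat \<Rightarrow> 'a \<Rightarrow> real" where
  "resid n = (\<lambda>x. f n x - (\<Sum>j<n. ip (f n) (gs j) * gs j x))"

lemma gs_eq: "gs n = (\<lambda>x. (1 / nrm (resid n)) * resid n x)"
  by (subst gs.simps) (simp add: resid_def)

context
  assumes f_mem: "\<And>n. f n \<in> V"
begin

lemma gs_mem: "gs n \<in> V"
proof (induction n rule: less_induct)
  case (less n)
  have "resid n \<in> V"
    using lin_mem[OF f_mem sum_mem[of "{..<n}" gs "\<lambda>j. ip (f n) (gs j)"], of n "-1"] less.IH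
    by (simp add: resid_def)
  then show ?case unfolding gs_eq by (rule scale_mem)
qed

lemma resid_mem: "resid n \<in> V"
  using lin_mem[OF f_mem sum_mem[of "{..<n}" gs "\<lambda>j. ip (f n) (gs j)"], of n "-1"] gs_mem
  by (simp add: resid_def)

lemma ip_resid:
  assumes "g \<in> V"
  shows "ip (resid n) g = ip (f n) g - (\<Sum>j<n. ip (f n) (gs j) * ip (gs j) g)"
  using ip_lin[OF f_mem sum_mem[of "{..<n}" gs "\<lambda>j. ip (f n) (gs j)"] assms, of n "-1"] gs_mem
  by (simp add: resid_def ip_sum assms)

lemma ip_gs: "g \<in> V \<Longrightarrow> ip (gs n) g = ip (resid n) g / nrm (resid n)"
  using ip_scale[OF resid_mem, of g "1 / nrm (resid n)" n] by (simp add: gs_eq)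

lemma gs_self: "ip (gs n) (gs n) = 1 \<or> gs n = (\<lambda>x. 0)"
proof (cases "nrm (resid n) = 0")
  case True
  then show ?thesis by (simp add: gs_eq)
next
  case False
  have "ip (gs n) (gs n) = ip (resid n) (gs n) / nrm (resid n)" by (rule ip_gs[OF gs_mem])
  also have "ip (resid n) (gs n) = (nrm (resid n))\<^sup>2 / nrm (resid n)"
    using ip_sym[OF resid_mem gs_mem, of n n] ip_gs[OF resid_mem, of n n]
    by (simp add: nrm_sq resid_mem)
  finally show ?thesis using False by (simp add: power2_eq_square)
qed

lemma gs_orthogonal: "i < n \<Longrightarrow> ip (gs n) (gs i) = 0"
proof (induction n arbitrary: i rule: less_induct)
  case (less n)
  have "ip (resid n) (gs i) = ip (f n) (gs i) - (\<Sum>j<n. ip (f n) (gs j) * ip (gs j) (gs i))"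
    by (rule ip_resid[OF gs_mem])
  also have "(\<Sum>j<n. ip (f n) (gs j) * ip (gs j) (gs i))
    = (\<Sum>j<n. if j = i then ip (f n) (gs i) * ip (gs i) (gs i) else 0)"
  proof (rule sum.cong[OF refl])
    fix j assume j: "j \<in> {..<n}"
    consider "j < i" | "j = i" | "i < j" by linarith
    then show "ip (f n) (gs j) * ip (gs j) (gs i)
      = (if j = i then ip (f n) (gs i) * ip (gs i) (gs i) else 0)"
    proof cases
      case 1
      then have "ip (gs i) (gs j) = 0" using less by simp
      then show ?thesis using 1 ip_sym[OF gs_mem gs_mem, of i j] by simp
    next
      case 3
      then have "ip (gs j) (gs i) = 0" using less j by simp
      then show ?thesis using 3 by simp
    qed simp
  qed
  also have "\<dots> = ip (f n) (gs i) * ip (gs i) (gs i)" using less.prems by simp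
  also have "\<dots> = ip (f n) (gs i)"
  proof (cases "ip (gs i) (gs i) = 1")
    case False
    then have "gs i = (\<lambda>x. 0)" using gs_self by blast
    then show ?thesis using ip_zero[OF f_mem] ip_sym[OF f_mem zero_mem] by simp
  qed simp
  finally have "ip (resid n) (gs i) = 0" by simp
  then show ?case by (simp add: ip_gs gs_mem)
qed

lemma ip_gs_distinct: "i \<noteq> j \<Longrightarrow> ip (gs i) (gs j) = 0"
  using gs_orthogonal[of i j] gs_orthogonal[of j i] ip_sym[OF gs_mem gs_mem, of i j] by linarith

text \<open>The residual is its norm times \<open>gs n\<close> as far as inner products can tell. If
  the norm vanishes this is Cauchy-Schwarz: a null vector is orthogonal to everything.\<close>

lemma ip_gs_expansion:
  assumes g: "g \<in> V"
  shows "ip (f n) g = (\<Sum>j\<le>n. ip (f n) (gs j) * ip (gs j) g)"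
proof -
  have q: "ip (f n) (gs n) = nrm (resid n)"
  proof -
    have "ip (resid n) (gs n) = ip (f n) (gs n)"
      using ip_resid[OF gs_mem, of n n] by (simp add: ip_gs_distinct)
    moreover have "ip (resid n) (gs n) = (nrm (resid n))\<^sup>2 / nrm (resid n)"
      using ip_sym[OF resid_mem gs_mem, of n n] ip_gs[OF resid_mem, of n n]
      by (simp add: nrm_sq resid_mem)
    ultimately show ?thesis by (simp add: power2_eq_square)
  qed
  have "ip (resid n) g = nrm (resid n) * ip (gs n) g"
  proof (cases "nrm (resid n) = 0")
    case True
    then show ?thesis using Cauchy_Schwarz[OF resid_mem g, of n] by simp
  next
    case False
    then show ?thesis by (simp add: ip_gs g)
  qed
  then show ?thesis using ip_resid[OF g, of n] q by (simp add: lessThan_Suc_atMost[symmetric])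
qed

lemma ip_gs_above: "n < j \<Longrightarrow> ip (f n) (gs j) = 0"
  using ip_gs_expansion[OF gs_mem, of n j] by (simp add: ip_gs_distinct)

lemma ip_eq_sum_coords:
  assumes "n < K" "m < K"
  shows "ip (f n) (f m) = (\<Sum>j<K. ip (f n) (gs j) * ip (f m) (gs j))"
proof -
  have "ip (f n) (f m) = (\<Sum>j\<le>n. ip (f n) (gs j) * ip (f m) (gs j))"
    using ip_gs_expansion[OF f_mem, of n m] ip_sym[OF gs_mem f_mem] by simp
  also have "\<dots> = (\<Sum>j<K. ip (f n) (gs j) * ip (f m) (gs j))"
    using assms(1) by (intro sum.mono_neutral_left) (auto simp: ip_gs_above)
  finally show ?thesis .
qed

text \<open>The sum of squares is the variance of the same combination after each function is
  replaced by its coordinates times independent standard normals. Indices given by \<open>t\<close>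
  may repeat.\<close>

lemma ip_combination:
  assumes "finite I" "\<And>i. i \<in> I \<Longrightarrow> t i < K"
  shows "ip (\<lambda>x. \<Sum>i\<in>I. c i * f (t i) x) (\<lambda>x. \<Sum>i\<in>I. c i * f (t i) x)
    = (\<Sum>j<K. (\<Sum>i\<in>I. c i * ip (f (t i)) (gs j))\<^sup>2)"
proof -
  let ?u = "\<lambda>x. \<Sum>i\<in>I. c i * f (t i) x"
  have u: "?u \<in> V" by (intro sum_mem f_mem)
  have "ip ?u ?u = (\<Sum>i\<in>I. c i * ip (f (t i)) ?u)" using u by (intro ip_sum f_mem)
  also have "\<dots> = (\<Sum>i\<in>I. c i * (\<Sum>l\<in>I. c l * ip (f (t l)) (f (t i))))"
    using u by (intro sum.cong refl) (simp add: ip_sym[OF f_mem u] ip_sum f_mem)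
  also have "\<dots> = (\<Sum>i\<in>I. c i * (\<Sum>l\<in>I. c l * (\<Sum>j<K. ip (f (t l)) (gs j) * ip (f (t i)) (gs j))))"
    using assms(2) by (intro sum.cong refl arg_cong2[where f="(*)"] ip_eq_sum_coords)
  also have "\<dots> = (\<Sum>i\<in>I. \<Sum>l\<in>I. \<Sum>j<K. (c i * ip (f (t i)) (gs j)) * (c l * ip (f (t l)) (gs j)))"
    by (simp add: sum_distrib_left mult_ac)
  also have "\<dots> = (\<Sum>j<K. (\<Sum>i\<in>I. c i * ip (f (t i)) (gs j))\<^sup>2)"
    unfolding power2_eq_square sum_product
    by (subst sum.swap[of _ "{..<K}"], subst sum.swap[of _ I "{..<K}"]) (rule refl)
  finally show ?thesis .
qed

end

end

end

section \<open>Centered normal random variables\<close>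

text \<open>Stated through the law of a scaled standard normal instead of a density, so that
  \<sigma> = 0, which occurs for functions at distance zero, is no special case and limits stay in
  the class.\<close>

definition centered_normal :: "'w measure \<Rightarrow> ('w \<Rightarrow> real) \<Rightarrow> real \<Rightarrow> bool" where
  "centered_normal N Z \<sigma> \<longleftrightarrow> Z \<in> borel_measurable N \<and> 0 \<le> \<sigma> \<and>
     distr N borel Z = distr std_normal_distribution borel (\<lambda>x. \<sigma> * x)"

lemma char_distr_eq:
  "Z \<in> borel_measurable N \<Longrightarrow> char (distr N borel Z) t = (CLINT \<omega>|N. iexp (t * Z \<omega>))"
  by (simp add: char_def integral_distr)

lemma char_distr_scale:
  "Z \<in> borel_measurable N \<Longrightarrow> char (distr N borel (\<lambda>\<omega>. c * Z \<omega>)) t = char (distr N borel Z) (c * t)"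
  by (simp add: char_distr_eq mult_ac)

lemma char_scaled_std_normal:
  "char (distr std_normal_distribution borel (\<lambda>x. \<sigma> * x)) t
    = complex_of_real (exp (- ((\<sigma> * t)\<^sup>2 / 2)))"
proof -
  have "char (distr std_normal_distribution borel (\<lambda>x. \<sigma> * x)) t
      = char (distr std_normal_distribution borel (\<lambda>x. x)) (\<sigma> * t)"
    by (rule char_distr_scale) simp
  also have "distr std_normal_distribution borel (\<lambda>x. x) = std_normal_distribution"
    by (rule distr_id2) simp
  finally show ?thesis by (simp add: char_std_normal_distribution)
qed

text \<open>Levy's uniqueness theorem reduces independent sums and almost sure limits to products
  and limits of characteristic functions.\<close>

lemma centered_normal_iff_char:
  assumes "prob_space N" "Z \<in> borel_measurable N" "0 \<le> \<sigma>"
  shows "centered_normal N Z \<sigma> \<longleftrightarrow>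
    (\<forall>t. char (distr N borel Z) t = complex_of_real (exp (- ((\<sigma> * t)\<^sup>2 / 2))))"
proof
  assume "centered_normal N Z \<sigma>"
  then show "\<forall>t. char (distr N borel Z) t = complex_of_real (exp (- ((\<sigma> * t)\<^sup>2 / 2)))"
    by (simp add: centered_normal_def char_scaled_std_normal)
next
  assume char: "\<forall>t. char (distr N borel Z) t = complex_of_real (exp (- ((\<sigma> * t)\<^sup>2 / 2)))"
  interpret N: prob_space N by fact
  interpret S: real_distribution std_normal_distribution by (rule real_dist_normal_dist)
  have "distr N borel Z = distr std_normal_distribution borel (\<lambda>x. \<sigma> * x)"
    using char assms(2)
    by (intro Levy_uniqueness N.real_distribution_distr S.real_distribution_distr ext)
      (simp_all add: char_scaled_std_normal)
  then show "centered_normal N Z \<sigma>" using assms by (simp add: centered_normal_def)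
qed

section \<open>Exponential moments and the Gaussian maximal inequality\<close>

lemma normal_density_exp_shift:
  "std_normal_density x * exp (a * x) = exp (a\<^sup>2 / 2) * normal_density a 1 x"
proof -
  have "a * x - x\<^sup>2 / 2 = a\<^sup>2 / 2 - (x - a)\<^sup>2 / 2"
    by (simp add: power2_eq_square algebra_simps add_divide_distrib diff_divide_distrib)
  then have "exp (a * x) * exp (- x\<^sup>2 / 2) = exp (a\<^sup>2 / 2) * exp (- (x - a)\<^sup>2 / 2)"
    by (simp add: exp_add[symmetric])
  then show ?thesis by (simp add: normal_density_def std_normal_density_def mult.commute)
qed

text \<open>Completing the square turns the integrand into a multiple of a shifted normal density,
  whose total mass is 1.\<close>

lemma std_normal_exp_moment:
  "(\<integral>\<^sup>+x. ennreal (exp (a * x)) \<partial>std_normal_distribution) = ennreal (exp (a\<^sup>2 / 2))"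
proof -
  have "(\<integral>\<^sup>+x. ennreal (exp (a * x)) \<partial>std_normal_distribution)
      = (\<integral>\<^sup>+x. ennreal (exp (a\<^sup>2 / 2)) * ennreal (normal_density a 1 x) \<partial>lborel)"
    by (subst nn_integral_density)
      (auto simp: ennreal_mult[symmetric] normal_density_exp_shift intro!: nn_integral_cong)
  also have "\<dots> = ennreal (exp (a\<^sup>2 / 2)) * (\<integral>\<^sup>+x. ennreal (normal_density a 1 x) \<partial>lborel)"
    by (rule nn_integral_cmult) simp
  also have "(\<integral>\<^sup>+x. ennreal (normal_density a 1 x) \<partial>lborel) = 1"
    by (subst nn_integral_eq_integral) auto
  finally show ?thesis by simp
qed

context
  fixes N :: "'w measure" and Z :: "'w \<Rightarrow> real" and \<sigma> :: real
  assumes N: "prob_space N" and Z: "centered_normal N Z \<sigma>"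
begin

lemma centered_normal_measurable: "Z \<in> borel_measurable N"
  using Z by (simp add: centered_normal_def)

lemma centered_normal_distr: "distr N borel Z = distr std_normal_distribution borel (\<lambda>x. \<sigma> * x)"
  using Z by (simp add: centered_normal_def)

lemma centered_normal_integral:
  fixes g :: "real \<Rightarrow> real"
  assumes "g \<in> borel_measurable borel"
  shows "(\<integral>\<omega>. g (Z \<omega>) \<partial>N) = (\<integral>x. g (\<sigma> * x) \<partial>std_normal_distribution)"
proof -
  have "(\<integral>\<omega>. g (Z \<omega>) \<partial>N) = (\<integral>x. g x \<partial>distr N borel Z)"
    using centered_normal_measurable assms by (simp add: integral_distr)
  also have "\<dots> = (\<integral>x. g (\<sigma> * x) \<partial>std_normal_distribution)"
    unfolding centered_normal_distr using assms by (simp add: integral_distr)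
  finally show ?thesis .
qed

lemma centered_normal_mean: "(\<integral>\<omega>. Z \<omega> \<partial>N) = 0"
  using centered_normal_integral[of "\<lambda>x. x"] integral_std_normal_distribution_moment_odd[of 1]
    by simp

lemma centered_normal_second_moment: "(\<integral>\<omega>. (Z \<omega>)\<^sup>2 \<partial>N) = \<sigma>\<^sup>2"
proof -
  have "(\<integral>\<omega>. (Z \<omega>)\<^sup>2 \<partial>N) = (\<integral>x. \<sigma>\<^sup>2 * x\<^sup>2 \<partial>std_normal_distribution)"
    using centered_normal_integral[of "\<lambda>x. x\<^sup>2"] by (simp add: power_mult_distrib)
  also have "\<dots> = \<sigma>\<^sup>2 * (\<integral>x. x\<^sup>2 \<partial>std_normal_distribution)"
    by (rule integral_mult_right_zero)
  also have "(\<integral>x. x\<^sup>2 \<partial>std_normal_distribution) = 1"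
    using std_normal_distribution_even_moments(1)[of 1] by simp
  finally show ?thesis by simp
qed

lemma centered_normal_square_integrable: "integrable N (\<lambda>\<omega>. (Z \<omega>)\<^sup>2)"
proof -
  have "integrable std_normal_distribution (\<lambda>x. \<sigma>\<^sup>2 * x\<^sup>2)"
    by (intro integrable_mult_right integrable_std_normal_distribution_moment)
  then have "integrable (distr std_normal_distribution borel (\<lambda>x. \<sigma> * x)) (\<lambda>x. x\<^sup>2)"
    by (subst integrable_distr_eq) (simp_all add: power_mult_distrib)
  then show ?thesis
    unfolding centered_normal_distr[symmetric] using centered_normal_measurable
    by (subst (asm) integrable_distr_eq) simp_all
qed

lemma centered_normal_exp_abs_moment:
  "(\<integral>\<^sup>+\<omega>. ennreal (exp (l * \<bar>Z \<omega>\<bar>)) \<partial>N) \<le> ennreal (2 * exp ((l * \<sigma>)\<^sup>2 / 2))"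
proof -
  have "(\<integral>\<^sup>+\<omega>. ennreal (exp (l * \<bar>Z \<omega>\<bar>)) \<partial>N) = (\<integral>\<^sup>+x. ennreal (exp (l * \<bar>x\<bar>)) \<partial>distr N borel Z)"
    using centered_normal_measurable by (simp add: nn_integral_distr)
  also have "\<dots> = (\<integral>\<^sup>+x. ennreal (exp (l * \<bar>\<sigma> * x\<bar>)) \<partial>std_normal_distribution)"
    unfolding centered_normal_distr by (simp add: nn_integral_distr)
  also have "\<dots> \<le> (\<integral>\<^sup>+x. ennreal (exp ((l * \<sigma>) * x)) + ennreal (exp ((- (l * \<sigma>)) * x)) \<partial>std_normal_distribution)"
  proof (intro nn_integral_mono)
    fix x
    have "exp (l * \<bar>\<sigma> * x\<bar>) \<le> exp ((l * \<sigma>) * x) + exp ((- (l * \<sigma>)) * x)"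
      by (cases "0 \<le> \<sigma> * x") (auto simp: mult.assoc)
    then show "ennreal (exp (l * \<bar>\<sigma> * x\<bar>))
      \<le> ennreal (exp ((l * \<sigma>) * x)) + ennreal (exp ((- (l * \<sigma>)) * x))"
      by (simp add: ennreal_plus[symmetric] del: ennreal_plus)
  qed
  also have "\<dots> = ennreal (exp ((l * \<sigma>)\<^sup>2 / 2)) + ennreal (exp ((- (l * \<sigma>))\<^sup>2 / 2))"
    by (subst nn_integral_add) (simp_all only: std_normal_exp_moment, simp_all)
  also have "\<dots> = ennreal (2 * exp ((l * \<sigma>)\<^sup>2 / 2))"
    by (simp add: ennreal_plus[symmetric] del: ennreal_plus)
  finally show ?thesis .
qed

lemma centered_normal_zero_AE:
  assumes "\<sigma> = 0"
  shows "AE \<omega> in N. Z \<omega> = 0"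
proof -
  have "AE x in distr N borel Z. x = 0"
    unfolding centered_normal_distr assms by (subst AE_distr_iff) auto
  then show ?thesis using centered_normal_measurable by (subst (asm) AE_distr_iff) auto
qed

lemma centered_normal_distributed:
  assumes "0 < \<sigma>"
  shows "distributed N lborel Z (\<lambda>x. ennreal (normal_density 0 \<sigma> x))"
proof -
  interpret S: prob_space std_normal_distribution by (rule prob_space_normal_density) simp
  have "distr std_normal_distribution lborel (\<lambda>x. x) = std_normal_distribution"
    by (rule distr_id2) simp
  then have "distributed std_normal_distribution lborel (\<lambda>x. x) (normal_density 0 1)"
    by (simp add: distributed_def)
  from S.normal_density_affine[OF this, of \<sigma> 0] assms
  have "distributed std_normal_distribution lborel (\<lambda>x. \<sigma> * x) (normal_density 0 \<sigma>)" by simp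
  then have "distr std_normal_distribution lborel (\<lambda>x. \<sigma> * x) = density lborel (normal_density 0 \<sigma>)"
    by (simp add: distributed_def)
  moreover have "distr std_normal_distribution lborel (\<lambda>x. \<sigma> * x) = distr N lborel Z"
  proof -
    have "distr N lborel Z = distr N borel Z" "distr std_normal_distribution lborel (\<lambda>x. \<sigma> * x)
        = distr std_normal_distribution borel (\<lambda>x. \<sigma> * x)"
      by (intro distr_cong; simp)+
    then show ?thesis by (simp add: centered_normal_distr)
  qed
  ultimately show ?thesis using centered_normal_measurable by (simp add: distributed_def)
qed

end

text \<open>A union bound on exponential moments: the cardinality enters only through a logarithm,
  and optimising the exponent leaves its square root. The main term gives
  \<open>3 / 2 * s * L\<close> and the correction at most \<open>s * L\<close>, whence the 3. The 1
  added to \<open>ln m\<close> keeps the bound positive for \<open>m = 1\<close>.\<close>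

lemma nn_integral_SUP_centered_normal_le:
  assumes N: "prob_space N" and I: "finite I" "real (card I) \<le> m" and m: "1 \<le> m" and s: "0 < s"
    and Z: "\<And>i. i \<in> I \<Longrightarrow> centered_normal N (Z i) (\<sigma> i)" "\<And>i. i \<in> I \<Longrightarrow> \<sigma> i \<le> s"
  shows "(\<integral>\<^sup>+\<omega>. (SUP i\<in>I. ennreal \<bar>Z i \<omega>\<bar>) \<partial>N) \<le> ennreal (3 * s * sqrt (1 + ln m))"
proof -
  interpret N: prob_space N by fact
  define L where "L = sqrt (1 + ln m)"
  have L1: "1 \<le> L" using m by (simp add: L_def)
  have L2: "L\<^sup>2 = 1 + ln m" using m by (simp add: L_def)
  \<comment> \<open>This balances the two parts of the bound: \<open>ln A / l\<close> and
    \<open>l * s\<^sup>2\<close> are both of order \<open>s * L\<close>.\<close>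
  define l where "l = L / s"
  have l: "0 < l" using L1 s by (simp add: l_def)
  \<comment> \<open>\<open>A\<close> bounds the sum over \<open>I\<close> of the exponential
    moments, so that dividing by \<open>l * A\<close> leaves at most \<open>1 / l\<close> in
    total.\<close>
  define A where "A = 2 * m * exp (L\<^sup>2 / 2)"
  have A: "0 < A" using m by (simp add: A_def)
  have lnA: "ln A \<le> 3 / 2 * L\<^sup>2"
  proof -
    have "ln A = ln 2 + ln m + L\<^sup>2 / 2" using m by (simp add: A_def ln_mult)
    then show ?thesis using ln_le_minus_one[of 2] L2 by linarith
  qed
  have [measurable]: "Z i \<in> borel_measurable N" if "i \<in> I" for i
    using centered_normal_measurable[OF N Z(1)[OF that]] .
  text \<open>The bound \<open>x \<le> ln A + exp x / A\<close> replaces Jensen's inequality for the exponential.\<close>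
  have "(SUP i\<in>I. ennreal \<bar>Z i \<omega>\<bar>)
    \<le> ennreal (3 / 2 * L\<^sup>2 / l) + (\<Sum>i\<in>I. ennreal (1 / (l * A)) * ennreal (exp (l * \<bar>Z i \<omega>\<bar>)))" for \<omega>
  proof (rule SUP_least)
    fix i assume i: "i \<in> I"
    have "l * \<bar>Z i \<omega>\<bar> - ln A \<le> exp (l * \<bar>Z i \<omega>\<bar> - ln A)"
      using exp_ge_add_one_self[of "l * \<bar>Z i \<omega>\<bar> - ln A"] by linarith
    also have "\<dots> = exp (l * \<bar>Z i \<omega>\<bar>) / A" using A by (simp add: exp_diff)
    finally have "l * \<bar>Z i \<omega>\<bar> \<le> 3 / 2 * L\<^sup>2 + exp (l * \<bar>Z i \<omega>\<bar>) / A" using lnA by linarith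
    then have "\<bar>Z i \<omega>\<bar> \<le> (3 / 2 * L\<^sup>2 + exp (l * \<bar>Z i \<omega>\<bar>) / A) / l"
      using l by (simp add: pos_le_divide_eq mult.commute)
    then have "\<bar>Z i \<omega>\<bar> \<le> 3 / 2 * L\<^sup>2 / l + 1 / (l * A) * exp (l * \<bar>Z i \<omega>\<bar>)"
      by (simp add: add_divide_distrib mult.commute)
    then have "ennreal \<bar>Z i \<omega>\<bar>
      \<le> ennreal (3 / 2 * L\<^sup>2 / l) + ennreal (1 / (l * A)) * ennreal (exp (l * \<bar>Z i \<omega>\<bar>))"
      using l A by (simp add: ennreal_mult[symmetric] ennreal_plus[symmetric] del: ennreal_plus)
    also have "ennreal (1 / (l * A)) * ennreal (exp (l * \<bar>Z i \<omega>\<bar>))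
        \<le> (\<Sum>i\<in>I. ennreal (1 / (l * A)) * ennreal (exp (l * \<bar>Z i \<omega>\<bar>)))"
      using I i by (intro member_le_sum) auto
    finally show "ennreal \<bar>Z i \<omega>\<bar>
      \<le> ennreal (3 / 2 * L\<^sup>2 / l) + (\<Sum>i\<in>I. ennreal (1 / (l * A)) * ennreal (exp (l * \<bar>Z i \<omega>\<bar>)))"
      by (simp add: add_left_mono)
  qed
  then have "(\<integral>\<^sup>+\<omega>. (SUP i\<in>I. ennreal \<bar>Z i \<omega>\<bar>) \<partial>N) \<le> (\<integral>\<^sup>+\<omega>. ennreal (3 / 2 * L\<^sup>2 / l) +
      (\<Sum>i\<in>I. ennreal (1 / (l * A)) * ennreal (exp (l * \<bar>Z i \<omega>\<bar>))) \<partial>N)"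
    by (rule nn_integral_mono)
  also have "\<dots> = ennreal (3 / 2 * L\<^sup>2 / l) +
      (\<Sum>i\<in>I. ennreal (1 / (l * A)) * (\<integral>\<^sup>+\<omega>. ennreal (exp (l * \<bar>Z i \<omega>\<bar>)) \<partial>N))"
    by (simp add: nn_integral_add nn_integral_sum nn_integral_cmult N.emeasure_space_1)
  also have "\<dots> \<le> ennreal (3 / 2 * L\<^sup>2 / l) +
      (\<Sum>i\<in>I. ennreal (1 / (l * A)) * ennreal (2 * exp (L\<^sup>2 / 2)))"
  proof (intro add_left_mono sum_mono mult_left_mono)
    fix i assume i: "i \<in> I"
    have s0: "0 \<le> \<sigma> i" using Z(1)[OF i] by (simp add: centered_normal_def)
    have "l * \<sigma> i \<le> l * s" using Z(2)[OF i] l by (intro mult_left_mono) auto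
    also have "l * s = L" using s by (simp add: l_def)
    finally have "(l * \<sigma> i)\<^sup>2 \<le> L\<^sup>2" using l s0 by (intro power_mono) auto
    then have "2 * exp ((l * \<sigma> i)\<^sup>2 / 2) \<le> 2 * exp (L\<^sup>2 / 2)" by simp
    then show "(\<integral>\<^sup>+\<omega>. ennreal (exp (l * \<bar>Z i \<omega>\<bar>)) \<partial>N) \<le> ennreal (2 * exp (L\<^sup>2 / 2))"
      using centered_normal_exp_abs_moment[OF N Z(1)[OF i], of l] ennreal_leI order_trans by blast
  qed simp
  also have "(\<Sum>i\<in>I. ennreal (1 / (l * A)) * ennreal (2 * exp (L\<^sup>2 / 2)))
    = ennreal (card I * (1 / (l * A) * (2 * exp (L\<^sup>2 / 2))))"
  proof -
    have "ennreal (1 / (l * A)) * ennreal (2 * exp (L\<^sup>2 / 2))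
      = ennreal (1 / (l * A) * (2 * exp (L\<^sup>2 / 2)))"
      using l A by (intro ennreal_mult[symmetric]) auto
    then show ?thesis
      using l A by (simp only: sum_constant ennreal_of_nat_eq_real_of_nat) (intro ennreal_mult[symmetric], auto)
  qed
  also have "ennreal (3 / 2 * L\<^sup>2 / l) + \<dots>
    = ennreal (3 / 2 * L\<^sup>2 / l + card I * (1 / (l * A) * (2 * exp (L\<^sup>2 / 2))))"
    using l A by (intro ennreal_plus[symmetric]) auto
  also have "\<dots> \<le> ennreal (3 * s * L)"
  proof (rule ennreal_leI)
    have "card I * (1 / (l * A) * (2 * exp (L\<^sup>2 / 2))) \<le> m * (1 / (l * A) * (2 * exp (L\<^sup>2 / 2)))"
      using I l A by (intro mult_right_mono) auto
    also have "\<dots> = 1 / l" using m l by (simp add: A_def)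
    also have "1 / l \<le> s * L"
    proof -
      have "s * 1 \<le> s * (L * L)" using L1 s mult_mono[of 1 L 1 L] by (intro mult_left_mono) auto
      then show ?thesis using L1 by (simp add: l_def field_simps)
    qed
    finally have "card I * (1 / (l * A) * (2 * exp (L\<^sup>2 / 2))) \<le> s * L" .
    moreover have "3 / 2 * L\<^sup>2 / l = 3 / 2 * (s * L)" using L1 by (simp add: l_def power2_eq_square)
    moreover have "0 \<le> s * L" using s L1 by simp
    ultimately show "3 / 2 * L\<^sup>2 / l + card I * (1 / (l * A) * (2 * exp (L\<^sup>2 / 2))) \<le> 3 * s * L"
      by linarith
  qed
  finally show ?thesis by (simp add: L_def)
qed

section \<open>Gaussian limits and families with prescribed covariance\<close>

text \<open>Dominated convergence carries the characteristic functions to the limit. This transfers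
  normality from net points to the whole class.\<close>

lemma centered_normal_limit:
  assumes N: "prob_space N" and Y: "\<And>k. centered_normal N (Y k) (\<sigma> k)" and s: "\<sigma> \<longlonglongrightarrow> s" "0 \<le> s"
    and Z: "Z \<in> borel_measurable N" "AE \<omega> in N. (\<lambda>k. Y k \<omega>) \<longlonglongrightarrow> Z \<omega>"
  shows "centered_normal N Z s"
proof -
  interpret N: prob_space N by fact
  have [measurable]: "Y k \<in> borel_measurable N" for k using centered_normal_measurable[OF N Y] .
  note Z(1)[measurable]
  have "char (distr N borel Z) t = complex_of_real (exp (- ((s * t)\<^sup>2 / 2)))" for t
  proof (rule LIMSEQ_unique)
    have "(\<lambda>k. CLINT \<omega>|N. iexp (t * Y k \<omega>)) \<longlonglongrightarrow> (CLINT \<omega>|N. iexp (t * Z \<omega>))"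
    proof (rule integral_dominated_convergence[where w="\<lambda>_. 1"])
      show "AE \<omega> in N. (\<lambda>k. iexp (t * Y k \<omega>)) \<longlonglongrightarrow> iexp (t * Z \<omega>)"
        using Z(2) by eventually_elim (intro tendsto_intros)
    qed (auto intro!: AE_I2)
    then show "(\<lambda>k. char (distr N borel (Y k)) t) \<longlonglongrightarrow> char (distr N borel Z) t"
      by (simp add: char_distr_eq)
    have "char (distr N borel (Y k)) t = complex_of_real (exp (- ((\<sigma> k * t)\<^sup>2 / 2)))" for k
      using Y[of k] centered_normal_iff_char[OF N, of "Y k" "\<sigma> k"]
        by (simp add: centered_normal_def)
    then show "(\<lambda>k. char (distr N borel (Y k)) t) \<longlonglongrightarrow> complex_of_real (exp (- ((s * t)\<^sup>2 / 2)))"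
      using s(1) by (auto intro!: tendsto_intros)
  qed
  then show ?thesis using centered_normal_iff_char[OF N Z(1) s(2)] by blast
qed

text \<open>The coordinates are independent, so characteristic functions multiply and the squares in
  their exponents add up.\<close>

lemma centered_normal_sum_PiM:
  fixes b :: "'i \<Rightarrow> real"
  assumes "finite J"
  shows "centered_normal (PiM UNIV (\<lambda>_. std_normal_distribution)) (\<lambda>\<omega>. \<Sum>i\<in>J. b i * \<omega> i) (sqrt (\<Sum>i\<in>J. (b i)\<^sup>2))"
proof -
  interpret product_prob_space "\<lambda>_ :: 'i. std_normal_distribution" UNIV
    by (intro product_prob_spaceI prob_space_normal_density) simp
  let ?N = "PiM (UNIV :: 'i set) (\<lambda>_. std_normal_distribution)"
  have N: "prob_space ?N" by (rule P.prob_space_axioms)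
  have comp: "distr ?N std_normal_distribution (\<lambda>\<omega>. \<omega> i) = std_normal_distribution" for i :: 'i
    by (rule PiM_component) simp
  have "P.indep_vars (\<lambda>_. std_normal_distribution) (\<lambda>i \<omega>. \<omega> i) (UNIV :: 'i set)"
  proof (subst P.indep_vars_iff_distr_eq_PiM)
    have "distr ?N ?N (\<lambda>x. \<lambda>i\<in>UNIV. x i) = ?N"
      using distr_id2[of ?N ?N] by (simp add: restrict_UNIV)
    then show "distr ?N ?N (\<lambda>x. \<lambda>i\<in>UNIV. x i)
      = PiM UNIV (\<lambda>i. distr ?N std_normal_distribution (\<lambda>x. x i))"
      by (simp add: comp)
  qed auto
  then have "P.indep_vars (\<lambda>_. borel) (\<lambda>i \<omega>. b i * \<omega> i) (UNIV :: 'i set)"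
    by (rule P.indep_vars_compose2) simp
  then have indep: "P.indep_vars (\<lambda>_. borel) (\<lambda>i \<omega>. b i * \<omega> i) J"
    by (rule P.indep_vars_subset) simp
  have "char (distr ?N borel (\<lambda>\<omega>. \<Sum>i\<in>J. b i * \<omega> i)) t
      = complex_of_real (exp (- ((sqrt (\<Sum>i\<in>J. (b i)\<^sup>2) * t)\<^sup>2 / 2)))" for t
  proof -
    have "char (distr ?N borel (\<lambda>\<omega>. \<Sum>i\<in>J. b i * \<omega> i)) t
      = (\<Prod>i\<in>J. char (distr ?N borel (\<lambda>\<omega>. b i * \<omega> i)) t)"
      by (rule P.char_distr_sum[OF indep])
    also have "\<dots> = (\<Prod>i\<in>J. complex_of_real (exp (- ((b i * t)\<^sup>2 / 2))))"
    proof (rule prod.cong[OF refl])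
      fix i
      have "distr ?N borel (\<lambda>\<omega>. \<omega> i) = std_normal_distribution"
        using comp[of i] distr_cong[of ?N ?N std_normal_distribution borel "\<lambda>\<omega>. \<omega> i"] by simp
      then show "char (distr ?N borel (\<lambda>\<omega>. b i * \<omega> i)) t
        = complex_of_real (exp (- ((b i * t)\<^sup>2 / 2)))"
        by (subst char_distr_scale) (simp_all add: char_std_normal_distribution)
    qed
    also have "\<dots> = complex_of_real (exp (\<Sum>i\<in>J. - ((b i * t)\<^sup>2 / 2)))"
      using assms by (simp add: exp_sum)
    also have "(\<Sum>i\<in>J. - ((b i * t)\<^sup>2 / 2)) = - ((sqrt (\<Sum>i\<in>J. (b i)\<^sup>2) * t)\<^sup>2 / 2)"
      by (simp add: power_mult_distrib sum_nonneg sum_negf sum_divide_distrib sum_distrib_right)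
    finally show ?thesis .
  qed
  moreover have "(\<lambda>\<omega>. \<Sum>i\<in>J. b i * \<omega> i) \<in> borel_measurable ?N" by measurable
  ultimately show ?thesis
    by (subst centered_normal_iff_char[OF N]) (auto simp: sum_nonneg)
qed

text \<open>Each function receives its Gram-Schmidt coordinates as coefficients of independent
  normals, so that combinations have the variance that \<open>ip\<close> prescribes. The path space
  is dictated by the type of \<open>N\<close> in \<open>uniform_donsker\<close>. Combinations run
  over a finite sequence \<open>t\<close>, which allows repetitions; distinct functions may have the
  same projection to a net.\<close>

lemma (in semi_inner) exists_normal_family:
  fixes S :: "('a \<Rightarrow> real) set"
  assumes "countable S" "S \<subseteq> V"
  shows "\<exists>X :: ('a \<Rightarrow> real) \<Rightarrow> (('a \<Rightarrow> real) \<Rightarrow> real) \<Rightarrow> real. \<forall>n c t. (\<forall>i<n. t i \<in> S) \<longrightarrow>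
    centered_normal (PiM UNIV (\<lambda>_. std_normal_distribution))
      (\<lambda>\<omega>. \<Sum>i<n. c i * X (t i) \<omega>) (nrm (\<lambda>x. \<Sum>i<n::nat. c i * t i x))"
proof -
  \<comment> \<open>Adding the zero function makes the set nonempty, so that it can be
    enumerated.\<close>
  define S' where "S' = insert (\<lambda>_. 0) S"
  have S': "countable S'" "S' \<noteq> {}" "S' \<subseteq> V" using assms zero_mem by (auto simp: S'_def)
  define f where "f = from_nat_into S'"
  define idx where "idx = to_nat_on S'"
  have f_mem: "f n \<in> V" for n using from_nat_into[OF S'(2)] S'(3) by (auto simp: f_def)
  have f_idx: "f (idx t) = t" if "t \<in> S" for t
    using that S'(1) by (simp add: f_def idx_def S'_def)
  define a where "a n j = ip (f n) (gs f j)" for n j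
  text \<open>The coordinates of the path space at the constant functions are an i.i.d. sequence.\<close>
  define e :: "nat \<Rightarrow> 'a \<Rightarrow> real" where "e n = (\<lambda>_. real n)" for n
  have inj_e: "inj e" by (auto simp: e_def inj_def fun_eq_iff)
  define X where "X t \<omega> = (\<Sum>j\<le>idx t. a (idx t) j * \<omega> (e j))"
    for t :: "'a \<Rightarrow> real" and \<omega> :: "('a \<Rightarrow> real) \<Rightarrow> real"
  show ?thesis
  proof (intro exI[of _ X] allI impI)
    fix n c and t :: "nat \<Rightarrow> 'a \<Rightarrow> real"
    assume t: "\<forall>i<n. t i \<in> S"
    \<comment> \<open>A common length for all coordinate expansions; they can be padded because
      coordinates above the index vanish. The inserted 0 provides for \<open>n = 0\<close>.\<close>
    define K where "K = Suc (Max (insert 0 ((\<lambda>i. idx (t i)) ` {..<n})))"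
    have K: "idx (t i) < K" if "i < n" for i
      using that unfolding K_def less_Suc_eq_le by (intro Max_ge) auto
    define b where "b j = (\<Sum>i<n. c i * a (idx (t i)) j)" for j
    define b' where "b' h = b (inv e h)" for h
    have b'_e: "b' (e j) = b j" for j using inj_e by (simp add: b'_def)
    have "(\<Sum>i<n. c i * X (t i) \<omega>) = (\<Sum>h\<in>e ` {..<K}. b' h * \<omega> h)" for \<omega>
    proof -
      have "X (t i) \<omega> = (\<Sum>j<K. a (idx (t i)) j * \<omega> (e j))" if "i < n" for i
        unfolding X_def using K[OF that]
        by (intro sum.mono_neutral_left) (auto simp: a_def not_le ip_gs_above[where f=f, OF f_mem])
      then have "(\<Sum>i<n. c i * X (t i) \<omega>) = (\<Sum>i<n. \<Sum>j<K. c i * a (idx (t i)) j * \<omega> (e j))"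
        by (simp add: sum_distrib_left mult.assoc)
      also have "\<dots> = (\<Sum>j<K. b j * \<omega> (e j))"
        by (subst sum.swap) (simp add: b_def sum_distrib_right)
      also have "\<dots> = (\<Sum>h\<in>e ` {..<K}. b' h * \<omega> h)"
        using inj_e by (subst sum.reindex) (auto simp: b'_e intro: inj_on_subset)
      finally show ?thesis .
    qed
    moreover have "sqrt (\<Sum>h\<in>e ` {..<K}. (b' h)\<^sup>2) = nrm (\<lambda>x. \<Sum>i<n. c i * t i x)"
    proof -
      have "(\<Sum>h\<in>e ` {..<K}. (b' h)\<^sup>2) = (\<Sum>j<K. (b j)\<^sup>2)"
        using inj_e by (subst sum.reindex) (auto simp: b'_e intro: inj_on_subset)
      also have "\<dots> = ip (\<lambda>x. \<Sum>i<n. c i * f (idx (t i)) x) (\<lambda>x. \<Sum>i<n. c i * f (idx (t i)) x)"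
        unfolding b_def a_def using K by (intro ip_combination[symmetric] f_mem) auto
      also have "(\<lambda>x. \<Sum>i<n. c i * f (idx (t i)) x) = (\<lambda>x. \<Sum>i<n. c i * t i x)"
        using t f_idx by simp
      finally show ?thesis by (simp add: nrm_def)
    qed
    ultimately show "centered_normal (PiM UNIV (\<lambda>_. std_normal_distribution))
      (\<lambda>\<omega>. \<Sum>i<n. c i * X (t i) \<omega>) (nrm (\<lambda>x. \<Sum>i<n. c i * t i x))"
      using centered_normal_sum_PiM[of "e ` {..<K}" b'] by simp
  qed
qed

section \<open>Chaining\<close>

lemma summable_increments_limit:
  fixes x :: "nat \<Rightarrow> real"
  assumes "\<And>j. \<bar>x (Suc j) - x j\<bar> \<le> m j" "summable m"
  shows "x \<longlonglongrightarrow> lim x" "\<bar>x k - lim x\<bar> \<le> (\<Sum>j. m (j + k))"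
proof -
  have sm: "summable (\<lambda>j. m (j + k))" for k using assms(2) by (rule summable_ignore_initial_segment)
  have abs: "summable (\<lambda>j. \<bar>x (Suc (j + k)) - x (j + k)\<bar>)" for k
    by (rule summable_comparison_test'[OF sm[of k]]) (use assms(1) in auto)
  have "summable (\<lambda>j. x (Suc j) - x j)" using abs[of 0] summable_rabs_cancel by simp
  then have "convergent (\<lambda>n. \<Sum>j<n. x (Suc j) - x j)" by (simp add: summable_iff_convergent)
  then have "convergent (\<lambda>n. x n - x 0)" by (simp add: sum_lessThan_telescope)
  then have "convergent (\<lambda>n. (x n - x 0) + x 0)" by (intro convergent_add convergent_const)
  then show lim: "x \<longlonglongrightarrow> lim x" by (simp add: convergent_LIMSEQ_iff)
  have "(\<lambda>j. x (j + k)) \<longlonglongrightarrow> lim x" using lim by (rule LIMSEQ_ignore_initial_segment)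
  from telescope_sums[OF this] have s: "(\<lambda>j. x (Suc (j + k)) - x (j + k)) sums (lim x - x k)"
    by simp
  have "\<bar>x k - lim x\<bar> = \<bar>\<Sum>j. x (Suc (j + k)) - x (j + k)\<bar>"
    using sums_unique[OF s] by (simp add: abs_minus_commute)
  also have "\<dots> \<le> (\<Sum>j. \<bar>x (Suc (j + k)) - x (j + k)\<bar>)" by (rule summable_rabs[OF abs])
  also have "\<dots> \<le> (\<Sum>j. m (j + k))" using assms(1) by (intro suminf_le abs sm) auto
  finally show "\<bar>x k - lim x\<bar> \<le> (\<Sum>j. m (j + k))" .
qed

lemma tendsto_suminf_tail:
  fixes m :: "nat \<Rightarrow> real"
  assumes "summable m"
  shows "(\<lambda>k. \<Sum>j. m (j + k)) \<longlonglongrightarrow> 0"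
proof -
  have "(\<lambda>k. suminf m - (\<Sum>j<k. m j)) \<longlonglongrightarrow> suminf m - suminf m"
    using summable_LIMSEQ[OF assms] by (intro tendsto_intros)
  then show ?thesis by (simp add: suminf_minus_initial_segment[OF assms])
qed

text \<open>\<open>H j\<close> bounds the logarithm of the size of the \<open>j\<close>-th net. The
  constant 18 is \<open>3 * 3 * 2\<close>: the maximal inequality, the radius of a link, and the
  estimate of the square root below.\<close>

definition chain_weight :: "(nat \<Rightarrow> real) \<Rightarrow> nat \<Rightarrow> real" where
  "chain_weight H j = 18 * (1 / 2) ^ j * (1 + sqrt (H j) + sqrt (H (Suc j)))"

lemma chain_weight_nonneg: "(\<And>k. 0 \<le> H k) \<Longrightarrow> 0 \<le> chain_weight H j"
  by (simp add: chain_weight_def)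

text \<open>The left side is the maximal inequality at radius \<open>3 * (1 / 2) ^ j\<close> for all
  pairs from two consecutive nets. The factor 2 comes from
  \<open>3 + 2 * (a + b) \<le> 4 * (1 + a + b)\<close>.\<close>

lemma chain_weight_ge:
  assumes "0 \<le> H j" "0 \<le> H (Suc j)"
  shows "3 * (3 * (1 / 2) ^ j) * sqrt (1 + ln ((exp (H j) + exp (H (Suc j)))\<^sup>2)) \<le> chain_weight H j"
proof -
  define a where "a = H j"
  define b where "b = H (Suc j)"
  have ab: "0 \<le> a" "0 \<le> b" using assms by (auto simp: a_def b_def)
  have "exp a + exp b \<le> exp (a + b) + exp (a + b)" using ab by (intro add_mono) simp_all
  then have "exp a + exp b \<le> 2 * exp (a + b)" by simp
  then have "ln (exp a + exp b) \<le> ln (2 * exp (a + b))" by (intro ln_mono add_pos_pos) auto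
  also have "\<dots> \<le> 1 + (a + b)" using ln_le_minus_one[of 2] by (simp add: ln_mult)
  finally have "ln ((exp a + exp b)\<^sup>2) \<le> 2 + 2 * (a + b)"
    by (simp add: ln_realpow add_pos_pos)
  also have "1 + (2 + 2 * (a + b)) \<le> (2 * (1 + sqrt a + sqrt b))\<^sup>2"
  proof -
    have "(2 * (1 + x + y))\<^sup>2 = 4 * (1 + x\<^sup>2 + y\<^sup>2) + 8 * (x + y + x * y)" for x y :: real
      by (simp add: power2_eq_square algebra_simps)
    from this[of "sqrt a" "sqrt b"]
    have "(2 * (1 + sqrt a + sqrt b))\<^sup>2 = 4 * (1 + a + b) + 8 * (sqrt a + sqrt b + sqrt a * sqrt b)"
      using ab by simp
    moreover have "0 \<le> sqrt a + sqrt b + sqrt a * sqrt b" using ab by simp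
    ultimately show ?thesis using ab by simp
  qed
  finally have "1 + ln ((exp a + exp b)\<^sup>2) \<le> (2 * (1 + sqrt a + sqrt b))\<^sup>2" by simp
  then have "sqrt (1 + ln ((exp a + exp b)\<^sup>2)) \<le> 2 * (1 + sqrt a + sqrt b)"
    using ab by (intro real_le_lsqrt) auto
  then have "3 * (3 * (1 / 2) ^ j) * sqrt (1 + ln ((exp a + exp b)\<^sup>2))
      \<le> 3 * (3 * (1 / 2) ^ j) * (2 * (1 + sqrt a + sqrt b))"
    by (rule mult_left_mono) simp
  then show ?thesis by (simp add: chain_weight_def a_def b_def)
qed

lemma summable_chain_weight:
  assumes "summable (\<lambda>j. (1 / 2) ^ j * sqrt (H j))"
  shows "summable (chain_weight H)"
proof -
  have "summable (\<lambda>j. (1 / 2) ^ Suc j * sqrt (H (Suc j)))"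
    using assms by (subst summable_Suc_iff)
  from summable_mult[OF this, of 2] have "summable (\<lambda>j. (1 / 2) ^ j * sqrt (H (Suc j)))" by simp
  moreover have "summable (\<lambda>j. (1 / 2) ^ j :: real)" by (rule summable_geometric) simp
  ultimately have "summable (\<lambda>j. 18 * ((1 / 2) ^ j + (1 / 2) ^ j * sqrt (H j) + (1 / 2) ^ j * sqrt (H (Suc j))))"
    using assms by (intro summable_mult summable_add)
  then show ?thesis by (simp add: chain_weight_def[abs_def] algebra_simps)
qed

section \<open>The limit process on the whole class\<close>

text \<open>Normality of \<open>X\<close> is available only on the countable union of nets; the
  process on \<open>F\<close> has to be reached by limits along the projections
  \<open>\<pi> k\<close>. Membership of the nets in \<open>F\<close> gives the starting points
  variance at most 1.\<close>

locale chaining = semi_inner V ip + N: prob_space N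
  for V :: "('a \<Rightarrow> real) set" and ip and N :: "'w measure" +
  fixes X :: "('a \<Rightarrow> real) \<Rightarrow> 'w \<Rightarrow> real" and F :: "('a \<Rightarrow> real) set"
    and T :: "nat \<Rightarrow> ('a \<Rightarrow> real) set" and \<pi> :: "nat \<Rightarrow> ('a \<Rightarrow> real) \<Rightarrow> 'a \<Rightarrow> real" and H :: "nat \<Rightarrow> real"
  assumes F_sub: "F \<subseteq> V" and T_sub: "\<And>k. T k \<subseteq> F" and finite_T: "\<And>k. finite (T k)"
    and H_nonneg: "\<And>k. 0 \<le> H k" and card_T: "\<And>k. real (card (T k)) \<le> exp (H k)"
    and net: "\<And>k f. f \<in> F \<Longrightarrow> \<pi> k f \<in> T k" "\<And>k f. f \<in> F \<Longrightarrow> nrm (\<lambda>x. f x - \<pi> k f x) \<le> (1 / 2) ^ k"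
    and nrm_le_1: "\<And>f. f \<in> F \<Longrightarrow> nrm f \<le> 1"
    and summable_H: "summable (\<lambda>j. (1 / 2) ^ j * sqrt (H j))"
    and X_normal: "\<And>n c t. (\<And>i. i < n \<Longrightarrow> t i \<in> (\<Union>k. T k)) \<Longrightarrow>
      centered_normal N (\<lambda>\<omega>. \<Sum>i<n. c i * X (t i) \<omega>) (nrm (\<lambda>x. \<Sum>i<n::nat. c i * t i x))"
begin

abbreviation "w \<equiv> chain_weight H"

lemma w_nonneg: "0 \<le> w j"
  using H_nonneg by (rule chain_weight_nonneg)

lemma summable_w: "summable w"
  by (rule summable_chain_weight[OF summable_H])

lemma X_centered_normal: "t \<in> T k \<Longrightarrow> centered_normal N (X t) (nrm t)"
  using X_normal[of 1 "\<lambda>_. t" "\<lambda>_. 1"] by auto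

lemma X_measurable: "t \<in> T k \<Longrightarrow> X t \<in> borel_measurable N"
  using centered_normal_measurable[OF N.prob_space_axioms X_centered_normal] .

lemma X_diff_centered_normal:
  assumes "s \<in> T j" "t \<in> T k"
  shows "centered_normal N (\<lambda>\<omega>. X s \<omega> - X t \<omega>) (nrm (\<lambda>x. s x - t x))"
proof -
  let ?t = "\<lambda>i :: nat. if i = 0 then s else t" and ?c = "\<lambda>i :: nat. if i = 0 then 1 else -1 :: real"
  have "centered_normal N (\<lambda>\<omega>. \<Sum>i<2. ?c i * X (?t i) \<omega>) (nrm (\<lambda>x. \<Sum>i<2. ?c i * ?t i x))"
    by (rule X_normal) (use assms in auto)
  then show ?thesis by (simp add: numeral_2_eq_2)
qed

text \<open>The radius 3 admits both kinds of links: consecutive projections of one function, and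
  projections to one net of two functions at distance at most \<open>(1 / 2) ^ j\<close>. One finite
  family thus serves convergence and continuity.\<close>

definition Q :: "nat \<Rightarrow> (('a \<Rightarrow> real) \<times> ('a \<Rightarrow> real)) set" where
  "Q j = {(s, t). s \<in> T j \<union> T (Suc j) \<and> t \<in> T j \<union> T (Suc j) \<and>
    nrm (\<lambda>x. s x - t x) \<le> 3 * (1 / 2) ^ j}"

definition incr :: "nat \<Rightarrow> 'w \<Rightarrow> ennreal" where
  "incr j \<omega> = (SUP p\<in>Q j. ennreal \<bar>X (fst p) \<omega> - X (snd p) \<omega>\<bar>)"

text \<open>The tail from scale \<open>k\<close> dominates, up to a constant, all increments of the
  process at distance at most \<open>(1 / 2) ^ k\<close> simultaneously.\<close>

definition R :: "nat \<Rightarrow> 'w \<Rightarrow> ennreal" where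
  "R k \<omega> = (\<Sum>j. incr (j + k) \<omega>)"

text \<open>The value 0 on the exceptional null set makes every path bounded and uniformly
  continuous; \<open>regular_paths\<close> asks for this at every point of the space.\<close>

definition G :: "('a \<Rightarrow> real) \<Rightarrow> 'w \<Rightarrow> real" where
  "G f \<omega> = (if R 0 \<omega> < \<infinity> then lim (\<lambda>k. X (\<pi> k f) \<omega>) else 0)"

lemma Q_sub: "Q j \<subseteq> (T j \<union> T (Suc j)) \<times> (T j \<union> T (Suc j))"
  by (auto simp: Q_def)

lemma finite_Q: "finite (Q j)"
  using finite_T by (intro finite_subset[OF Q_sub]) auto

lemma Q_diff_centered_normal:
  assumes "p \<in> Q j"
  shows "centered_normal N (\<lambda>\<omega>. X (fst p) \<omega> - X (snd p) \<omega>) (nrm (\<lambda>x. fst p x - snd p x))"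
proof -
  obtain i k where "fst p \<in> T i" "snd p \<in> T k" using assms by (auto simp: Q_def)
  then show ?thesis by (rule X_diff_centered_normal)
qed

lemma incr_measurable [measurable]: "incr j \<in> borel_measurable N"
  unfolding incr_def
proof (rule borel_measurable_SUP)
  show "countable (Q j)" using finite_Q by (rule countable_finite)
  fix p assume "p \<in> Q j"
  from centered_normal_measurable[OF N.prob_space_axioms Q_diff_centered_normal[OF this]]
  show "(\<lambda>\<omega>. ennreal \<bar>X (fst p) \<omega> - X (snd p) \<omega>\<bar>) \<in> borel_measurable N" by measurable
qed

lemma R_measurable [measurable]: "R k \<in> borel_measurable N"
  unfolding R_def by measurable

lemma nn_integral_incr_le: "(\<integral>\<^sup>+\<omega>. incr j \<omega> \<partial>N) \<le> ennreal (w j)"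
proof -
  let ?m = "(exp (H j) + exp (H (Suc j)))\<^sup>2"
  have "card (Q j) \<le> card (T j \<union> T (Suc j)) * card (T j \<union> T (Suc j))"
    using card_mono[OF _ Q_sub, of j] finite_T by (simp add: card_cartesian_product)
  also have "\<dots> \<le> (card (T j) + card (T (Suc j))) * (card (T j) + card (T (Suc j)))"
    by (intro mult_mono card_Un_le) auto
  finally have "real (card (Q j)) \<le> (real (card (T j)) + real (card (T (Suc j))))\<^sup>2"
    unfolding power2_eq_square by (metis of_nat_add of_nat_le_iff of_nat_mult)
  also have "\<dots> \<le> ?m" by (intro power_mono add_mono card_T) simp
  finally have card: "real (card (Q j)) \<le> ?m" .
  have "1 \<le> exp (H j) + exp (H (Suc j))" using H_nonneg[of j] by (simp add: add_increasing2)
  then have m: "1 \<le> ?m" by simp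
  have "(\<integral>\<^sup>+\<omega>. incr j \<omega> \<partial>N) \<le> ennreal (3 * (3 * (1 / 2) ^ j) * sqrt (1 + ln ?m))"
    unfolding incr_def
    by (rule nn_integral_SUP_centered_normal_le[OF N.prob_space_axioms finite_Q card m _ Q_diff_centered_normal])
      (auto simp: Q_def)
  also have "\<dots> \<le> ennreal (w j)" by (intro ennreal_leI chain_weight_ge H_nonneg)
  finally show ?thesis .
qed

lemma nn_integral_R_le: "(\<integral>\<^sup>+\<omega>. R k \<omega> \<partial>N) \<le> ennreal (\<Sum>j. w (j + k))"
proof -
  have "(\<integral>\<^sup>+\<omega>. R k \<omega> \<partial>N) = (\<Sum>j. \<integral>\<^sup>+\<omega>. incr (j + k) \<omega> \<partial>N)"
    unfolding R_def by (rule nn_integral_suminf) measurable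
  also have "\<dots> \<le> (\<Sum>j. ennreal (w (j + k)))" by (intro suminf_le nn_integral_incr_le) auto
  also have "\<dots> = ennreal (\<Sum>j. w (j + k))"
    by (intro suminf_ennreal2 w_nonneg summable_ignore_initial_segment summable_w)
  finally show ?thesis .
qed

lemma AE_R_finite: "AE \<omega> in N. R 0 \<omega> < \<infinity>"
proof -
  have "(\<integral>\<^sup>+\<omega>. R 0 \<omega> \<partial>N) \<noteq> \<infinity>"
    using nn_integral_R_le[of 0] by (metis ennreal_less_top infinity_ennreal_def leD)
  then have "AE \<omega> in N. R 0 \<omega> \<noteq> \<infinity>" by (intro nn_integral_PInf_AE R_measurable)
  then show ?thesis by eventually_elim (simp add: less_top)
qed

lemma
  assumes "R 0 \<omega> < \<infinity>"
  shows incr_eq: "incr j \<omega> = ennreal (enn2real (incr j \<omega>))"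
    and summable_incr: "summable (\<lambda>j. enn2real (incr j \<omega>))"
    and R_eq: "R k \<omega> = ennreal (\<Sum>j. enn2real (incr (j + k) \<omega>))"
proof -
  have "incr j \<omega> \<noteq> \<infinity>" for j
  proof
    assume "incr j \<omega> = \<infinity>"
    moreover have "incr j \<omega> \<le> (\<Sum>j. incr j \<omega>)"
      using sum_le_suminf[of "\<lambda>j. incr j \<omega>" "{j}"] by simp
    ultimately show False using assms by (simp add: R_def)
  qed
  then have m: "incr j \<omega> = ennreal (enn2real (incr j \<omega>))" for j by (simp add: less_top)
  then show "incr j \<omega> = ennreal (enn2real (incr j \<omega>))" .
  have "(\<Sum>j. ennreal (enn2real (incr j \<omega>))) \<noteq> top"
    using assms by (simp add: R_def m[symmetric])
  then show s: "summable (\<lambda>j. enn2real (incr j \<omega>))" by (intro summable_suminf_not_top) auto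
  have "R k \<omega> = (\<Sum>j. ennreal (enn2real (incr (j + k) \<omega>)))" by (simp add: R_def m[symmetric])
  also have "\<dots> = ennreal (\<Sum>j. enn2real (incr (j + k) \<omega>))"
    using s by (intro suminf_ennreal2 summable_ignore_initial_segment) auto
  finally show "R k \<omega> = ennreal (\<Sum>j. enn2real (incr (j + k) \<omega>))" .
qed

lemma incr_ge:
  assumes "(s, t) \<in> Q j"
  shows "ennreal \<bar>X s \<omega> - X t \<omega>\<bar> \<le> incr j \<omega>"
  unfolding incr_def using SUP_upper[OF assms, of "\<lambda>p. ennreal \<bar>X (fst p) \<omega> - X (snd p) \<omega>\<bar>"] by simp

lemma V_mem: "f \<in> F \<Longrightarrow> f \<in> V" "f \<in> F \<Longrightarrow> \<pi> k f \<in> V"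
  using F_sub T_sub net(1) by blast+

lemma chain_link: "f \<in> F \<Longrightarrow> (\<pi> (Suc j) f, \<pi> j f) \<in> Q j"
proof -
  assume f: "f \<in> F"
  have "nrm (\<lambda>x. \<pi> (Suc j) f x - \<pi> j f x) \<le> nrm (\<lambda>x. \<pi> (Suc j) f x - f x) + nrm (\<lambda>x. f x - \<pi> j f x)"
    using f by (intro nrm_diff_triangle V_mem)
  also have "nrm (\<lambda>x. \<pi> (Suc j) f x - f x) = nrm (\<lambda>x. f x - \<pi> (Suc j) f x)"
    using f by (intro nrm_diff_commute V_mem)
  also have "\<dots> \<le> (1 / 2) ^ Suc j" using f by (rule net(2))
  also have "(1 / 2) ^ Suc j + nrm (\<lambda>x. f x - \<pi> j f x) \<le> (1 / 2) ^ Suc j + (1 / 2) ^ j"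
    using net(2)[OF f, of j] by simp
  also have "\<dots> \<le> 3 * (1 / 2) ^ j" by simp
  finally show ?thesis using net(1)[OF f] by (simp add: Q_def)
qed

lemma close_link:
  assumes "f \<in> F" "g \<in> F" "nrm (\<lambda>x. f x - g x) \<le> (1 / 2) ^ k"
  shows "(\<pi> k f, \<pi> k g) \<in> Q k"
proof -
  have "nrm (\<lambda>x. \<pi> k f x - \<pi> k g x) \<le> nrm (\<lambda>x. \<pi> k f x - f x) + nrm (\<lambda>x. f x - \<pi> k g x)"
    using assms by (intro nrm_diff_triangle V_mem)
  also have "nrm (\<lambda>x. f x - \<pi> k g x) \<le> nrm (\<lambda>x. f x - g x) + nrm (\<lambda>x. g x - \<pi> k g x)"
    using assms by (intro nrm_diff_triangle V_mem)
  also have "nrm (\<lambda>x. \<pi> k f x - f x) = nrm (\<lambda>x. f x - \<pi> k f x)"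
    using assms by (intro nrm_diff_commute V_mem)
  finally have "nrm (\<lambda>x. \<pi> k f x - \<pi> k g x) \<le> 3 * (1 / 2) ^ k"
    using net(2)[OF assms(1), of k] net(2)[OF assms(2), of k] assms(3) by simp
  then show ?thesis using net(1) assms by (simp add: Q_def)
qed

lemma G_limit:
  assumes "R 0 \<omega> < \<infinity>" "f \<in> F"
  shows "(\<lambda>k. X (\<pi> k f) \<omega>) \<longlonglongrightarrow> G f \<omega>" "ennreal \<bar>X (\<pi> k f) \<omega> - G f \<omega>\<bar> \<le> R k \<omega>"
proof -
  define m where "m = (\<lambda>j. enn2real (incr j \<omega>))"
  have "\<bar>X (\<pi> (Suc j) f) \<omega> - X (\<pi> j f) \<omega>\<bar> \<le> m j" for j
  proof -
    have "ennreal \<bar>X (\<pi> (Suc j) f) \<omega> - X (\<pi> j f) \<omega>\<bar> \<le> ennreal (m j)"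
      using incr_ge[OF chain_link[OF assms(2)], of j \<omega>] incr_eq[OF assms(1), of j]
        by (simp add: m_def)
    then show ?thesis by (simp add: m_def)
  qed
  note * = summable_increments_limit[where x="\<lambda>k. X (\<pi> k f) \<omega>", OF this summable_incr[OF assms(1), folded m_def]]
  have G: "G f \<omega> = lim (\<lambda>k. X (\<pi> k f) \<omega>)" using assms(1) by (simp add: G_def)
  show "(\<lambda>k. X (\<pi> k f) \<omega>) \<longlonglongrightarrow> G f \<omega>" unfolding G by (rule *(1))
  show "ennreal \<bar>X (\<pi> k f) \<omega> - G f \<omega>\<bar> \<le> R k \<omega>" unfolding G R_eq[OF assms(1)] using *(2)
    by (intro ennreal_leI) (simp add: m_def)
qed

lemma incr_le_R: "incr k \<omega> \<le> R k \<omega>"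
  unfolding R_def using sum_le_suminf[of "\<lambda>j. incr (j + k) \<omega>" "{0}"] by simp

text \<open>Three steps, each at most \<open>R k\<close>: from \<open>f\<close> to its projection,
  between the projections of \<open>f\<close> and \<open>g\<close>, and from there to
  \<open>g\<close>.\<close>

lemma G_diff_le:
  assumes "f \<in> F" "g \<in> F" "nrm (\<lambda>x. f x - g x) \<le> (1 / 2) ^ k"
  shows "ennreal \<bar>G f \<omega> - G g \<omega>\<bar> \<le> 3 * R k \<omega>"
proof (cases "R 0 \<omega> < \<infinity>")
  case True
  let ?a = "X (\<pi> k f) \<omega>" and ?b = "X (\<pi> k g) \<omega>"
  have "\<bar>G f \<omega> - G g \<omega>\<bar> \<le> \<bar>?a - G f \<omega>\<bar> + \<bar>?b - G g \<omega>\<bar> + \<bar>?a - ?b\<bar>" by linarith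
  then have "ennreal \<bar>G f \<omega> - G g \<omega>\<bar>
    \<le> ennreal \<bar>?a - G f \<omega>\<bar> + ennreal \<bar>?b - G g \<omega>\<bar> + ennreal \<bar>?a - ?b\<bar>"
    by (simp add: ennreal_plus[symmetric] del: ennreal_plus)
  also have "\<dots> \<le> R k \<omega> + R k \<omega> + R k \<omega>"
    using G_limit(2)[OF True] assms incr_ge[OF close_link[OF assms]] incr_le_R[of k \<omega>]
    by (intro add_mono) (auto intro: order_trans)
  also have "\<dots> = (1 + 1 + 1) * R k \<omega>" by (simp only: distrib_right mult_1_left)
  also have "1 + 1 + 1 = (3 :: ennreal)" by simp
  finally show ?thesis .
qed (simp add: G_def)

lemma abs_G_le:
  assumes "f \<in> F"
  shows "ennreal \<bar>G f \<omega>\<bar> \<le> (SUP t\<in>T 0. ennreal \<bar>X t \<omega>\<bar>) + R 0 \<omega>"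
proof (cases "R 0 \<omega> < \<infinity>")
  case True
  have "\<bar>G f \<omega>\<bar> \<le> \<bar>X (\<pi> 0 f) \<omega>\<bar> + \<bar>X (\<pi> 0 f) \<omega> - G f \<omega>\<bar>" by linarith
  then have "ennreal \<bar>G f \<omega>\<bar> \<le> ennreal \<bar>X (\<pi> 0 f) \<omega>\<bar> + ennreal \<bar>X (\<pi> 0 f) \<omega> - G f \<omega>\<bar>"
    by (simp add: ennreal_plus[symmetric] del: ennreal_plus)
  also have "\<dots> \<le> (SUP t\<in>T 0. ennreal \<bar>X t \<omega>\<bar>) + R 0 \<omega>"
    using net(1)[OF assms] by (intro add_mono G_limit(2)[OF True assms] SUP_upper)
  finally show ?thesis .
qed (simp add: G_def)

text \<open>The suprema below need not be measurable, but monotonicity of the nonnegative integral holds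
  for arbitrary functions.\<close>

lemma nn_integral_SUP_G_le:
  "(\<integral>\<^sup>+\<omega>. (SUP f\<in>F. ennreal \<bar>G f \<omega>\<bar>) \<partial>N) \<le> ennreal (3 * sqrt (1 + H 0) + (\<Sum>j. w j))"
proof -
  have "(\<integral>\<^sup>+\<omega>. (SUP f\<in>F. ennreal \<bar>G f \<omega>\<bar>) \<partial>N) \<le> (\<integral>\<^sup>+\<omega>. (SUP t\<in>T 0. ennreal \<bar>X t \<omega>\<bar>) + R 0 \<omega> \<partial>N)"
    by (intro nn_integral_mono SUP_least abs_G_le)
  also have "\<dots> = (\<integral>\<^sup>+\<omega>. (SUP t\<in>T 0. ennreal \<bar>X t \<omega>\<bar>) \<partial>N) + (\<integral>\<^sup>+\<omega>. R 0 \<omega> \<partial>N)"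
  proof (rule nn_integral_add)
    show "(\<lambda>\<omega>. SUP t\<in>T 0. ennreal \<bar>X t \<omega>\<bar>) \<in> borel_measurable N"
    proof (rule borel_measurable_SUP)
      fix t assume "t \<in> T 0"
      from X_measurable[OF this] show "(\<lambda>\<omega>. ennreal \<bar>X t \<omega>\<bar>) \<in> borel_measurable N" by measurable
    qed (rule countable_finite[OF finite_T])
  qed measurable
  also have "\<dots> \<le> ennreal (3 * 1 * sqrt (1 + ln (exp (H 0)))) + ennreal (\<Sum>j. w (j + 0))"
  proof (intro add_mono nn_integral_R_le)
    show "(\<integral>\<^sup>+\<omega>. (SUP t\<in>T 0. ennreal \<bar>X t \<omega>\<bar>) \<partial>N) \<le> ennreal (3 * 1 * sqrt (1 + ln (exp (H 0))))"
      using nrm_le_1 T_sub[of 0] H_nonneg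
      by (intro nn_integral_SUP_centered_normal_le[OF N.prob_space_axioms finite_T card_T _ _ X_centered_normal]) auto
  qed
  also have "\<dots> = ennreal (3 * sqrt (1 + H 0) + (\<Sum>j. w j))"
    using H_nonneg suminf_nonneg[OF summable_w w_nonneg] by (subst ennreal_plus[symmetric]) auto
  finally show ?thesis .
qed

lemma nn_integral_SUP_G_diff_le:
  assumes "C \<subseteq> {(f, g). f \<in> F \<and> g \<in> F \<and> nrm (\<lambda>x. f x - g x) \<le> (1 / 2) ^ k}"
  shows "(\<integral>\<^sup>+\<omega>. (SUP (f, g)\<in>C. ennreal \<bar>G f \<omega> - G g \<omega>\<bar>) \<partial>N) \<le> ennreal (3 * (\<Sum>j. w (j + k)))"
proof -
  have "(\<integral>\<^sup>+\<omega>. (SUP (f, g)\<in>C. ennreal \<bar>G f \<omega> - G g \<omega>\<bar>) \<partial>N) \<le> (\<integral>\<^sup>+\<omega>. 3 * R k \<omega> \<partial>N)"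
    using assms by (intro nn_integral_mono SUP_least) (auto intro!: G_diff_le)
  also have "\<dots> = 3 * (\<integral>\<^sup>+\<omega>. R k \<omega> \<partial>N)" by (rule nn_integral_cmult) measurable
  also have "\<dots> \<le> 3 * ennreal (\<Sum>j. w (j + k))" by (intro mult_left_mono nn_integral_R_le) simp
  also have "\<dots> = ennreal (3 * (\<Sum>j. w (j + k)))"
    using suminf_nonneg[OF summable_ignore_initial_segment[OF summable_w] w_nonneg, of k]
    by (simp add: ennreal_mult)
  finally show ?thesis .
qed

lemma bounded_G: "bounded ((\<lambda>f. G f \<omega>) ` F)"
proof (cases "R 0 \<omega> < \<infinity>")
  case True
  have "(SUP t\<in>T 0. ennreal \<bar>X t \<omega>\<bar>) \<le> ennreal (\<Sum>t\<in>T 0. \<bar>X t \<omega>\<bar>)"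
    using finite_T by (intro SUP_least ennreal_leI member_le_sum) auto
  moreover obtain r where "R 0 \<omega> = ennreal r" "0 \<le> r" using True by (cases "R 0 \<omega>") auto
  ultimately have "ennreal \<bar>G f \<omega>\<bar> \<le> ennreal ((\<Sum>t\<in>T 0. \<bar>X t \<omega>\<bar>) + r)" if "f \<in> F" for f
    using abs_G_le[OF that, of \<omega>] by (simp add: sum_nonneg) (metis add_right_mono order_trans)
  moreover have "0 \<le> (\<Sum>t\<in>T 0. \<bar>X t \<omega>\<bar>) + r" using \<open>0 \<le> r\<close> by (simp add: sum_nonneg)
  ultimately show ?thesis
    by (intro boundedI[of _ "(\<Sum>t\<in>T 0. \<bar>X t \<omega>\<bar>) + r"]) (auto simp del: ennreal_plus)
next
  case False
  then show ?thesis by (intro boundedI[of _ 0]) (auto simp: G_def)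
qed

lemma uniformly_continuous_G:
  assumes "0 < e"
  shows "\<exists>d>0. \<forall>f\<in>F. \<forall>g\<in>F. nrm (\<lambda>x. f x - g x) < d \<longrightarrow> \<bar>G f \<omega> - G g \<omega>\<bar> < e"
proof (cases "R 0 \<omega> < \<infinity>")
  case True
  define m where "m = (\<lambda>j. enn2real (incr j \<omega>))"
  note sm = summable_incr[OF True, folded m_def]
  \<comment> \<open>The third of \<open>e\<close> compensates the factor in
    \<open>G_diff_le\<close>; tails of this one convergent series provide a modulus for all pairs at
    once.\<close>
  have "\<forall>\<^sub>F k in sequentially. (\<Sum>j. m (j + k)) < e / 3"
    using tendsto_suminf_tail[OF sm] assms by (intro order_tendstoD) auto
  then obtain k where k: "(\<Sum>j. m (j + k)) < e / 3" by (auto simp: eventually_sequentially)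
  have nonneg: "0 \<le> (\<Sum>j. m (j + k))"
    by (intro suminf_nonneg summable_ignore_initial_segment sm) (simp add: m_def)
  have "\<bar>G f \<omega> - G g \<omega>\<bar> < e" if "f \<in> F" "g \<in> F" "nrm (\<lambda>x. f x - g x) < (1 / 2) ^ k" for f g
  proof -
    have "ennreal \<bar>G f \<omega> - G g \<omega>\<bar> \<le> 3 * R k \<omega>" using that by (intro G_diff_le) auto
    also have "\<dots> = ennreal (3 * (\<Sum>j. m (j + k)))" using nonneg
      by (simp add: R_eq[OF True] m_def ennreal_mult)
    finally show ?thesis using k nonneg by (simp add: ennreal_le_iff)
  qed
  then show ?thesis by (intro exI[of _ "(1 / 2) ^ k"]) auto
next
  case False
  then show ?thesis using assms by (intro exI[of _ 1]) (auto simp: G_def)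
qed

lemma G_measurable: "f \<in> F \<Longrightarrow> G f \<in> borel_measurable N"
proof -
  assume f: "f \<in> F"
  have [measurable]: "X (\<pi> k f) \<in> borel_measurable N" for k using X_measurable[OF net(1)[OF f]] .
  show ?thesis unfolding G_def by measurable
qed

text \<open>Replacing each function by its projection gives normal combinations that converge almost
  surely, and the reverse triangle inequality makes their standard deviations converge at rate
  \<open>(1 / 2) ^ k\<close>.\<close>

lemma G_centered_normal:
  assumes t: "\<And>i. i < n \<Longrightarrow> t i \<in> F"
  shows "centered_normal N (\<lambda>\<omega>. \<Sum>i<n. c i * G (t i) \<omega>) (nrm (\<lambda>x. \<Sum>i<n::nat. c i * t i x))"
proof (rule centered_normal_limit[OF N.prob_space_axioms])
  let ?u = "\<lambda>k x. \<Sum>i<n. c i * \<pi> k (t i) x"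
  let ?v = "\<lambda>x. \<Sum>i<n. c i * t i x"
  have v: "?v \<in> V" and u: "?u k \<in> V" for k using t V_mem by (auto intro!: sum_mem)
  show "centered_normal N (\<lambda>\<omega>. \<Sum>i<n. c i * X (\<pi> k (t i)) \<omega>) (nrm (?u k))" for k
    using net(1) t by (intro X_normal) blast
  show "0 \<le> nrm ?v" using v by (rule nrm_nonneg)
  show "(\<lambda>\<omega>. \<Sum>i<n. c i * G (t i) \<omega>) \<in> borel_measurable N"
    using G_measurable t by (intro borel_measurable_sum borel_measurable_times) auto
  show "AE \<omega> in N. (\<lambda>k. \<Sum>i<n. c i * X (\<pi> k (t i)) \<omega>) \<longlonglongrightarrow> (\<Sum>i<n. c i * G (t i) \<omega>)"
    using AE_R_finite by eventually_elim (intro tendsto_intros G_limit, auto intro: t)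
  show "(\<lambda>k. nrm (?u k)) \<longlonglongrightarrow> nrm ?v"
  proof (rule LIM_zero_cancel, rule Lim_null_comparison)
    have "\<bar>nrm (?u k) - nrm ?v\<bar> \<le> (\<Sum>i<n. \<bar>c i\<bar>) * (1 / 2) ^ k" for k
    proof -
      have "\<bar>nrm (?u k) - nrm ?v\<bar> \<le> nrm (\<lambda>x. ?u k x - ?v x)" by (rule abs_nrm_diff_le[OF u v])
      also have "(\<lambda>x. ?u k x - ?v x) = (\<lambda>x. \<Sum>i<n. c i * (\<pi> k (t i) x - t i x))"
        by (simp add: sum_subtractf right_diff_distrib)
      also have "nrm \<dots> \<le> (\<Sum>i<n. \<bar>c i\<bar> * nrm (\<lambda>x. \<pi> k (t i) x - t i x))"
        using lin_mem[of "\<pi> k (t i)" "t i" "-1" for i] V_mem t by (intro nrm_sum_le) simp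
      also have "\<dots> \<le> (\<Sum>i<n. \<bar>c i\<bar> * (1 / 2) ^ k)"
        using net(2)[OF t] nrm_diff_commute[OF V_mem(2) V_mem(1), OF t t]
        by (intro sum_mono mult_left_mono) auto
      finally show ?thesis by (simp add: sum_distrib_right)
    qed
    then show "\<forall>\<^sub>F k in sequentially. norm (nrm (?u k) - nrm ?v) \<le> (\<Sum>i<n. \<bar>c i\<bar>) * (1 / 2) ^ k"
      by simp
    show "(\<lambda>k. (\<Sum>i<n. \<bar>c i\<bar>) * (1 / 2) ^ k) \<longlonglongrightarrow> 0"
      by (intro tendsto_mult_right_zero LIMSEQ_power_zero) simp
  qed
qed

end

context chaining
begin

lemma G_lin_centered_normal:
  assumes "f \<in> F" "g \<in> F"
  shows "centered_normal N (\<lambda>\<omega>. G f \<omega> + c * G g \<omega>) (nrm (\<lambda>x. f x + c * g x))"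
proof -
  let ?t = "\<lambda>i :: nat. if i = 0 then f else g" and ?c = "\<lambda>i :: nat. if i = 0 then 1 else c"
  have "centered_normal N (\<lambda>\<omega>. \<Sum>i<2. ?c i * G (?t i) \<omega>) (nrm (\<lambda>x. \<Sum>i<2. ?c i * ?t i x))"
    by (rule G_centered_normal) (use assms in auto)
  then show ?thesis by (simp add: numeral_2_eq_2)
qed

lemma G_mean: "f \<in> F \<Longrightarrow> (\<integral>\<omega>. G f \<omega> \<partial>N) = 0"
  using centered_normal_mean[OF N.prob_space_axioms G_lin_centered_normal[of f f 0]] by simp

text \<open>Polarisation: the second moments of the sum and of the difference determine the mixed
  moment.\<close>

lemma G_covariance:
  assumes "f \<in> F" "g \<in> F"
  shows "(\<integral>\<omega>. G f \<omega> * G g \<omega> \<partial>N) = ip f g"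
proof -
  note lin = G_lin_centered_normal[OF assms]
  have V: "f \<in> V" "g \<in> V" using assms V_mem by auto
  have m: "(\<integral>\<omega>. (G f \<omega> + c * G g \<omega>)\<^sup>2 \<partial>N) = ip f f + 2 * c * ip f g + c\<^sup>2 * ip g g" for c
    using centered_normal_second_moment[OF N.prob_space_axioms lin, of c]
    by (simp add: nrm_sq lin_mem V ip_lin_self)
  have i: "integrable N (\<lambda>\<omega>. (G f \<omega> + c * G g \<omega>)\<^sup>2)" for c
    by (rule centered_normal_square_integrable[OF N.prob_space_axioms lin])
  have "(\<integral>\<omega>. G f \<omega> * G g \<omega> \<partial>N) = (\<integral>\<omega>. ((G f \<omega> + 1 * G g \<omega>)\<^sup>2 - (G f \<omega> + (-1) * G g \<omega>)\<^sup>2) / 4 \<partial>N)"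
    by (intro Bochner_Integration.integral_cong refl) (simp add: power2_eq_square algebra_simps)
  also have "\<dots> = ((\<integral>\<omega>. (G f \<omega> + 1 * G g \<omega>)\<^sup>2 \<partial>N) - (\<integral>\<omega>. (G f \<omega> + (-1) * G g \<omega>)\<^sup>2 \<partial>N)) / 4"
    by (simp only: integral_divide_zero Bochner_Integration.integral_diff[OF i i])
  also have "\<dots> = ip f g" unfolding m by simp
  finally show ?thesis .
qed

lemma gaussian_process_G: "gaussian_process N F G"
  unfolding gaussian_process_def
proof (intro conjI allI impI N.prob_space_axioms)
  fix S and c :: "('a \<Rightarrow> real) \<Rightarrow> real"
  assume S: "finite S" "S \<subseteq> F"
  obtain h where h: "bij_betw h {..<card S} S"
    using ex_bij_betw_nat_finite[OF S(1)] by (auto simp: atLeast0LessThan)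
  have "centered_normal N (\<lambda>\<omega>. \<Sum>i<card S. c (h i) * G (h i) \<omega>) (nrm (\<lambda>x. \<Sum>i<card S. c (h i) * h i x))"
    by (rule G_centered_normal) (use h S(2) in \<open>auto simp: bij_betw_def\<close>)
  moreover have "(\<Sum>i<card S. c (h i) * G (h i) \<omega>) = (\<Sum>f\<in>S. c f * G f \<omega>)" for \<omega>
    by (rule sum.reindex_bij_betw[OF h])
  ultimately obtain \<sigma> where Z: "centered_normal N (\<lambda>\<omega>. \<Sum>f\<in>S. c f * G f \<omega>) \<sigma>" by auto
  note facts = N.prob_space_axioms Z
  consider "\<sigma> = 0" | "0 < \<sigma>" using Z by (fastforce simp: centered_normal_def)
  then show "normal_rv N (\<lambda>\<omega>. \<Sum>f\<in>S. c f * G f \<omega>)"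
    unfolding normal_rv_def
    using centered_normal_measurable[OF facts] centered_normal_zero_AE[OF facts]
      centered_normal_distributed[OF facts] by cases blast+
qed

end

section \<open>Nets and the covariance form\<close>

text \<open>A separated set of maximal cardinality is a net, since a function far from all its
  members could be added. The bound \<open>m\<close> ensures that a maximum exists, and the centres
  lie in \<open>F\<close> itself.\<close>

lemma exists_finite_net:
  fixes d :: "'b \<Rightarrow> 'b \<Rightarrow> real"
  assumes sep: "\<And>S. finite S \<Longrightarrow> S \<subseteq> F \<Longrightarrow> (\<And>f g. f \<in> S \<Longrightarrow> g \<in> S \<Longrightarrow> f \<noteq> g \<Longrightarrow> \<epsilon> < d f g) \<Longrightarrow>
      real (card S) \<le> m"
    and refl: "\<And>f. f \<in> F \<Longrightarrow> d f f \<le> \<epsilon>" and sym: "\<And>f g. f \<in> F \<Longrightarrow> g \<in> F \<Longrightarrow> d f g = d g f"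
  shows "\<exists>T\<subseteq>F. finite T \<and> real (card T) \<le> m \<and> (\<forall>f\<in>F. \<exists>t\<in>T. d f t \<le> \<epsilon>)"
proof -
  define P where "P = (\<lambda>S. finite S \<and> S \<subseteq> F \<and> (\<forall>f\<in>S. \<forall>g\<in>S. f \<noteq> g \<longrightarrow> \<epsilon> < d f g))"
  have "P {}" by (simp add: P_def)
  moreover have bnd: "real (card S) \<le> m" if "P S" for S using that by (intro sep) (auto simp: P_def)
  then have "\<forall>S. P S \<longrightarrow> card S < Suc (nat \<lfloor>m\<rfloor>)" by (auto simp: less_Suc_eq_le le_nat_floor)
  ultimately obtain S where S: "P S" "\<And>S'. P S' \<Longrightarrow> card S' \<le> card S"
    using ex_has_greatest_nat[of P "{}" card] by blast
  have "\<exists>t\<in>S. d f t \<le> \<epsilon>" if f: "f \<in> F" for f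
  proof (rule ccontr)
    assume "\<not> ?thesis"
    then have far: "\<epsilon> < d f t" if "t \<in> S" for t using that by auto
    then have "f \<notin> S" using refl[OF f] by force
    moreover have "P (insert f S)"
      unfolding P_def
    proof (intro conjI ballI impI)
      show "finite (insert f S)" "insert f S \<subseteq> F" using S(1) f by (auto simp: P_def)
      fix u v assume uv: "u \<in> insert f S" "v \<in> insert f S" "u \<noteq> v"
      show "\<epsilon> < d u v"
      proof (cases "u = f")
        case True
        then show ?thesis using uv far by auto
      next
        case False
        show ?thesis
        proof (cases "v = f")
          case True
          then have "u \<in> S" using uv by auto
          then have "u \<in> F" using S(1) by (auto simp: P_def)
          then have "d u v = d f u" using sym[of u f] f True by simp
          then show ?thesis using far \<open>u \<in> S\<close> by simp
        next
          case v: False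
          then show ?thesis using uv False S(1) by (auto simp: P_def)
        qed
      qed
    qed
    ultimately show False using S(2)[of "insert f S"] S(1) by (simp add: P_def)
  qed
  then show ?thesis using S(1) bnd[OF S(1)] by (intro exI[of _ S]) (auto simp: P_def)
qed

text \<open>The unit ball is not closed under linear combinations; this is the carrier on which
  covariance is a semi-inner product.\<close>

definition bounded_funs :: "'a measure \<Rightarrow> ('a \<Rightarrow> real) set" where
  "bounded_funs M = {f \<in> borel_measurable M. \<exists>B. \<forall>x\<in>space M. \<bar>f x\<bar> \<le> B}"

definition covar :: "'a measure \<Rightarrow> ('a \<Rightarrow> real) \<Rightarrow> ('a \<Rightarrow> real) \<Rightarrow> real" where
  "covar P f g = (\<integral>x. f x * g x \<partial>P) - (\<integral>x. f x \<partial>P) * (\<integral>x. g x \<partial>P)"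

lemma unit_ball_sub_bounded_funs: "unit_ball_Linf M \<subseteq> bounded_funs M"
  by (auto simp: unit_ball_Linf_def bounded_funs_def)

lemma unit_ball_Linf_cong:
  assumes "sets P = sets M"
  shows "unit_ball_Linf P = unit_ball_Linf M"
proof -
  have "(borel_measurable P :: ('a \<Rightarrow> real) set) = borel_measurable M"
    using assms by (intro measurable_cong_sets) simp_all
  then show ?thesis using sets_eq_imp_space_eq[OF assms] by (simp add: unit_ball_Linf_def)
qed

lemma fat_dim_cong: "sets P = sets M \<Longrightarrow> fat_dim P F \<epsilon> = fat_dim M F \<epsilon>"
  using sets_eq_imp_space_eq[of P M] by (simp add: fat_dim_def)

context prob_space
begin

lemma bounded_funs_integrable:
  assumes "f \<in> bounded_funs M"
  shows "integrable M f"
proof -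
  obtain B where "\<And>x. x \<in> space M \<Longrightarrow> \<bar>f x\<bar> \<le> B"
    using assms unfolding bounded_funs_def by blast
  then show ?thesis
    using assms by (intro integrable_const_bound[of _ B]) (auto simp: bounded_funs_def)
qed

lemma bounded_funs_lin:
  assumes "f \<in> bounded_funs M" "g \<in> bounded_funs M"
  shows "(\<lambda>x. f x + c * g x) \<in> bounded_funs M"
proof -
  obtain A B where AB: "\<And>x. x \<in> space M \<Longrightarrow> \<bar>f x\<bar> \<le> A" "\<And>x. x \<in> space M \<Longrightarrow> \<bar>g x\<bar> \<le> B"
    using assms unfolding bounded_funs_def by blast
  have "\<bar>f x + c * g x\<bar> \<le> A + \<bar>c\<bar> * B" if "x \<in> space M" for x
  proof -
    have "\<bar>f x + c * g x\<bar> \<le> \<bar>f x\<bar> + \<bar>c\<bar> * \<bar>g x\<bar>" using abs_triangle_ineq[of "f x" "c * g x"]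
      by (simp add: abs_mult)
    also have "\<dots> \<le> A + \<bar>c\<bar> * B" using AB that by (intro add_mono mult_left_mono) auto
    finally show ?thesis .
  qed
  then show ?thesis using assms unfolding bounded_funs_def by auto
qed

lemma bounded_funs_mult:
  assumes "f \<in> bounded_funs M" "g \<in> bounded_funs M"
  shows "(\<lambda>x. f x * g x) \<in> bounded_funs M"
proof -
  obtain A B where AB: "\<And>x. x \<in> space M \<Longrightarrow> \<bar>f x\<bar> \<le> A" "\<And>x. x \<in> space M \<Longrightarrow> \<bar>g x\<bar> \<le> B"
    using assms unfolding bounded_funs_def by blast
  have "\<bar>f x * g x\<bar> \<le> A * B" if "x \<in> space M" for x
    unfolding abs_mult using AB[OF that] by (intro mult_mono) auto
  then show ?thesis using assms unfolding bounded_funs_def by auto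
qed

lemma covar_self: "f \<in> bounded_funs M \<Longrightarrow> covar M f f = variance f"
  using bounded_funs_integrable bounded_funs_mult[of f f]
  by (subst variance_eq) (auto simp: covar_def power2_eq_square)

lemma semi_inner_covar: "semi_inner (bounded_funs M) (covar M)"
proof
  show "(\<lambda>x. 0) \<in> bounded_funs M" by (auto simp: bounded_funs_def)
  show "covar M f g = covar M g f" for f g by (simp add: covar_def mult.commute)
  show "0 \<le> covar M f f" if "f \<in> bounded_funs M" for f using that by (simp add: covar_self)
  fix f g h c assume fgh: "f \<in> bounded_funs M" "g \<in> bounded_funs M" "h \<in> bounded_funs M"
  note [simp] = bounded_funs_integrable[OF fgh(1)] bounded_funs_integrable[OF fgh(2)]
    bounded_funs_integrable[OF bounded_funs_mult[OF fgh(1,3)]] bounded_funs_integrable[OF bounded_funs_mult[OF fgh(2,3)]]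
  show "covar M (\<lambda>x. f x + c * g x) h = covar M f h + c * covar M g h"
    by (simp add: covar_def distrib_right mult.assoc) (simp add: algebra_simps)
qed (rule bounded_funs_lin)

end

section \<open>The uniform Donsker property\<close>

lemma fat_dim_antimono:
  assumes "\<epsilon> \<le> \<epsilon>'"
  shows "fat_dim M F \<epsilon>' \<le> fat_dim M F \<epsilon>"
proof -
  have "shattered F \<epsilon> A" if sh: "shattered F \<epsilon>' A" for A
  proof -
    obtain \<gamma> where \<gamma>: "\<And>B. B \<subseteq> A \<Longrightarrow> \<exists>f\<in>F. \<forall>y\<in>A.
      (y \<in> B \<longrightarrow> f y \<ge> \<gamma> y + \<epsilon>') \<and> (y \<notin> B \<longrightarrow> f y \<le> \<gamma> y - \<epsilon>')"
      using sh unfolding shattered_def by (elim exE) blast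
    have "\<exists>f\<in>F. \<forall>y\<in>A. (y \<in> B \<longrightarrow> f y \<ge> \<gamma> y + \<epsilon>) \<and> (y \<notin> B \<longrightarrow> f y \<le> \<gamma> y - \<epsilon>)" if B: "B \<subseteq> A" for B
    proof -
      obtain f where f: "f \<in> F" "\<forall>y\<in>A. (y \<in> B \<longrightarrow> f y \<ge> \<gamma> y + \<epsilon>') \<and> (y \<notin> B \<longrightarrow> f y \<le> \<gamma> y - \<epsilon>')"
        using \<gamma>[OF B] by (elim bexE)
      have "(y \<in> B \<longrightarrow> f y \<ge> \<gamma> y + \<epsilon>) \<and> (y \<notin> B \<longrightarrow> f y \<le> \<gamma> y - \<epsilon>)" if "y \<in> A" for y
        using bspec[OF f(2) that] assms by auto
      then show ?thesis using f(1) by blast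
    qed
    then show ?thesis unfolding shattered_def by (intro exI[of _ \<gamma>] allI impI)
  qed
  then show ?thesis unfolding fat_dim_def by (intro SUP_subset_mono) auto
qed

lemma sqrt_enat_mono: "m \<le> n \<Longrightarrow> sqrt_enat m \<le> sqrt_enat n"
  by (cases m; cases n) (auto simp: sqrt_enat_def intro!: ennreal_leI)

text \<open>A lower Riemann sum. On the interval from \<open>(1 / 2) ^ Suc k\<close> to
  \<open>(1 / 2) ^ k\<close> the dimension is at least its value at the right end, and
  \<open>ln (2 / t)\<close> is at least \<open>(k + 1) * ln 2\<close>. An infinite dimension at one
  dyadic scale would already make the sum infinite.\<close>

lemma fat_dim_dyadic_bounds:
  fixes F :: "('a \<Rightarrow> real) set"
  assumes "(\<integral>\<^sup>+t\<in>{0<..1::real}. sqrt_enat (fat_dim M F (t / 8)) * ennreal (ln (2 / t)) \<partial>lborel) < \<infinity>"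
  shows "\<exists>D :: nat \<Rightarrow> nat. (\<forall>k. fat_dim M F ((1 / 2) ^ k / 8) = enat (D k)) \<and>
    summable (\<lambda>k. (1 / 2) ^ k * (real k + 1) * sqrt (real (D k)))"
proof -
  let ?g = "\<lambda>t :: real. sqrt_enat (fat_dim M F (t / 8)) * ennreal (ln (2 / t)) * indicator {0<..1} t"
  define I where "I k = {(1 / 2) ^ Suc k<..(1 / 2) ^ k :: real}" for k
  define s where "s k = sqrt_enat (fat_dim M F ((1 / 2) ^ k / 8))" for k
  define a where "a k = s k * ennreal ((real k + 1) / 2)" for k
  have I_disj: "k = l" if "t \<in> I k" "t \<in> I l" for k l t
  proof -
    have "\<not> k < l" if "t \<in> I k" "t \<in> I l" for k l
    proof
      assume "k < l"
      then have "(1 / 2) ^ l \<le> (1 / 2 :: real) ^ Suc k" by (intro power_decreasing) auto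
      then show False using that by (auto simp: I_def)
    qed
    from this[OF that] this[OF that(2,1)] show ?thesis by linarith
  qed
  have le: "a k \<le> ?g t" if t: "t \<in> I k" for k t
  proof -
    have t0: "0 < t" using t order.strict_trans1[of 0 "(1 / 2) ^ Suc k" t] by (auto simp: I_def)
    have "(1 / 2) ^ k \<le> (1 :: real)" by (rule power_le_one) auto
    then have t1: "t \<in> {0<..1}" using t t0 by (auto simp: I_def)
    have "s k \<le> sqrt_enat (fat_dim M F (t / 8))"
      unfolding s_def using t by (intro sqrt_enat_mono fat_dim_antimono) (auto simp: I_def)
    moreover have "(real k + 1) / 2 \<le> ln (2 / t)"
    proof -
      have "(real k + 1) * (1 / 2) \<le> (real k + 1) * ln 2"
        using ln2_ge_two_thirds by (intro mult_left_mono) auto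
      also have "\<dots> = ln (2 ^ Suc k)" by (simp add: ln_realpow del: power_Suc)
      also have "\<dots> \<le> ln (2 / t)"
      proof (rule ln_mono)
        have "2 ^ Suc k * t \<le> 2 ^ Suc k * (1 / 2) ^ k" using t
          by (intro mult_left_mono) (auto simp: I_def)
        also have "\<dots> = 2" by (simp add: power_one_over)
        finally show "2 ^ Suc k \<le> 2 / t" using t0 by (simp add: pos_le_divide_eq)
      qed (use t0 in auto)
      finally show ?thesis by simp
    qed
    ultimately have "a k \<le> sqrt_enat (fat_dim M F (t / 8)) * ennreal (ln (2 / t))"
      unfolding a_def by (intro mult_mono ennreal_leI) auto
    then show ?thesis using t1 by simp
  qed
  have "(\<Sum>k. a k * indicator (I k) t) \<le> ?g t" for t
  proof (cases "\<exists>k. t \<in> I k")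
    case True
    then obtain k where k: "t \<in> I k" by blast
    have "(\<Sum>l. a l * indicator (I l) t) = (\<Sum>l\<in>{k}. a l * indicator (I l) t)"
      using I_disj[OF k] by (intro suminf_finite) (auto simp: indicator_def)
    then show ?thesis using le[OF k] k by simp
  next
    case False
    then show ?thesis by simp
  qed
  then have "(\<integral>\<^sup>+t. (\<Sum>k. a k * indicator (I k) t) \<partial>lborel) \<le> (\<integral>\<^sup>+t. ?g t \<partial>lborel)"
    by (intro nn_integral_mono)
  also have "(\<integral>\<^sup>+t. (\<Sum>k. a k * indicator (I k) t) \<partial>lborel)
    = (\<Sum>k. \<integral>\<^sup>+t. a k * indicator (I k) t \<partial>lborel)"
    by (rule nn_integral_suminf) (simp add: I_def)
  also have "\<dots> = (\<Sum>k. a k * ennreal ((1 / 2) ^ Suc k))"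
  proof (rule suminf_cong)
    fix k
    have "(\<integral>\<^sup>+t. a k * indicator (I k) t \<partial>lborel) = a k * emeasure lborel (I k)"
      by (rule nn_integral_cmult_indicator) (simp add: I_def)
    also have "emeasure lborel (I k) = ennreal ((1 / 2) ^ Suc k)" by (simp add: I_def)
    finally show "(\<integral>\<^sup>+t. a k * indicator (I k) t \<partial>lborel) = a k * ennreal ((1 / 2) ^ Suc k)" .
  qed
  finally have fin: "(\<Sum>k. a k * ennreal ((1 / 2) ^ Suc k)) < \<infinity>"
    using assms by (rule order.strict_trans1)
  have "fat_dim M F ((1 / 2) ^ k / 8) \<noteq> \<infinity>" for k
  proof
    assume inf: "fat_dim M F ((1 / 2) ^ k / 8) = \<infinity>"
    have "a k = \<infinity>" by (simp add: a_def s_def inf sqrt_enat_def ennreal_top_mult add_pos_nonneg)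
    then have "\<infinity> = a k * ennreal ((1 / 2) ^ Suc k)" by (simp add: ennreal_top_mult)
    also have "\<dots> \<le> (\<Sum>k. a k * ennreal ((1 / 2) ^ Suc k))"
      using sum_le_suminf[of "\<lambda>k. a k * ennreal ((1 / 2) ^ Suc k)" "{k}"] by simp
    finally show False using fin by simp
  qed
  note finite_fat = this
  define D where "D k = the_enat (fat_dim M F ((1 / 2) ^ k / 8))" for k
  have D: "fat_dim M F ((1 / 2) ^ k / 8) = enat (D k)" for k
    unfolding D_def using finite_fat[of k] by (cases "fat_dim M F ((1 / 2) ^ k / 8)") simp_all
  have "a k * ennreal ((1 / 2) ^ Suc k)
    = ennreal (1 / 4 * ((1 / 2) ^ k * (real k + 1) * sqrt (real (D k))))" for k
  proof -
    have "a k * ennreal ((1 / 2) ^ Suc k)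
        = ennreal (sqrt (real (D k))) * ennreal ((real k + 1) / 2) * ennreal ((1 / 2) ^ Suc k)"
      unfolding a_def s_def D by (simp only: sqrt_enat_def enat.case)
    also have "\<dots> = ennreal (sqrt (real (D k)) * ((real k + 1) / 2) * (1 / 2) ^ Suc k)"
      by (subst ennreal_mult[symmetric], simp, simp, subst ennreal_mult[symmetric]) simp_all
    also have "sqrt (real (D k)) * ((real k + 1) / 2) * (1 / 2) ^ Suc k
        = 1 / 4 * ((1 / 2) ^ k * (real k + 1) * sqrt (real (D k)))" by simp
    finally show ?thesis .
  qed
  then have "(\<Sum>k. ennreal (1 / 4 * ((1 / 2) ^ k * (real k + 1) * sqrt (real (D k))))) \<noteq> top"
    using fin by (simp only: infinity_ennreal_def less_top)
  then have "summable (\<lambda>k. 1 / 4 * ((1 / 2) ^ k * (real k + 1) * sqrt (real (D k))))"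
    by (intro summable_suminf_not_top) auto
  from summable_mult[OF this, of 4]
  have "summable (\<lambda>k. (1 / 2) ^ k * (real k + 1) * sqrt (real (D k)))" by simp
  with D show ?thesis by (intro exI[of _ D] conjI allI)
qed

text \<open>Variance is at most the second moment, so a family separated by the covariance seminorm
  is separated in L2, where the cardinality bound applies.\<close>

lemma (in prob_space) covar_net:
  assumes F: "F \<subseteq> unit_ball_Linf M" and fat: "fat_dim M F ((1 / 2) ^ k / 8) = enat d"
    and d: "real d \<le> c * 4 ^ k" and C: "\<forall>k d N. 1 \<le> N \<longrightarrow> real d \<le> c * 4 ^ k \<longrightarrow> card_bound k d N \<longrightarrow>
    ln (real N) \<le> C * (real d + 1) * (real k + 1)\<^sup>2"
  shows "\<exists>T\<subseteq>F. finite T \<and> real (card T) \<le> exp (C * (real d + 1) * (real k + 1)\<^sup>2) \<and>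
    (\<forall>f\<in>F. \<exists>t\<in>T. semi_inner.nrm (covar M) (\<lambda>x. f x - t x) \<le> (1 / 2) ^ k)"
proof (rule exists_finite_net)
  interpret semi_inner "bounded_funs M" "covar M" by (rule semi_inner_covar)
  have V: "f \<in> bounded_funs M" if "f \<in> F" for f using that F unit_ball_sub_bounded_funs by blast
  show "nrm (\<lambda>x. f x - f x) \<le> (1 / 2) ^ k" if "f \<in> F" for f
    by (simp add: nrm_def ip_zero zero_mem)
  show "nrm (\<lambda>x. f x - g x) = nrm (\<lambda>x. g x - f x)" if "f \<in> F" "g \<in> F" for f g
    using that by (intro nrm_diff_commute V)
  fix S assume S: "finite S" "S \<subseteq> F"
    and sep: "\<And>f g. f \<in> S \<Longrightarrow> g \<in> S \<Longrightarrow> f \<noteq> g \<Longrightarrow> (1 / 2) ^ k < nrm (\<lambda>x. f x - g x)"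
  have L2: "((1 / 2) ^ k)\<^sup>2 \<le> expectation (\<lambda>x. (f x - g x)\<^sup>2)" if "f \<in> S" "g \<in> S" "f \<noteq> g" for f g
  proof -
    have fg: "(\<lambda>x. f x - g x) \<in> bounded_funs M"
      using lin_mem[OF V V, of f g "-1"] that S(2) by auto
    have "((1 / 2) ^ k)\<^sup>2 \<le> (nrm (\<lambda>x. f x - g x))\<^sup>2"
      using sep[OF that] by (intro power_mono) auto
    also have "\<dots> = covar M (\<lambda>x. f x - g x) (\<lambda>x. f x - g x)" using fg by (rule nrm_sq)
    also have "\<dots> \<le> expectation (\<lambda>x. (f x - g x)\<^sup>2)" by (simp add: covar_def power2_eq_square)
    finally show ?thesis .
  qed
  have params: "fat_dim M F ((1 / 2) ^ k / 8) \<le> enat d" "8 / (1 / 2) ^ k \<le> real (8 * 2 ^ k)"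
    "(0 :: real) < (1 / 2) ^ k" "(1 / 2 :: real) ^ k \<le> 1"
    by (simp only: fat order_refl) (simp_all add: power_one_over)
  have "card_bound k d (card S)"
    unfolding card_bound_def
    using card_L2_separated_less[OF S F params(3,4) L2 params(1,2)] by blast
  then have ln: "ln (real (card S)) \<le> C * (real d + 1) * (real k + 1)\<^sup>2" if "1 \<le> card S"
    using C[rule_format, OF that d] by blast
  show "real (card S) \<le> exp (C * (real d + 1) * (real k + 1)\<^sup>2)"
  proof (cases "1 \<le> card S")
    case True
    then have "real (card S) = exp (ln (real (card S)))" by simp
    also have "\<dots> \<le> exp (C * (real d + 1) * (real k + 1)\<^sup>2)" using ln[OF True] by simp
    finally show ?thesis .
  next
    \<comment> \<open>The entropy bound concerns \<open>1 \<le> N\<close>, so the empty packing is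
      treated apart.\<close>
    case False
    then have "card S = 0" by simp
    then show ?thesis by (simp only: of_nat_0 exp_ge_zero)
  qed
qed

text \<open>The root of the entropy is \<open>sqrt C * (k + 1) * sqrt (D k + 1)\<close>. Splitting
  off the 1 leaves the series given by the integral condition and a convergent series with weights
  \<open>(k + 1) / 2 ^ k\<close>.\<close>

lemma summable_entropy:
  assumes "summable (\<lambda>k. (1 / 2) ^ k * (real k + 1) * sqrt (real (D k)))" "0 \<le> C"
  shows "summable (\<lambda>k. (1 / 2) ^ k * sqrt (C * (real (D k) + 1) * (real k + 1)\<^sup>2))"
proof (rule summable_comparison_test')
  have "(\<lambda>k. of_nat (Suc k) * (1 / 2 :: real) ^ k) sums (1 / (1 - 1 / 2)\<^sup>2)"
    by (rule geometric_deriv_sums) simp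
  then have "summable (\<lambda>k. (1 / 2) ^ k * (real k + 1))"
    by (auto dest!: sums_summable simp: mult_ac add.commute)
  then show "summable (\<lambda>k. sqrt C * ((1 / 2) ^ k * (real k + 1) * sqrt (real (D k)) + (1 / 2) ^ k * (real k + 1)))"
    using assms(1) by (intro summable_mult summable_add)
  fix k
  have "sqrt (real (D k) + 1) \<le> sqrt (real (D k)) + 1"
    using sqrt_add_le_add_sqrt[of "real (D k)" 1] by simp
  then have "sqrt C * ((1 / 2) ^ k * (real k + 1)) * sqrt (real (D k) + 1)
      \<le> sqrt C * ((1 / 2) ^ k * (real k + 1)) * (sqrt (real (D k)) + 1)"
    using assms(2) by (intro mult_left_mono) auto
  then show "norm ((1 / 2) ^ k * sqrt (C * (real (D k) + 1) * (real k + 1)\<^sup>2))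
    \<le> sqrt C * ((1 / 2) ^ k * (real k + 1) * sqrt (real (D k)) + (1 / 2) ^ k * (real k + 1))"
  proof -
    have "sqrt (C * (real (D k) + 1) * (real k + 1)\<^sup>2)
      = sqrt C * sqrt (real (D k) + 1) * (real k + 1)"
      by (simp add: real_sqrt_mult)
    moreover assume "sqrt C * ((1 / 2) ^ k * (real k + 1)) * sqrt (real (D k) + 1)
      \<le> sqrt C * ((1 / 2) ^ k * (real k + 1)) * (sqrt (real (D k)) + 1)"
    ultimately show ?thesis using assms(2) by (simp add: abs_mult) (simp add: algebra_simps)
  qed
qed

lemma rho_dist_eq_nrm: "rho_dist P f g = semi_inner.nrm (covar P) (\<lambda>x. f x - g x)"
  if "semi_inner V (covar P)"
proof -
  interpret semi_inner V "covar P" by fact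
  show ?thesis by (simp add: rho_dist_def nrm_def covar_def power2_eq_square)
qed

text \<open>One probability space serves every \<open>P\<close>; the law \<open>P\<close> enters
  only through the coefficients of the process.\<close>

abbreviation path_measure :: "(('a \<Rightarrow> real) \<Rightarrow> real) measure" where
  "path_measure \<equiv> PiM UNIV (\<lambda>_. std_normal_distribution)"

text \<open>Both bounds depend on the measure only through \<open>H\<close>. With an
  \<open>H\<close> common to all \<open>P\<close> they are uniform.\<close>

lemma (in prob_space) exists_regular_G_P:
  fixes H :: "nat \<Rightarrow> real"
  assumes F: "F \<subseteq> unit_ball_Linf M" and H: "\<And>k. 0 \<le> H k" "summable (\<lambda>k. (1 / 2) ^ k * sqrt (H k))"
    and nets: "\<And>k. \<exists>T\<subseteq>F. finite T \<and> real (card T) \<le> exp (H k) \<and>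
      (\<forall>f\<in>F. \<exists>t\<in>T. semi_inner.nrm (covar M) (\<lambda>x. f x - t x) \<le> (1 / 2) ^ k)"
  shows "\<exists>G :: ('a \<Rightarrow> real) \<Rightarrow> (('a \<Rightarrow> real) \<Rightarrow> real) \<Rightarrow> real.
    is_G_P F M path_measure G \<and> regular_paths F M path_measure G \<and>
    (\<integral>\<^sup>+\<omega>. (SUP f\<in>F. ennreal \<bar>G f \<omega>\<bar>) \<partial>path_measure)
      \<le> ennreal (3 * sqrt (1 + H 0) + (\<Sum>j. chain_weight H j)) \<and>
    (\<forall>k \<delta>. \<delta> \<le> (1 / 2) ^ k \<longrightarrow>
      (\<integral>\<^sup>+\<omega>. (SUP (f, g)\<in>close_pairs F M \<delta>. ennreal \<bar>G f \<omega> - G g \<omega>\<bar>) \<partial>path_measure)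
      \<le> ennreal (3 * (\<Sum>j. chain_weight H (j + k))))"
proof -
  interpret semi_inner "bounded_funs M" "covar M" by (rule semi_inner_covar)
  interpret PP: product_prob_space "\<lambda>_ :: 'a \<Rightarrow> real. std_normal_distribution" UNIV
    by (intro product_prob_spaceI prob_space_normal_density) simp
  obtain T where T: "\<And>k. T k \<subseteq> F" "\<And>k. finite (T k)" "\<And>k. real (card (T k)) \<le> exp (H k)"
    "\<And>k f. f \<in> F \<Longrightarrow> \<exists>t\<in>T k. nrm (\<lambda>x. f x - t x) \<le> (1 / 2) ^ k"
    using nets by metis
  define \<pi> where "\<pi> k f = (SOME t. t \<in> T k \<and> nrm (\<lambda>x. f x - t x) \<le> (1 / 2) ^ k)" for k f
  have \<pi>: "\<pi> k f \<in> T k \<and> nrm (\<lambda>x. f x - \<pi> k f x) \<le> (1 / 2) ^ k" if "f \<in> F" for k f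
  proof -
    have "\<exists>t. t \<in> T k \<and> nrm (\<lambda>x. f x - t x) \<le> (1 / 2) ^ k"
      using T(4)[OF that, of k] by (simp only: Bex_def)
    from someI_ex[OF this] show ?thesis unfolding \<pi>_def .
  qed
  have F_sub: "F \<subseteq> bounded_funs M" using F unit_ball_sub_bounded_funs by blast
  have cnt: "countable (\<Union>k. T k)" by (rule countable_UN) (simp_all add: countable_finite T(2))
  have sub: "(\<Union>k. T k) \<subseteq> bounded_funs M" using T(1) F_sub by blast
  from exists_normal_family[OF cnt sub] obtain X :: "('a \<Rightarrow> real) \<Rightarrow> (('a \<Rightarrow> real) \<Rightarrow> real) \<Rightarrow> real"
    where X: "\<forall>n c t. (\<forall>i<n. t i \<in> (\<Union>k. T k)) \<longrightarrow>
    centered_normal path_measure (\<lambda>\<omega>. \<Sum>i<n. c i * X (t i) \<omega>) (nrm (\<lambda>x. \<Sum>i<n::nat. c i * t i x))"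
    by (elim exE) (rule that)
  have nrm1: "nrm f \<le> 1" if f: "f \<in> F" for f
  proof -
    have f': "f \<in> borel_measurable M" "\<And>x. x \<in> space M \<Longrightarrow> \<bar>f x\<bar> \<le> 1"
      using f F by (auto simp: unit_ball_Linf_def)
    have "covar M f f \<le> expectation (\<lambda>x. (f x)\<^sup>2)" by (simp add: covar_def power2_eq_square)
    also have "\<dots> \<le> expectation (\<lambda>_. 1)"
    proof (rule integral_mono)
      show "integrable M (\<lambda>x. (f x)\<^sup>2)"
        using bounded_funs_integrable[OF bounded_funs_mult] f F_sub by (auto simp: power2_eq_square)
      show "(f x)\<^sup>2 \<le> 1" if "x \<in> space M" for x using f'(2)[OF that] by (simp add: abs_square_le_1)
    qed simp
    finally show ?thesis by (simp add: nrm_def prob_space)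
  qed
  interpret chaining "bounded_funs M" "covar M" path_measure X F T \<pi> H
    by unfold_locales (use F_sub T H \<pi> nrm1 X[rule_format] in auto)
  have rho: "rho_dist M f g = nrm (\<lambda>x. f x - g x)" for f g
    by (rule rho_dist_eq_nrm[OF semi_inner_covar])
  have "is_G_P F M path_measure G"
    unfolding is_G_P_def using gaussian_process_G G_mean G_covariance by (simp add: covar_def)
  moreover have "regular_paths F M path_measure G"
    unfolding regular_paths_def rho using bounded_G uniformly_continuous_G by blast
  moreover have "(\<integral>\<^sup>+\<omega>. (SUP (f, g)\<in>close_pairs F M \<delta>. ennreal \<bar>G f \<omega> - G g \<omega>\<bar>) \<partial>path_measure)
      \<le> ennreal (3 * (\<Sum>j. chain_weight H (j + k)))" if "\<delta> \<le> (1 / 2) ^ k" for k \<delta>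
    by (rule nn_integral_SUP_G_diff_le) (use that in \<open>auto simp: close_pairs_def rho\<close>)
  ultimately show ?thesis using nn_integral_SUP_G_le by blast
qed

theorem corollary5p6:
  fixes M :: "'a measure" and F :: "('a \<Rightarrow> real) set"
  assumes "F \<subseteq> unit_ball_Linf M"
    and "(\<integral>\<^sup>+t\<in>{0<..1::real}. sqrt_enat (fat_dim M F (t / 8)) * ennreal (ln (2 / t)) \<partial>lborel) < \<infinity>"
  shows "uniform_donsker M F"
proof -
  obtain D :: "nat \<Rightarrow> nat" where D: "\<And>k. fat_dim M F ((1 / 2) ^ k / 8) = enat (D k)"
    and sum_D: "summable (\<lambda>k. (1 / 2) ^ k * (real k + 1) * sqrt (real (D k)))"
    using fat_dim_dyadic_bounds[OF assms(2)] by (elim exE conjE) metis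
  \<comment> \<open>Each term of the convergent series is at most its sum, so
    \<open>sqrt (D k) \<le> S * 2 ^ k\<close>. This is the growth condition of
    \<open>ln_card_bound\<close> with \<open>c = S\<^sup>2\<close>.\<close>
  define S where "S = (\<Sum>k. (1 / 2) ^ k * (real k + 1) * sqrt (real (D k)))"
  have D_le: "real (D k) \<le> S\<^sup>2 * 4 ^ k" for k
  proof -
    have "(1 / 2) ^ k * sqrt (D k) * 1 \<le> (1 / 2) ^ k * sqrt (D k) * (real k + 1)"
      by (intro mult_left_mono) auto
    also have "\<dots> \<le> S"
      using sum_le_suminf[OF sum_D, of "{k}"] unfolding S_def by (simp add: mult_ac)
    finally have "sqrt (D k) \<le> S * 2 ^ k" by (simp add: power_one_over field_simps)
    then have "(sqrt (D k))\<^sup>2 \<le> (S * 2 ^ k)\<^sup>2" by (intro power_mono) auto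
    also have "(S * 2 ^ k)\<^sup>2 = S\<^sup>2 * (2 ^ k)\<^sup>2" by (rule power_mult_distrib)
    also have "((2 :: real) ^ k)\<^sup>2 = 4 ^ k"
      unfolding power2_eq_square power_mult_distrib[symmetric] by simp
    finally show ?thesis by simp
  qed
  obtain C :: real where C: "0 < C"
    and C_bound: "\<forall>k d N. 1 \<le> N \<longrightarrow> real d \<le> S\<^sup>2 * 4 ^ k \<longrightarrow> card_bound k d N \<longrightarrow>
    ln (real N) \<le> C * (real d + 1) * (real k + 1)\<^sup>2"
    using ln_card_bound[of "S\<^sup>2"] by auto
  define H where "H k = C * (real (D k) + 1) * (real k + 1)\<^sup>2" for k
  have H: "\<And>k. 0 \<le> H k" "summable (\<lambda>k. (1 / 2) ^ k * sqrt (H k))"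
    using C summable_entropy[OF sum_D, of C] by (auto simp: H_def)
  define A where "A = 3 * sqrt (1 + H 0) + (\<Sum>j. chain_weight H j)"
  define r where "r k = 3 * (\<Sum>j. chain_weight H (j + k))" for k
  let ?good = "\<lambda>P (G :: ('a \<Rightarrow> real) \<Rightarrow> (('a \<Rightarrow> real) \<Rightarrow> real) \<Rightarrow> real).
    is_G_P F P path_measure G \<and> regular_paths F P path_measure G \<and>
    (\<integral>\<^sup>+\<omega>. (SUP f\<in>F. ennreal \<bar>G f \<omega>\<bar>) \<partial>path_measure) \<le> ennreal A \<and>
    (\<forall>k \<delta>. \<delta> \<le> (1 / 2) ^ k \<longrightarrow>
      (\<integral>\<^sup>+\<omega>. (SUP (f, g)\<in>close_pairs F P \<delta>. ennreal \<bar>G f \<omega> - G g \<omega>\<bar>) \<partial>path_measure) \<le> ennreal (r k))"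
  have "\<forall>P\<in>prob_measures_on M. \<exists>G. ?good P G"
  proof
    fix P assume P: "P \<in> prob_measures_on M"
    interpret P: prob_space P using P by (simp add: prob_measures_on_def)
    have sets: "sets P = sets M" using P by (simp add: prob_measures_on_def)
    have F: "F \<subseteq> unit_ball_Linf P" using assms(1) unit_ball_Linf_cong[OF sets] by simp
    show "\<exists>G. ?good P G" unfolding A_def r_def
    proof (rule P.exists_regular_G_P[OF F H])
      show "\<exists>T\<subseteq>F. finite T \<and> real (card T) \<le> exp (H k) \<and>
        (\<forall>f\<in>F. \<exists>t\<in>T. semi_inner.nrm (covar P) (\<lambda>x. f x - t x) \<le> (1 / 2) ^ k)" for k
        unfolding H_def
        by (rule P.covar_net[OF F _ D_le C_bound]) (simp add: fat_dim_cong[OF sets] D)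
    qed
  qed
  from bchoice[OF this] obtain G where all_good: "\<forall>P\<in>prob_measures_on M. ?good P (G P)"
    by (elim exE)
  note G = bspec[OF all_good]
  note G_P = G[THEN conjunct1] and regular = G[THEN conjunct2, THEN conjunct1]
    and sup_le = G[THEN conjunct2, THEN conjunct2, THEN conjunct1]
    and osc_le = G[THEN conjunct2, THEN conjunct2, THEN conjunct2, rule_format]
  let ?Osc = "\<lambda>\<delta>. SUP P\<in>prob_measures_on M.
    \<integral>\<^sup>+\<omega>. (SUP (f, g)\<in>close_pairs F P \<delta>. ennreal \<bar>G P f \<omega> - G P g \<omega>\<bar>) \<partial>path_measure"
  have "(SUP P\<in>prob_measures_on M. \<integral>\<^sup>+\<omega>. (SUP f\<in>F. ennreal \<bar>G P f \<omega>\<bar>) \<partial>path_measure) \<le> ennreal A"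
    by (rule SUP_least) (rule sup_le)
  also have "ennreal A < \<infinity>" by simp
  finally have bounded: "(SUP P\<in>prob_measures_on M.
    \<integral>\<^sup>+\<omega>. (SUP f\<in>F. ennreal \<bar>G P f \<omega>\<bar>) \<partial>path_measure) < \<infinity>" .
  have Osc_le: "?Osc \<delta> \<le> ennreal (r k)" if "\<delta> \<le> (1 / 2) ^ k" for \<delta> k
    by (rule SUP_least) (rule osc_le[OF _ that])
  have "(?Osc \<longlongrightarrow> 0) (at_right 0)"
  proof (rule order_tendstoI)
    fix a :: ennreal assume "0 < a"
    have "(\<lambda>k. ennreal (r k)) \<longlonglongrightarrow> ennreal (3 * 0)"
      unfolding r_def by (intro tendsto_intros tendsto_suminf_tail summable_chain_weight H(2))
    then have "\<forall>\<^sub>F k in sequentially. ennreal (r k) < a" using \<open>0 < a\<close>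
      by (intro order_tendstoD(2)) auto
    then obtain k where k: "ennreal (r k) < a" by (auto simp: eventually_sequentially)
    \<comment> \<open>One scale with small tail bounds the oscillation for all smaller \<delta> and
      all \<open>P\<close> together.\<close>
    have "\<forall>\<^sub>F \<delta> in at_right 0. \<delta> < (1 / 2 :: real) ^ k"
      unfolding eventually_at_right_field by (intro exI[of _ "(1 / 2) ^ k"]) simp
    then show "\<forall>\<^sub>F \<delta> in at_right 0. ?Osc \<delta> < a"
    proof eventually_elim
      case (elim \<delta>)
      then show ?case by (intro order.strict_trans1[OF Osc_le k]) simp
    qed
  qed simp
  then show ?thesis
    unfolding uniform_donsker_def using bounded G_P regular
    by (intro exI[of _ "\<lambda>_. path_measure"] exI[of _ G] conjI ballI)
qed

end
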